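(* Let $\Omega\subset\mathbb{R}^n$ be an open set and let $V=v(M,\theta)$ be a rectifiable $d$-varifold in $\Omega$ with bounded first variation and generalized mean curvature $H$. Let the kernel profiles $(\rho,\xi)$ be such that $\rho\in W^{2,\infty}$ and $\xi\in W^{1,\infty}$. Let $(V_i)_i$ be a sequence of $d$-varifolds in $\Omega$ for which there exist two positive, decreasing sequences $(\eta_i)_i,(d_i)_i$ converging to $0$ such that for any ball $B\subset\Omega$ centered in $\mathrm{spt}\,\|V\|$ one has \[ \Delta^{1,1}_B(V,V_i)\le d_i\min\big(\|V\|(B^{\eta_i}),\|V_i\|(B^{\eta_i})\big). \] Then for $\|V\|$-almost every $x\in\Omega$, for every sequence $(z_i)_i$ of points tending to $x$, and for every positive, decreasing sequence $(\epsilon_i)_i$ converging to $0$ such that \[ \frac{d_i+|x-z_i|}{\epsilon_i^2}\to0\quad\text{and}\quad\frac{\eta_i}{\epsilon_i}\to0\qquad\text{as }i\to\infty, \] there is a constant $C>0$ such that \[ \left|H^{V_i}_{\rho,\xi,\epsilon_i}(z_i)-H^{V}_{\rho,\xi,\epsilon_i}(x)\right|\le C\,\|\rho\|_{W^{2,\infty}}\,\frac{d_i+|x-z_i|}{\epsilon_i^2}\qquad\text{for all $i$ large enough,} \] and \[ H^{V_i}_{\rho,\xi,\epsilon_i}(z_i)\longrightarrow H(x)\qquad\text{as }i\to\infty . \]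
   Context: Fix integers $1\le d<n$. $G_{d,n}$ is the Grassmannian of $d$-dimensional linear subspaces of $\mathbb{R}^n$; a subspace $S$ is identified with the orthogonal projection $\Pi_S$ onto it, with metric $\|S-P\|$ (operator norm). A $d$-varifold in $\Omega$ is a non-negative Radon measure $V$ on $\Omega\times G_{d,n}$; its mass is $\|V\|(B)=V(B\times G_{d,n})$. The rectifiable $d$-varifold $V=v(M,\theta)$, with $M$ countably $d$-rectifiable and $\theta>0$ $\mathcal{H}^d$-a.e. on $M$, is given by $\int\varphi\,dV=\int_M\varphi(x,T_xM)\theta(x)\,d\mathcal{H}^d(x)$ for $\varphi\in C_c^0(\Omega\times G_{d,n})$, with $T_xM$ the approximate tangent space. First variation: $\delta V(X)=\int\mathrm{div}_SX(x)\,dV(x,S)$ for $X\in C_c^1(\Omega,\mathbb{R}^n)$, $\mathrm{div}_SX=\sum_{j=1}^n\langle\Pi_S(\nabla X_j),e_j\rangle$. $V$ has bounded first variation if $|\delta V(X)|\le C\sup|X|$ for all such $X$; then $\delta V$ is an $\mathbb{R}^n$-valued Radon measure, decomposed as $\delta V=-H\|V\|+\delta V_s$ with $\delta V_s$ singular with respect to $\|V\|$; $H$ is the generalized mean curvature. Localized bounded Lipschitz distance: for $U\subset\Omega$ open, $\Delta^{1,1}_U(V,W)$ is the supremum of $\left|\int\varphi\,dV-\int\varphi\,dW\right|$ over all $1$-Lipschitz $\varphi:\Omega\times G_{d,n}\to\mathbb{R}$ with $\|\varphi\|_\infty\le1$ and $\mathrm{spt}\,\varphi\subset U\times G_{d,n}$,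 where $\Omega\times G_{d,n}$ carries the metric $|x-y|+\|S-T\|$. For a set $A$, $A^\eta=\bigcup_{x\in A}B_\eta(x)$ (masses of $A^\eta$ are understood as masses of $A^\eta\cap\Omega$). Kernels: $\rho,\xi:\mathbb{R}\to[0,\infty)$ are even with support in $[-1,1]$, $\rho\in C^1$, $\xi\in C^0$; $\rho_1(x)=\rho(|x|)$ and $\xi_1(x)=\xi(|x|)$ on $\mathbb{R}^n$ have integral $1$; $\rho_\epsilon(x)=\epsilon^{-n}\rho_1(x/\epsilon)$, $\xi_\epsilon(x)=\epsilon^{-n}\xi_1(x/\epsilon)$. $\|\rho\|_{W^{2,\infty}}=\|\rho\|_\infty+\|\rho'\|_\infty+\mathrm{lip}(\rho')$. Set $C_\rho=d\,\omega_d\int_0^1\rho(r)r^{d-1}dr$, $C_\xi=d\,\omega_d\int_0^1\xi(r)r^{d-1}dr$, $\omega_d$ the volume of the unit ball of $\mathbb{R}^d$. Define \[ \delta V\ast\rho_\epsilon(x)=\int_{\Omega\times G_{d,n}}\Pi_S\big(\nabla\rho_\epsilon(y-x)\big)\,dV(y,S),\qquad \|V\|\ast\xi_\epsilon(x)=\int_\Omega\xi_\epsilon(y-x)\,d\|V\|(y) \] (well defined whenever $\overline{B_\epsilon(x)}\subset\Omega$). The approximate mean curvature of $V$ at $x$ is, whenever $\|V\|\ast\xi_\epsilon(x)>0$, $H^V_{\rho,\xi,\epsilon}(x)=-\frac{C_\xi}{C_\rho}\,\frac{\delta V\ast\rho_\epsilon(x)}{\|V\|\ast\xi_\epsilon(x)}$.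 *)

theory Defs
  imports "HOL-Analysis.Analysis"
begin

section \<open>The Grassmannian\<close>

text \<open>A subspace is represented by the orthogonal projection onto it, an element of the space of
  bounded linear maps; \<^const>\<open>norm\<close> (hence \<^const>\<open>dist\<close>) on that type is the operator norm.\<close>

definition orth_proj :: "'a::euclidean_space set \<Rightarrow> 'a \<Rightarrow>\<^sub>L 'a" where
  "orth_proj S = Blinfun (closest_point S)"

definition grassmannian :: "nat \<Rightarrow> ('a::euclidean_space \<Rightarrow>\<^sub>L 'a) set" where
  "grassmannian d = {orth_proj S | S. subspace S \<and> dim S = d}"

lemma closest_point_subspace:
  fixes S :: "'a::euclidean_space set"
  assumes S: "subspace S"
  shows "closest_point S x \<in> S" "y \<in> S \<Longrightarrow> orthogonal (x - closest_point S x) y"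
proof -
  let ?p = "closest_point S x"
  have ne: "S \<noteq> {}" and cl: "closed S" and cv: "convex S"
    using S by (auto simp: closed_subspace subspace_imp_convex dest: subspace_0)
  show p: "?p \<in> S"
    by (rule closest_point_in_set[OF cl ne])
  show "orthogonal (x - ?p) y" if "y \<in> S"
  proof -
    have "(x - ?p) \<bullet> ((?p + y) - ?p) \<le> 0" "(x - ?p) \<bullet> ((?p - y) - ?p) \<le> 0"
      by (intro closest_point_dot[OF cv cl] subspace_add[OF S p that] subspace_diff[OF S p that])+
    then show ?thesis
      by (simp add: orthogonal_def)
  qed
qed

lemma orth_proj_unique:
  fixes S :: "'a::euclidean_space set"
  assumes S: "subspace S" and p: "p \<in> S" and o: "\<And>y. y \<in> S \<Longrightarrow> orthogonal (x - p) y"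
  shows "closest_point S x = p"
proof -
  let ?q = "closest_point S x"
  have qp: "?q - p \<in> S"
    using S closest_point_subspace(1)[OF S] p by (simp add: subspace_diff)
  have "(x - p) \<bullet> (?q - p) = 0" "(x - ?q) \<bullet> (?q - p) = 0"
    using o[OF qp] closest_point_subspace(2)[OF S qp] by (auto simp: orthogonal_def)
  then have "(?q - p) \<bullet> (?q - p) = 0"
    by (simp add: inner_diff_left)
  then show ?thesis
    by simp
qed

lemma orth_proj_apply:
  fixes S :: "'a::euclidean_space set"
  assumes S: "subspace S"
  shows "blinfun_apply (orth_proj S) x = closest_point S x"
proof -
  have "linear (closest_point S)"
  proof (rule linearI)
    fix x y :: 'a and r :: real
    note c = closest_point_subspace[OF S]
    show "closest_point S (x + y) = closest_point S x + closest_point S y"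
    proof (rule orth_proj_unique[OF S])
      show "closest_point S x + closest_point S y \<in> S"
        by (intro subspace_add S c)
      show "orthogonal (x + y - (closest_point S x + closest_point S y)) v" if "v \<in> S" for v
        using c(2)[OF that, of x] c(2)[OF that, of y] by (simp add: orthogonal_def algebra_simps)
    qed
    show "closest_point S (r *\<^sub>R x) = r *\<^sub>R closest_point S x"
    proof (rule orth_proj_unique[OF S])
      show "r *\<^sub>R closest_point S x \<in> S"
        by (intro subspace_scale S c)
      show "orthogonal (r *\<^sub>R x - r *\<^sub>R closest_point S x) v" if "v \<in> S" for v
        using c(2)[OF that, of x] by (simp add: orthogonal_def inner_diff_left)
    qed
  qed
  then show ?thesis
    unfolding orth_proj_def by (simp add: bounded_linear_Blinfun_apply linear_conv_bounded_linear)
qed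


section \<open>Hausdorff measure and rectifiable sets\<close>

text \<open>Covering sets are required to be bounded because \<^const>\<open>diameter\<close> carries no information
  on unbounded sets.\<close>

definition hausdorff_pre :: "nat \<Rightarrow> real \<Rightarrow> 'a::euclidean_space set \<Rightarrow> ennreal" where
  "hausdorff_pre d \<delta> A =
     (INF C \<in> {C :: nat \<Rightarrow> 'a set. (\<forall>j. bounded (C j) \<and> diameter (C j) \<le> \<delta>) \<and> A \<subseteq> (\<Union>j. C j)}.
        \<Sum>j. ennreal (unit_ball_vol (real d) * (diameter (C j) / 2) ^ d))"

definition hausdorff_outer :: "nat \<Rightarrow> 'a::euclidean_space set \<Rightarrow> ennreal" where
  "hausdorff_outer d A = (SUP \<delta>\<in>{0<..}. hausdorff_pre d \<delta> A)"

text \<open>The measurable sets are the Caratheodory-measurable ones.\<close>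

definition hausdorff_measure :: "nat \<Rightarrow> 'a::euclidean_space measure" where
  "hausdorff_measure d =
     measure_of UNIV (lambda_system UNIV (Pow UNIV) (hausdorff_outer d)) (hausdorff_outer d)"

lemma hausdorff_pre_subadditive:
  fixes A :: "nat \<Rightarrow> 'a::euclidean_space set"
  shows "hausdorff_pre d \<delta> (\<Union>i. A i) \<le> (\<Sum>i. hausdorff_pre d \<delta> (A i))"
proof (rule ennreal_le_epsilon)
  fix e :: real assume e: "0 < e" and fin: "(\<Sum>i. hausdorff_pre d \<delta> (A i)) < top"
  let ?w = "\<lambda>C :: 'a set. ennreal (unit_ball_vol (real d) * (diameter C / 2) ^ d)"
  have "\<exists>C. (\<forall>j. bounded (C j) \<and> diameter (C j) \<le> \<delta>) \<and> A i \<subseteq> (\<Union>j. C j) \<and>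
      (\<Sum>j. ?w (C j)) \<le> hausdorff_pre d \<delta> (A i) + ennreal (e * (1 / 2) ^ Suc i)" for i
  proof -
    have "hausdorff_pre d \<delta> (A i) \<noteq> top"
      using ennreal_suminf_lessD[OF fin] by (simp add: less_top)
    then have "hausdorff_pre d \<delta> (A i) < hausdorff_pre d \<delta> (A i) + ennreal (e * (1 / 2) ^ Suc i)"
      using e by (simp add: ennreal_add_left_cancel_less top.not_eq_extremum)
    then show ?thesis
      by (subst (asm) hausdorff_pre_def) (auto simp: INF_less_iff intro: less_imp_le)
  qed
  then obtain C where C: "\<And>i j. bounded (C i j)" "\<And>i j. diameter (C i j) \<le> \<delta>"
    "\<And>i. A i \<subseteq> (\<Union>j. C i j)"
    "\<And>i. (\<Sum>j. ?w (C i j)) \<le> hausdorff_pre d \<delta> (A i) + ennreal (e * (1 / 2) ^ Suc i)"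
    by metis
  define D where "D = case_prod C \<circ> prod_decode"
  have cover: "(\<Union>i. A i) \<subseteq> (\<Union>j. D j)"
  proof
    fix x assume "x \<in> (\<Union>i. A i)"
    then obtain i j where "x \<in> C i j"
      using C(3) by blast
    then have "x \<in> D (prod_encode (i, j))"
      by (simp add: D_def)
    then show "x \<in> (\<Union>j. D j)"
      by blast
  qed
  have "hausdorff_pre d \<delta> (\<Union>i. A i) \<le> (\<Sum>j. ?w (D j))"
    unfolding hausdorff_pre_def using cover C(1,2)
    by (intro INF_lower) (auto simp: D_def split: prod.split)
  also have "\<dots> = (\<Sum>j. (\<lambda>p. ?w (case_prod C p)) (prod_decode j))"
    by (simp add: D_def)
  also have "\<dots> = (\<Sum>i. \<Sum>j. ?w (C i j))"
    using suminf_ennreal_2dimen[of "\<lambda>i. \<Sum>j. ?w (C i j)" "\<lambda>p. ?w (case_prod C p)"]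
    by (simp add: o_def)
  also have "\<dots> \<le> (\<Sum>i. hausdorff_pre d \<delta> (A i) + ennreal (e * (1 / 2) ^ Suc i))"
    by (intro suminf_le C(4)) auto
  also have "\<dots> = (\<Sum>i. hausdorff_pre d \<delta> (A i)) + (\<Sum>i. ennreal (e * (1 / 2) ^ Suc i))"
    by (simp add: suminf_add)
  also have "(\<Sum>i. ennreal (e * (1 / 2) ^ Suc i)) = ennreal e"
  proof (rule suminf_ennreal_eq)
    show "0 \<le> e * (1 / 2) ^ Suc i" for i
      using e by simp
    show "(\<lambda>i. e * (1 / 2) ^ Suc i) sums e"
      using sums_mult[OF power_half_series, of e] by simp
  qed
  finally show "hausdorff_pre d \<delta> (\<Union>i. A i) \<le> (\<Sum>i. hausdorff_pre d \<delta> (A i)) + ennreal e" .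
qed

lemma outer_measure_space_hausdorff:
  assumes "1 \<le> d"
  shows "outer_measure_space (Pow UNIV) (hausdorff_outer d :: 'a::euclidean_space set \<Rightarrow> ennreal)"
  unfolding outer_measure_space_def
proof (intro conjI)
  have "hausdorff_pre d \<delta> ({} :: 'a set) = 0" if "0 < \<delta>" for \<delta>
  proof -
    have "hausdorff_pre d \<delta> ({} :: 'a set) \<le>
        (\<Sum>j::nat. ennreal (unit_ball_vol (real d) * (diameter ({} :: 'a set) / 2) ^ d))"
      unfolding hausdorff_pre_def using that by (intro INF_lower) auto
    then show ?thesis
      using assms by (simp add: zero_power)
  qed
  then show "positive (Pow UNIV) (hausdorff_outer d :: 'a set \<Rightarrow> ennreal)"
    by (auto simp: positive_def hausdorff_outer_def)
  have "hausdorff_pre d \<delta> A \<le> hausdorff_pre d \<delta> B" if "A \<subseteq> B" for \<delta> and A B :: "'a set"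
    unfolding hausdorff_pre_def using that by (intro INF_superset_mono) auto
  then show "increasing (Pow UNIV) (hausdorff_outer d :: 'a set \<Rightarrow> ennreal)"
    unfolding increasing_def hausdorff_outer_def by (blast intro: SUP_mono)
  show "countably_subadditive (Pow UNIV) (hausdorff_outer d :: 'a set \<Rightarrow> ennreal)"
    unfolding countably_subadditive_def
  proof (intro allI impI)
    fix A :: "nat \<Rightarrow> 'a set"
    have "hausdorff_pre d \<delta> (\<Union>i. A i) \<le> (\<Sum>i. hausdorff_outer d (A i))" if "0 < \<delta>" for \<delta>
      using that
      by (intro order_trans[OF hausdorff_pre_subadditive] suminf_le)
         (auto simp: hausdorff_outer_def intro: SUP_upper)
    then show "hausdorff_outer d (\<Union>i. A i) \<le> (\<Sum>i. hausdorff_outer d (A i))"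
      unfolding hausdorff_outer_def[of d "\<Union>i. A i"] by (intro SUP_least) auto
  qed
qed

lemma hausdorff_measure_eq:
  assumes "1 \<le> d"
  shows "sets (hausdorff_measure d :: 'a::euclidean_space measure)
           = lambda_system UNIV (Pow UNIV) (hausdorff_outer d)"
    and "A \<in> sets (hausdorff_measure d :: 'a measure) \<Longrightarrow>
           emeasure (hausdorff_measure d) A = hausdorff_outer d A"
proof -
  let ?L = "lambda_system UNIV (Pow UNIV) (hausdorff_outer d :: 'a set \<Rightarrow> ennreal)"
  have ms: "measure_space UNIV ?L (hausdorff_outer d)"
    by (rule sigma_algebra.caratheodory_lemma
          [OF sigma_algebra_Pow outer_measure_space_hausdorff[OF assms]])
  then have L: "sigma_sets UNIV ?L = ?L"
    by (simp add: measure_space_def sigma_algebra.sigma_sets_eq)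
  show s: "sets (hausdorff_measure d :: 'a measure) = ?L"
    unfolding hausdorff_measure_def using L by (subst sets_measure_of) (blast, assumption)
  show "A \<in> sets (hausdorff_measure d :: 'a measure) \<Longrightarrow>
      emeasure (hausdorff_measure d) A = hausdorff_outer d A"
    using ms s unfolding hausdorff_measure_def
    by (intro emeasure_measure_of_sigma) (auto simp: measure_space_def)
qed

text \<open>The subspace \<open>P\<close> is an isometric copy of \<open>\<real>\<^sup>d\<close>, available because \<open>d\<close> is at most the dimension
  of the ambient space.\<close>

definition countably_rectifiable :: "nat \<Rightarrow> 'a::euclidean_space set \<Rightarrow> bool" where
  "countably_rectifiable d M \<longleftrightarrow>
     M \<in> sets (hausdorff_measure d) \<and>
     (\<exists>N P (f :: nat \<Rightarrow> 'a \<Rightarrow> 'a).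
        hausdorff_outer d N = 0 \<and> subspace P \<and> dim P = d \<and>
        (\<forall>j. \<exists>L. L-lipschitz_on P (f j)) \<and>
        M \<subseteq> N \<union> (\<Union>j. f j ` P))"

text \<open>The approximate tangent space of \<open>M\<close> at \<open>x\<close> (with respect to the multiplicity \<open>\<theta>\<close>, as in
  Simon's lectures): the blow-ups of \<open>\<theta> \<H>\<^sup>d\<close> restricted to \<open>M\<close> converge to \<open>\<theta>(x) \<H>\<^sup>d\<close> restricted
  to \<open>P\<close>. Such a \<open>P\<close> is unique if \<open>\<theta>(x) > 0\<close>.\<close>

definition approx_tangent_space ::
  "nat \<Rightarrow> 'a::euclidean_space set \<Rightarrow> ('a \<Rightarrow> real) \<Rightarrow> 'a \<Rightarrow> 'a set \<Rightarrow> bool" where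
  "approx_tangent_space d M \<theta> x P \<longleftrightarrow>
     subspace P \<and> dim P = d \<and>
     (\<forall>f :: 'a \<Rightarrow> real. continuous_on UNIV f \<and> compact (closure {y. f y \<noteq> 0}) \<longrightarrow>
        ((\<lambda>r. (\<integral>y\<in>M. f ((y - x) /\<^sub>R r) * \<theta> y \<partial>hausdorff_measure d) / r ^ d)
           \<longlongrightarrow> \<theta> x * (\<integral>y\<in>P. f y \<partial>hausdorff_measure d)) (at_right 0))"


section \<open>Varifolds\<close>

text \<open>On a locally compact, \<open>\<sigma>\<close>-compact metric space the regularity of a locally finite Borel
  measure is automatic.\<close>

definition radon_measure_on :: "'b::topological_space set \<Rightarrow> 'b measure \<Rightarrow> bool" where
  "radon_measure_on X \<mu> \<longleftrightarrow>
     sets \<mu> = sets (restrict_space borel X) \<and>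
     (\<forall>K. compact K \<and> K \<subseteq> X \<longrightarrow> emeasure \<mu> K < \<infinity>)"

definition varifold ::
  "nat \<Rightarrow> 'a::euclidean_space set \<Rightarrow> ('a \<times> ('a \<Rightarrow>\<^sub>L 'a)) measure \<Rightarrow> bool" where
  "varifold d \<Omega> V \<longleftrightarrow> radon_measure_on (\<Omega> \<times> grassmannian d) V"

definition mass ::
  "'a::euclidean_space set \<Rightarrow> ('a \<times> ('a \<Rightarrow>\<^sub>L 'a)) measure \<Rightarrow> 'a measure" where
  "mass \<Omega> V = distr V (restrict_space borel \<Omega>) fst"

lemma emeasure_mass:
  assumes V: "varifold d \<Omega> V" and B: "B \<in> sets (restrict_space borel \<Omega>)"
  shows "emeasure (mass \<Omega> V) B = emeasure V (B \<times> grassmannian d)"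
proof -
  have s: "sets V = sets (restrict_space borel (\<Omega> \<times> grassmannian d))"
    using V by (simp add: varifold_def radon_measure_on_def)
  then have sp: "space V = \<Omega> \<times> grassmannian d"
    using sets_eq_imp_space_eq[OF s] by (simp add: space_restrict_space)
  have "fst \<in> borel_measurable (restrict_space borel (\<Omega> \<times> grassmannian d))"
    by (intro measurable_restrict_space1 borel_measurable_continuous_onI continuous_intros)
  then have m: "fst \<in> measurable V (restrict_space borel \<Omega>)"
    using sp sets_eq_imp_space_eq[OF s]
    by (auto simp: measurable_restrict_space2_iff measurable_cong_sets[OF s refl])
  have "B \<subseteq> \<Omega>"
    using sets.sets_into_space[OF B] by (simp add: space_restrict_space)
  then have "fst -` B \<inter> space V = B \<times> grassmannian d"
    using sp by auto
  then show ?thesis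
    unfolding mass_def using emeasure_distr[OF m B] by simp
qed

definition mass_support ::
  "'a::euclidean_space set \<Rightarrow> ('a \<times> ('a \<Rightarrow>\<^sub>L 'a)) measure \<Rightarrow> 'a set" where
  "mass_support \<Omega> V = {x \<in> \<Omega>. \<forall>r>0. emeasure (mass \<Omega> V) (ball x r \<inter> \<Omega>) > 0}"

text \<open>\<open>V = v(M, \<theta>)\<close>. Local integrability of \<open>\<theta>\<close> and measurability of the tangent field \<open>T\<close>, both
  consequences of \<open>V\<close> being a Radon measure and \<open>T\<close> being the approximate tangent field, are spelled
  out so that the integrals are genuine rather than default values.\<close>

definition rectifiable_varifold ::
  "nat \<Rightarrow> 'a::euclidean_space set \<Rightarrow> 'a set \<Rightarrow> ('a \<Rightarrow> real) \<Rightarrow>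
     ('a \<times> ('a \<Rightarrow>\<^sub>L 'a)) measure \<Rightarrow> bool" where
  "rectifiable_varifold d \<Omega> M \<theta> V \<longleftrightarrow>
     varifold d \<Omega> V \<and>
     M \<subseteq> \<Omega> \<and> countably_rectifiable d M \<and>
     set_borel_measurable (hausdorff_measure d) M \<theta> \<and>
     (AE x in hausdorff_measure d. x \<in> M \<longrightarrow> 0 < \<theta> x) \<and>
     (\<forall>K. compact K \<and> K \<subseteq> \<Omega> \<longrightarrow> set_integrable (hausdorff_measure d) (M \<inter> K) \<theta>) \<and>
     (\<exists>T :: 'a \<Rightarrow> 'a set.
        (AE x in hausdorff_measure d. x \<in> M \<longrightarrow> approx_tangent_space d M \<theta> x (T x)) \<and>
        set_borel_measurable (hausdorff_measure d) M (\<lambda>x. orth_proj (T x)) \<and>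
        (\<forall>\<phi> :: 'a \<times> ('a \<Rightarrow>\<^sub>L 'a) \<Rightarrow> real.
           continuous_on (\<Omega> \<times> grassmannian d) \<phi> \<and>
           (\<exists>K. compact K \<and> K \<subseteq> \<Omega> \<times> grassmannian d \<and>
                (\<forall>p \<in> \<Omega> \<times> grassmannian d - K. \<phi> p = 0)) \<longrightarrow>
           (\<integral>p. \<phi> p \<partial>V) = (\<integral>x\<in>M. \<phi> (x, orth_proj (T x)) * \<theta> x \<partial>hausdorff_measure d)))"


section \<open>First variation and generalized mean curvature\<close>

definition gradient :: "('a::euclidean_space \<Rightarrow> real) \<Rightarrow> 'a \<Rightarrow> 'a" where
  "gradient f x = (THE D. GDERIV f x :> D)"

lemma gradient_eqI:
  assumes "GDERIV f x :> D"
  shows "gradient f x = D"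
  unfolding gradient_def
proof (rule the_equality)
  show "GDERIV f x :> D" by (fact assms)
  fix D' assume "GDERIV f x :> D'"
  then have "(\<lambda>h. h \<bullet> D') = (\<lambda>h. h \<bullet> D)"
    using assms unfolding gderiv_def by (rule has_derivative_unique)
  then show "D' = D"
    by (metis vector_eq_ldot)
qed

definition C1_compact_support ::
  "'a::euclidean_space set \<Rightarrow> ('a \<Rightarrow> 'a) \<Rightarrow> bool" where
  "C1_compact_support \<Omega> X \<longleftrightarrow>
     (\<exists>X'. (\<forall>x. (X has_derivative blinfun_apply (X' x)) (at x)) \<and> continuous_on UNIV X') \<and>
     compact (closure {x. X x \<noteq> 0}) \<and> closure {x. X x \<noteq> 0} \<subseteq> \<Omega>"

definition tangential_div ::
  "('a::euclidean_space \<Rightarrow>\<^sub>L 'a) \<Rightarrow> ('a \<Rightarrow> 'a) \<Rightarrow> 'a \<Rightarrow> real" where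
  "tangential_div S X x = (\<Sum>e\<in>Basis. blinfun_apply S (gradient (\<lambda>y. X y \<bullet> e) x) \<bullet> e)"

definition first_variation ::
  "('a::euclidean_space \<times> ('a \<Rightarrow>\<^sub>L 'a)) measure \<Rightarrow> ('a \<Rightarrow> 'a) \<Rightarrow> real" where
  "first_variation V X = (\<integral>p. tangential_div (snd p) X (fst p) \<partial>V)"

definition bounded_first_variation ::
  "'a::euclidean_space set \<Rightarrow> ('a \<times> ('a \<Rightarrow>\<^sub>L 'a)) measure \<Rightarrow> bool" where
  "bounded_first_variation \<Omega> V \<longleftrightarrow>
     (\<exists>C. \<forall>X. C1_compact_support \<Omega> X \<longrightarrow> \<bar>first_variation V X\<bar> \<le> C * (SUP x. norm (X x)))"

text \<open>\<open>\<delta>V = - H \<parallel>V\<parallel> + \<delta>V\<^sub>s\<close>, where the vector-valued Radon measure \<open>\<delta>V\<^sub>s\<close> is given by its polar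
  decomposition \<open>\<nu> \<sigma>\<close> (so \<open>\<sigma>\<close> is its total variation) and is concentrated on a
  \<open>\<parallel>V\<parallel>\<close>-null set \<open>N\<close>.\<close>

definition generalized_mean_curvature ::
  "'a::euclidean_space set \<Rightarrow> ('a \<times> ('a \<Rightarrow>\<^sub>L 'a)) measure \<Rightarrow> ('a \<Rightarrow> 'a) \<Rightarrow> bool" where
  "generalized_mean_curvature \<Omega> V H \<longleftrightarrow>
     H \<in> borel_measurable (mass \<Omega> V) \<and>
     (\<forall>K. compact K \<and> K \<subseteq> \<Omega> \<longrightarrow> set_integrable (mass \<Omega> V) K H) \<and>
     (\<exists>\<sigma> \<nu>. radon_measure_on \<Omega> \<sigma> \<and>
        \<nu> \<in> borel_measurable \<sigma> \<and> (AE x in \<sigma>. norm (\<nu> x) = 1) \<and>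
        (\<exists>N \<in> sets (restrict_space borel \<Omega>).
           emeasure (mass \<Omega> V) N = 0 \<and> emeasure \<sigma> (\<Omega> - N) = 0) \<and>
        (\<forall>X. C1_compact_support \<Omega> X \<longrightarrow>
           first_variation V X = - (\<integral>x. X x \<bullet> H x \<partial>mass \<Omega> V) + (\<integral>x. X x \<bullet> \<nu> x \<partial>\<sigma>)))"


section \<open>Localized bounded Lipschitz distance\<close>

text \<open>The product metric is the sum of the two distances, not the library's Euclidean one, and
  supports are closures relative to \<open>\<Omega> \<times> grassmannian d\<close>. A Radon measure may have infinite mass on
  \<open>U \<times> grassmannian d\<close> when \<open>U\<close> touches the boundary of \<open>\<Omega>\<close>; the supremum then ranges over those
  test functions for which both integrals exist. Test functions with compact support always do.\<close>

definition bounded_lipschitz_dist ::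
  "nat \<Rightarrow> 'a::euclidean_space set \<Rightarrow> 'a set \<Rightarrow> ('a \<times> ('a \<Rightarrow>\<^sub>L 'a)) measure \<Rightarrow>
     ('a \<times> ('a \<Rightarrow>\<^sub>L 'a)) measure \<Rightarrow> ennreal" where
  "bounded_lipschitz_dist d \<Omega> U V W =
     (SUP \<phi> \<in> {\<phi> :: 'a \<times> ('a \<Rightarrow>\<^sub>L 'a) \<Rightarrow> real.
         (\<forall>x\<in>\<Omega>. \<forall>y\<in>\<Omega>. \<forall>S\<in>grassmannian d. \<forall>T\<in>grassmannian d.
            \<bar>\<phi> (x, S) - \<phi> (y, T)\<bar> \<le> dist x y + dist S T) \<and>
         (\<forall>p \<in> \<Omega> \<times> grassmannian d. \<bar>\<phi> p\<bar> \<le> 1) \<and>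
         closure {p \<in> \<Omega> \<times> grassmannian d. \<phi> p \<noteq> 0} \<inter> (\<Omega> \<times> grassmannian d)
           \<subseteq> U \<times> grassmannian d \<and>
         integrable V \<phi> \<and> integrable W \<phi>}.
       ennreal \<bar>(\<integral>p. \<phi> p \<partial>V) - (\<integral>p. \<phi> p \<partial>W)\<bar>)"

definition thickening :: "real \<Rightarrow> 'a::euclidean_space set \<Rightarrow> 'a set" where
  "thickening \<eta> A = (\<Union>x\<in>A. ball x \<eta>)"


section \<open>Kernels and approximate mean curvature\<close>

definition W1_infinity :: "(real \<Rightarrow> real) \<Rightarrow> bool" where
  "W1_infinity f \<longleftrightarrow> bounded (range f) \<and> (\<exists>L. L-lipschitz_on UNIV f)"

text \<open>Only applied to profiles of class \<open>C\<^sup>1\<close>, so that \<^const>\<open>deriv\<close> is the derivative.\<close>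

definition W2_infinity :: "(real \<Rightarrow> real) \<Rightarrow> bool" where
  "W2_infinity f \<longleftrightarrow> bounded (range f) \<and> W1_infinity (deriv f)"

definition W2_infinity_norm :: "(real \<Rightarrow> real) \<Rightarrow> real" where
  "W2_infinity_norm f =
     (SUP t. \<bar>f t\<bar>) + (SUP t. \<bar>deriv f t\<bar>) + Inf {L. L-lipschitz_on UNIV (deriv f)}"

text \<open>The type argument fixes the space \<open>\<real>\<^sup>n\<close> on which the radial kernel is normalized.\<close>

definition kernel_profile :: "'a::euclidean_space itself \<Rightarrow> (real \<Rightarrow> real) \<Rightarrow> bool" where
  "kernel_profile _ f \<longleftrightarrow>
     (\<forall>t. 0 \<le> f t) \<and> (\<forall>t. f (- t) = f t) \<and> (\<forall>t. 1 < \<bar>t\<bar> \<longrightarrow> f t = 0) \<and>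
     (\<integral>x. f (norm (x :: 'a)) \<partial>lborel) = 1"

definition scaled_kernel :: "(real \<Rightarrow> real) \<Rightarrow> real \<Rightarrow> 'a::euclidean_space \<Rightarrow> real" where
  "scaled_kernel f \<epsilon> x = f (norm (x /\<^sub>R \<epsilon>)) / \<epsilon> ^ DIM('a)"

definition profile_const :: "nat \<Rightarrow> (real \<Rightarrow> real) \<Rightarrow> real" where
  "profile_const d f =
     real d * unit_ball_vol (real d) * integral {0..1} (\<lambda>r. f r * r ^ (d - 1))"

definition first_variation_conv ::
  "('a::euclidean_space \<times> ('a \<Rightarrow>\<^sub>L 'a)) measure \<Rightarrow> (real \<Rightarrow> real) \<Rightarrow> real \<Rightarrow> 'a \<Rightarrow> 'a" where
  "first_variation_conv V \<rho> \<epsilon> x =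
     (\<integral>p. blinfun_apply (snd p) (gradient (scaled_kernel \<rho> \<epsilon>) (fst p - x)) \<partial>V)"

definition mass_conv ::
  "'a::euclidean_space set \<Rightarrow> ('a \<times> ('a \<Rightarrow>\<^sub>L 'a)) measure \<Rightarrow> (real \<Rightarrow> real) \<Rightarrow> real \<Rightarrow> 'a \<Rightarrow> real" where
  "mass_conv \<Omega> V \<xi> \<epsilon> x = (\<integral>y. scaled_kernel \<xi> \<epsilon> (y - x) \<partial>mass \<Omega> V)"

definition approx_mean_curvature_defined ::
  "'a::euclidean_space set \<Rightarrow> ('a \<times> ('a \<Rightarrow>\<^sub>L 'a)) measure \<Rightarrow> (real \<Rightarrow> real) \<Rightarrow> real \<Rightarrow> 'a \<Rightarrow> bool" where
  "approx_mean_curvature_defined \<Omega> V \<xi> \<epsilon> x \<longleftrightarrow> cball x \<epsilon> \<subseteq> \<Omega> \<and> 0 < mass_conv \<Omega> V \<xi> \<epsilon> x"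

definition approx_mean_curvature ::
  "nat \<Rightarrow> 'a::euclidean_space set \<Rightarrow> ('a \<times> ('a \<Rightarrow>\<^sub>L 'a)) measure \<Rightarrow> (real \<Rightarrow> real) \<Rightarrow>
     (real \<Rightarrow> real) \<Rightarrow> real \<Rightarrow> 'a \<Rightarrow> 'a" where
  "approx_mean_curvature d \<Omega> V \<rho> \<xi> \<epsilon> x =
     - ((profile_const d \<xi> / profile_const d \<rho>) *\<^sub>R
          (first_variation_conv V \<rho> \<epsilon> x /\<^sub>R mass_conv \<Omega> V \<xi> \<epsilon> x))"

end

theory Submission
  imports Defs
begin

text \<open>Let \<open>\<mu> = \<parallel>V\<parallel>\<close> and \<open>n\<close> the ambient dimension. Convergence of \<open>H\<^bsup>V\<^esup>\<^sub>\<epsilon>(x)\<close> to \<open>H(x)\<close>: testing the first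
  variation with \<open>\<rho>\<^sub>\<epsilon>(\<cdot> - x) e\<close> turns \<open>\<delta>V \<ast> \<rho>\<^sub>\<epsilon>\<close> into \<open>-\<integral>\<rho>\<^sub>\<epsilon> H d\<mu>\<close> plus a singular part, so at a
  Lebesgue point of \<open>H\<close> where the singular part has density \<open>0\<close> it equals
  \<open>-(\<mu> \<ast> \<rho>\<^sub>\<epsilon>)(x) H(x) + o(\<epsilon>\<^bsup>d-n\<^esup>)\<close>. Blowing up at the approximate tangent plane \<open>P\<close>, the ratio of
  \<open>\<mu> \<ast> \<rho>\<^sub>\<epsilon>\<close> and \<open>\<mu> \<ast> \<xi>\<^sub>\<epsilon>\<close> tends to \<open>C\<^sub>\<rho> / C\<^sub>\<xi>\<close>; as only ratios matter, it suffices that \<open>\<H>\<^sup>d\<close> of the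
  unit ball of \<open>P\<close> is positive and finite, and the isodiametric inequality is avoided. Stability:
  the integrands of \<open>\<delta>V \<ast> \<rho>\<^sub>\<epsilon>\<close> and \<open>\<mu> \<ast> \<xi>\<^sub>\<epsilon>\<close> are Lipschitz with constants of order \<open>\<epsilon>\<^bsup>-n-2\<^esup>\<close> and
  \<open>\<epsilon>\<^bsup>-n-1\<^esup>\<close>, hence the bounded Lipschitz distance controls numerator and denominator, whose sizes are of
  order \<open>\<epsilon>\<^bsup>d-n-1\<^esup>\<close> and \<open>\<epsilon>\<^bsup>d-n\<^esup>\<close>.\<close>

section \<open>Hausdorff measure of Borel sets and of subspaces\<close>

text \<open>\<open>V\<close> is tied to Hausdorff measure only through continuous test functions
  with compact support, whereas tangent planes and positivity of \<open>\<theta>\<close> are known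
  off sets null for Hausdorff measure. Turning this into statements valid almost everywhere for the
  mass requires Borel measurability, Borel hulls of arbitrary sets and a cut-off argument on compact
  sets. Lebesgue points and vanishing density are measured against \<open>r ^ d\<close>, the scale
  at which blow-up limits exist, rather than against the mass of the ball. The rate
  \<open>1 / \<epsilon>^2\<close> is the common order of two relative errors. Put
  \<open>\<delta> = ds i + norm (x - z i)\<close> and \<open>u = \<epsilon>^(d - n)\<close>. The
  numerator moves by about \<open>\<delta> * u / \<epsilon>^2\<close>, to be divided by
  \<open>u\<close>. The denominator moves by about \<open>\<delta> * u / \<epsilon>\<close>, which
  is multiplied by a numerator of size \<open>u / \<epsilon>\<close> and divided by
  \<open>u^2\<close>. Moving the centre from \<open>z i\<close> to \<open>x\<close> is a Lipschitz
  estimate on the kernels, paid with the mass of \<open>V\<close>.\<close>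

abbreviation ball_weight :: "nat \<Rightarrow> 'a::euclidean_space set \<Rightarrow> ennreal" where
  "ball_weight d C \<equiv> ennreal (unit_ball_vol (real d) * (diameter C / 2) ^ d)"

section \<open>Pre-measures, monotonicity and the metric property of the Hausdorff outer
  measure\<close>

lemma hausdorff_pre_le:
  assumes "\<And>j. bounded (C j)" "\<And>j. diameter (C j) \<le> \<delta>" "A \<subseteq> (\<Union>j. C j)"
  shows "hausdorff_pre d \<delta> A \<le> (\<Sum>j. ball_weight d (C j))"
  unfolding hausdorff_pre_def using assms by (intro INF_lower) auto

lemma hausdorff_pre_geI:
  assumes "\<And>C. (\<And>j. bounded (C j)) \<Longrightarrow> (\<And>j. diameter (C j) \<le> \<delta>) \<Longrightarrow> A \<subseteq> (\<Union>j. C j)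
    \<Longrightarrow> x \<le> (\<Sum>j::nat. ball_weight d (C j))"
  shows "x \<le> hausdorff_pre d \<delta> A"
  unfolding hausdorff_pre_def using assms by (intro INF_greatest) auto

text \<open>Multiplication by a finite positive constant is invertible in \<open>ennreal\<close>,
  hence commutes with the infimum over covers, infinite values included.\<close>

lemma hausdorff_pre_cmult_geI:
  assumes c: "0 < c" and le: "\<And>C. (\<And>j. bounded (C j)) \<Longrightarrow> (\<And>j. diameter (C j) \<le> \<delta>) \<Longrightarrow> A \<subseteq> (\<Union>j. C j)
    \<Longrightarrow> x \<le> ennreal c * (\<Sum>j::nat. ball_weight d (C j))"
  shows "x \<le> ennreal c * hausdorff_pre d \<delta> A"
proof -
  have inv: "ennreal (1 / c) * (ennreal c * y) = y" "ennreal c * (ennreal (1 / c) * y) = y" for y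
    using c by (simp_all add: mult.assoc[symmetric] ennreal_mult'[symmetric])
  have "ennreal (1 / c) * x \<le> hausdorff_pre d \<delta> A"
  proof (rule hausdorff_pre_geI)
    fix C assume "\<And>j. bounded (C j)" "\<And>j. diameter (C j) \<le> \<delta>" "A \<subseteq> (\<Union>j::nat. C j)"
    from mult_left_mono[OF le[OF this], of "ennreal (1 / c)"]
    show "ennreal (1 / c) * x \<le> (\<Sum>j. ball_weight d (C j))" by (simp add: inv)
  qed
  from mult_left_mono[OF this, of "ennreal c"] show ?thesis by (simp add: inv)
qed

lemma hausdorff_pre_cover:
  assumes "hausdorff_pre d \<delta> A < t"
  obtains C where "\<And>j. bounded (C j)" "\<And>j. diameter (C j) \<le> \<delta>" "A \<subseteq> (\<Union>j. C j)"
    "(\<Sum>j::nat. ball_weight d (C j)) < t"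
  using assms unfolding hausdorff_pre_def INF_less_iff by blast

lemma hausdorff_pre_mono: "A \<subseteq> B \<Longrightarrow> hausdorff_pre d \<delta> A \<le> hausdorff_pre d \<delta> B"
  by (rule hausdorff_pre_geI) (rule hausdorff_pre_le, auto)

lemma hausdorff_pre_antimono: "\<delta> \<le> \<delta>' \<Longrightarrow> hausdorff_pre d \<delta>' A \<le> hausdorff_pre d \<delta> A"
  by (rule hausdorff_pre_geI) (rule hausdorff_pre_le, auto intro: order_trans)

lemma hausdorff_pre_le_outer: "0 < \<delta> \<Longrightarrow> hausdorff_pre d \<delta> A \<le> hausdorff_outer d A"
  unfolding hausdorff_outer_def by (auto intro: SUP_upper)

lemma hausdorff_outer_mono: "A \<subseteq> B \<Longrightarrow> hausdorff_outer d A \<le> hausdorff_outer d B"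
  unfolding hausdorff_outer_def by (intro SUP_mono) (auto intro: hausdorff_pre_mono)

lemma hausdorff_outer_empty: "1 \<le> d \<Longrightarrow> hausdorff_outer d ({}::'a::euclidean_space set) = 0"
  using outer_measure_space_hausdorff[of d] by (auto simp: outer_measure_space_def positive_def)

lemma hausdorff_outer_UN:
  assumes "1 \<le> d"
  shows "hausdorff_outer d (\<Union>i::nat. A i) \<le> (\<Sum>i. hausdorff_outer d (A i :: 'a::euclidean_space set))"
proof -
  have "hausdorff_pre d \<delta> (\<Union>i. A i) \<le> (\<Sum>i. hausdorff_outer d (A i))" if "0 < \<delta>" for \<delta>
    using that
    by (intro order_trans[OF hausdorff_pre_subadditive] suminf_le) (auto intro: hausdorff_pre_le_outer)
  then show ?thesis
    unfolding hausdorff_outer_def[of d "\<Union>i. A i"] by (intro SUP_least) auto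
qed

lemma hausdorff_outer_Un:
  assumes "1 \<le> d"
  shows "hausdorff_outer d (A \<union> B) \<le> hausdorff_outer d A + hausdorff_outer d (B :: 'a::euclidean_space set)"
proof -
  let ?F = "\<lambda>n::nat. if n = 0 then A else if n = 1 then B else {}"
  have "(\<Sum>i. hausdorff_outer d (?F i)) = (\<Sum>i\<in>{0,1}. hausdorff_outer d (?F i))"
    by (rule suminf_finite) (auto simp: hausdorff_outer_empty[OF assms])
  moreover have "(\<Union>i. ?F i) = A \<union> B"
    by (auto split: if_splits)
  ultimately show ?thesis
    using hausdorff_outer_UN[OF assms, of ?F] by simp
qed

text \<open>A set of diameter at most \<open>\<delta>\<close> cannot meet both sets, so every cover
  splits into a cover of \<open>A\<close> and one of \<open>B\<close>. Discarded members become
  empty and weigh \<open>0 ^ d = 0\<close>, which is where \<open>1 \<le> d\<close> enters.\<close>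

lemma hausdorff_pre_separated:
  fixes A B :: "'a::euclidean_space set"
  assumes d: "1 \<le> d" and sep: "\<And>x y. x \<in> A \<Longrightarrow> y \<in> B \<Longrightarrow> \<delta> < dist x y"
  shows "hausdorff_pre d \<delta> A + hausdorff_pre d \<delta> B \<le> hausdorff_pre d \<delta> (A \<union> B)"
proof (rule hausdorff_pre_geI)
  fix C :: "nat \<Rightarrow> 'a set"
  assume C: "\<And>j. bounded (C j)" "\<And>j. diameter (C j) \<le> \<delta>" "A \<union> B \<subseteq> (\<Union>j. C j)"
  let ?CA = "\<lambda>j. if C j \<inter> A \<noteq> {} then C j else {}"
  let ?CB = "\<lambda>j. if C j \<inter> A \<noteq> {} then {} else C j"
  have \<delta>: "0 \<le> \<delta>"
    using C(1,2) diameter_ge_0 order_trans by blast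
  have disj: "C j \<inter> B = {}" if a: "a \<in> C j" "a \<in> A" for j a
  proof (rule ccontr)
    assume "C j \<inter> B \<noteq> {}"
    then obtain b where b: "b \<in> C j" "b \<in> B" by blast
    have "dist a b \<le> diameter (C j)"
      using diameter_bounded_bound[OF C(1) a(1) b(1)] by simp
    then show False using sep[OF a(2) b(2)] C(2)[of j] by linarith
  qed
  have "hausdorff_pre d \<delta> A \<le> (\<Sum>j. ball_weight d (?CA j))"
  proof (rule hausdorff_pre_le)
    show "A \<subseteq> (\<Union>j. ?CA j)" using C(3) by (fastforce split: if_splits)
  qed (use C \<delta> in auto)
  moreover have "hausdorff_pre d \<delta> B \<le> (\<Sum>j. ball_weight d (?CB j))"
  proof (rule hausdorff_pre_le)
    show "B \<subseteq> (\<Union>j. ?CB j)"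
    proof
      fix b assume "b \<in> B"
      then obtain j where "b \<in> C j" using C(3) by blast
      then show "b \<in> (\<Union>j. ?CB j)" using disj[of _ j] \<open>b \<in> B\<close> by (intro UN_I[of j]) auto
    qed
  qed (use C \<delta> in auto)
  ultimately have "hausdorff_pre d \<delta> A + hausdorff_pre d \<delta> B
      \<le> (\<Sum>j. ball_weight d (?CA j)) + (\<Sum>j. ball_weight d (?CB j))"
    by (rule add_mono)
  also have "\<dots> = (\<Sum>j. ball_weight d (?CA j) + ball_weight d (?CB j))"
    by (rule suminf_add) auto
  also have "\<dots> = (\<Sum>j. ball_weight d (C j))"
    using d by (intro suminf_cong) (auto simp: zero_power)
  finally show "hausdorff_pre d \<delta> A + hausdorff_pre d \<delta> B \<le> (\<Sum>j. ball_weight d (C j))" .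
qed

text \<open>Pre-measures grow as the scale shrinks, so both suprema may be compared at one common
  scale below the gap \<open>e\<close>. This is the metric property from which Caratheodory
  measurability follows.\<close>

lemma hausdorff_outer_separated:
  fixes A B :: "'a::euclidean_space set"
  assumes d: "1 \<le> d" and e: "0 < e" and sep: "\<And>x y. x \<in> A \<Longrightarrow> y \<in> B \<Longrightarrow> e \<le> dist x y"
  shows "hausdorff_outer d A + hausdorff_outer d B \<le> hausdorff_outer d (A \<union> B)"
proof -
  have *: "hausdorff_pre d \<delta>1 A + hausdorff_pre d \<delta>2 B \<le> hausdorff_outer d (A \<union> B)"
    if "0 < \<delta>1" "0 < \<delta>2" for \<delta>1 \<delta>2
  proof -
    define \<delta> where "\<delta> = min (e/2) (min \<delta>1 \<delta>2)"
    have \<delta>: "0 < \<delta>" "\<delta> < e" "\<delta> \<le> \<delta>1" "\<delta> \<le> \<delta>2" using that e by (auto simp: \<delta>_def)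
    have "hausdorff_pre d \<delta>1 A + hausdorff_pre d \<delta>2 B \<le> hausdorff_pre d \<delta> A + hausdorff_pre d \<delta> B"
      using \<delta> by (intro add_mono hausdorff_pre_antimono)
    also have "\<dots> \<le> hausdorff_pre d \<delta> (A \<union> B)"
      by (rule hausdorff_pre_separated[OF d]) (use sep \<delta> in force)
    also have "\<dots> \<le> hausdorff_outer d (A \<union> B)"
      by (rule hausdorff_pre_le_outer[OF \<delta>(1)])
    finally show ?thesis .
  qed
  have **: "hausdorff_outer d A + hausdorff_pre d \<delta>2 B \<le> hausdorff_outer d (A \<union> B)" if "0 < \<delta>2" for \<delta>2
    unfolding hausdorff_outer_def[of d A]
    by (subst ennreal_SUP_add_left[symmetric]) (auto intro!: SUP_least * that)
  show ?thesis
    unfolding hausdorff_outer_def[of d B]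
    by (subst ennreal_SUP_add_right) (auto intro!: SUP_least **)
qed

text \<open>The gap may shrink with the index: each induction step adds one piece to finitely many
  earlier ones, so only its distance to those counts.\<close>

lemma hausdorff_outer_separated_sum:
  fixes R :: "nat \<Rightarrow> 'a::euclidean_space set"
  assumes d: "1 \<le> d"
    and sep: "\<And>i. \<exists>e>0. \<forall>j<i. \<forall>x\<in>R j. \<forall>y\<in>R i. e \<le> dist x y"
    and sub: "\<And>i. R i \<subseteq> A"
  shows "(\<Sum>i. hausdorff_outer d (R i)) \<le> hausdorff_outer d A"
proof (rule suminf_le_const)
  show "(\<Sum>i<n. hausdorff_outer d (R i)) \<le> hausdorff_outer d A" for n
  proof -
    have "(\<Sum>i<n. hausdorff_outer d (R i)) \<le> hausdorff_outer d (\<Union>i<n. R i)"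
    proof (induction n)
      case (Suc n)
      obtain e where e: "e > 0" "\<And>j x y. j < n \<Longrightarrow> x \<in> R j \<Longrightarrow> y \<in> R n \<Longrightarrow> e \<le> dist x y"
        using sep[of n] by blast
      have "(\<Sum>i<Suc n. hausdorff_outer d (R i)) \<le> hausdorff_outer d (\<Union>i<n. R i) + hausdorff_outer d (R n)"
        using Suc by (simp add: add_mono)
      also have "\<dots> \<le> hausdorff_outer d ((\<Union>i<n. R i) \<union> R n)"
        by (rule hausdorff_outer_separated[OF d e(1)]) (use e(2) in blast)
      also have "(\<Union>i<n. R i) \<union> R n = (\<Union>i<Suc n. R i)"
        by (auto simp: less_Suc_eq)
      finally show ?case .
    qed (simp add: hausdorff_outer_empty[OF d])
    also have "\<dots> \<le> hausdorff_outer d A" by (rule hausdorff_outer_mono) (use sub in auto)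
    finally show ?thesis .
  qed
qed simp

text \<open>Caratheodory's argument for metric outer measures, run on half-spaces because they
  generate the Borel sets. The part of \<open>A\<close> beyond the hyperplane is cut into layers
  that thin out towards it. Their measures are summable, so up to a negligible tail this part keeps
  a positive distance from the half-space.\<close>

lemma halfspace_lambda_system:
  fixes u :: "'a::euclidean_space"
  assumes d: "1 \<le> d" and u: "norm u = 1"
  shows "{x. x \<bullet> u \<le> a} \<in> lambda_system UNIV (Pow UNIV) (hausdorff_outer d)"
proof -
  let ?H = "hausdorff_outer d :: 'a set \<Rightarrow> ennreal" and ?F = "{x. x \<bullet> u \<le> a}"
  have lip: "\<bar>x \<bullet> u - y \<bullet> u\<bar> \<le> dist x y" for x y
    using Cauchy_Schwarz_ineq2[of "x - y" u] u by (simp add: inner_diff_left dist_norm)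
  have key: "?H (A \<inter> ?F) + ?H (A - ?F) \<le> ?H A" if fin: "?H A < top" for A
  proof -
    define s where "s k = 1 / real (Suc k)" for k
    define R where "R k = {x\<in>A. a + s (Suc k) \<le> x \<bullet> u \<and> x \<bullet> u < a + s k}" for k
    define D where "D k = {x\<in>A. a + s k \<le> x \<bullet> u}" for k
    have s: "0 < s k" "s (Suc k) < s k" for k by (auto simp: s_def field_simps)
    have smono: "s k \<le> s j" if "j \<le> k" for j k using that by (auto simp: s_def field_simps)
    have s0: "s \<longlonglongrightarrow> 0" unfolding s_def by (rule LIMSEQ_inverse_real_of_nat[unfolded inverse_eq_divide])
    \<comment> \<open>Layers whose indices differ by at least two have the whole thickness of layer
      \<open>k - 1\<close> between them, so one gap \<open>s (k - 1) - s k\<close> serves all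
      earlier \<open>j\<close>.\<close>
    have sepR: "\<exists>e>0. \<forall>j. j + 1 < k \<longrightarrow> (\<forall>x\<in>R j. \<forall>y\<in>R k. e \<le> dist x y)" for k
    proof (cases "k = 0")
      case False
      have "s (k - 1) - s k \<le> dist x y" if "x \<in> R j" "y \<in> R k" "j + 2 \<le> k" for j x y
      proof -
        from False obtain k' where k': "k = Suc k'" using not0_implies_Suc by blast
        have "a + s (Suc j) \<le> x \<bullet> u" "y \<bullet> u < a + s k" using that by (auto simp: R_def)
        moreover have "s k' \<le> s (Suc j)" by (rule smono) (use that k' in auto)
        ultimately show ?thesis using lip[of x y] k' by simp
      qed
      then show ?thesis using s(2)[of "k - 1"] False
        by (intro exI[of _ "s (k-1) - s k"]) auto
    qed (auto intro: exI[of _ 1])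
    \<comment> \<open>Adjacent layers may touch, so the even and the odd ones are summed
      separately.\<close>
    have "(\<Sum>k. ?H (R (2*k))) \<le> ?H A"
    proof (rule hausdorff_outer_separated_sum[OF d])
      show "\<exists>e>0. \<forall>j<i. \<forall>x\<in>R (2*j). \<forall>y\<in>R (2*i). e \<le> dist x y" for i
      proof -
        obtain e where e: "e > 0" "\<And>j. j + 1 < 2*i \<Longrightarrow> \<forall>x\<in>R j. \<forall>y\<in>R (2*i). e \<le> dist x y"
          using sepR[of "2*i"] by blast
        moreover have "\<forall>j<i. \<forall>x\<in>R (2*j). \<forall>y\<in>R (2*i). e \<le> dist x y"
        proof (intro allI impI)
          show "\<forall>x\<in>R (2*j). \<forall>y\<in>R (2*i). e \<le> dist x y" if "j < i" for j
            using e(2)[of "2*j"] that by simp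
        qed
        ultimately show ?thesis by blast
      qed
    qed (auto simp: R_def)
    moreover have "(\<Sum>k. ?H (R (2*k+1))) \<le> ?H A"
    proof (rule hausdorff_outer_separated_sum[OF d])
      show "\<exists>e>0. \<forall>j<i. \<forall>x\<in>R (2*j+1). \<forall>y\<in>R (2*i+1). e \<le> dist x y" for i
      proof -
        obtain e where e: "e > 0" "\<And>j. j + 1 < 2*i+1 \<Longrightarrow> \<forall>x\<in>R j. \<forall>y\<in>R (2*i+1). e \<le> dist x y"
          using sepR[of "2*i+1"] by blast
        moreover have "\<forall>j<i. \<forall>x\<in>R (2*j+1). \<forall>y\<in>R (2*i+1). e \<le> dist x y"
        proof (intro allI impI)
          show "\<forall>x\<in>R (2*j+1). \<forall>y\<in>R (2*i+1). e \<le> dist x y" if "j < i" for j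
            using e(2)[of "2*j+1"] that by simp
        qed
        ultimately show ?thesis by blast
      qed
    qed (auto simp: R_def)
    ultimately have "(\<Sum>k. ?H (R (2*k))) + (\<Sum>k. ?H (R (2*k+1))) \<le> ?H A + ?H A"
      by (rule add_mono)
    then have sumR: "(\<Sum>k. ?H (R (2*k)) + ?H (R (2*k+1))) < top"
      using fin by (subst (asm) suminf_add) (auto elim: le_less_trans)
    define c where "c k = ?H (R (2*k)) + ?H (R (2*k+1))" for k
    have S: "(\<Sum>k. c k) < top" using sumR by (simp add: c_def)
    show ?thesis
    proof (rule ennreal_le_epsilon)
      fix e :: real assume e: "0 < e"
      have "(\<lambda>N. (\<Sum>k<N. c k) + ennreal e) \<longlonglongrightarrow> (\<Sum>k. c k) + ennreal e"
        by (intro tendsto_add summable_LIMSEQ tendsto_const) auto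
      moreover have "(\<Sum>k. c k) < (\<Sum>k. c k) + ennreal e"
        using S e by (simp add: ennreal_add_left_cancel_less top.not_eq_extremum)
      ultimately obtain N where N: "(\<Sum>k. c k) < (\<Sum>k<N. c k) + ennreal e"
        using order_tendstoD(1) eventually_sequentially by (metis (no_types, lifting) order_refl)
      have split: "(\<Sum>k. c k) = (\<Sum>k. c (k + N)) + (\<Sum>k<N. c k)"
        by (rule suminf_offset) auto
      have "(\<Sum>k<N. c k) + (\<Sum>k. c (k + N)) < (\<Sum>k<N. c k) + ennreal e"
        using N unfolding split by (simp add: add.commute)
      then have tail: "(\<Sum>k. c (k + N)) \<le> ennreal e"
        by (auto simp: ennreal_add_left_cancel_less)
      have "A - ?F \<subseteq> D (2*N) \<union> (\<Union>k. R (2*(k+N)) \<union> R (2*(k+N)+1))"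
      proof
        fix x assume x: "x \<in> A - ?F"
        show "x \<in> D (2*N) \<union> (\<Union>k. R (2*(k+N)) \<union> R (2*(k+N)+1))"
        proof (cases "a + s (2*N) \<le> x \<bullet> u")
          case False
          have "\<forall>\<^sub>F k in sequentially. s k < x \<bullet> u - a"
            using s0 x by (intro order_tendstoD(2)[OF s0]) auto
          then obtain m where m: "s m < x \<bullet> u - a"
            unfolding eventually_sequentially by blast
          \<comment> \<open>The first threshold that \<open>x\<close> reaches identifies its layer
            \<open>k - 1\<close>. Since \<open>x\<close> misses the threshold with index
            \<open>2*N\<close>, this layer has index at least \<open>2*N\<close> and lies in the
            tail.\<close>
          define k where "k = (LEAST k. a + s k \<le> x \<bullet> u)"
          have k: "a + s k \<le> x \<bullet> u"
            unfolding k_def by (rule LeastI[of _ m]) (use m in auto)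
          have kN: "2*N < k"
            using False k smono[of k "2*N"] by (meson add_left_mono leI order_trans)
          then obtain k' where k': "k = Suc k'" using not0_implies_Suc by (metis not_less_zero)
          have "\<not> a + s k' \<le> x \<bullet> u"
            using not_less_Least[of k' "\<lambda>k. a + s k \<le> x \<bullet> u"] k' by (simp add: k_def)
          then have xR: "x \<in> R k'" using k k' x by (auto simp: R_def)
          have "x \<in> R (2*((k' div 2 - N)+N)) \<union> R (2*((k' div 2 - N)+N)+1)"
          proof -
            have "k' div 2 - N + N = k' div 2" using kN k' by auto
            moreover have "k' = 2*(k' div 2) \<or> k' = 2*(k' div 2) + 1" by presburger
            ultimately show ?thesis using xR by (metis Un_iff)
          qed
          then show ?thesis by blast
        qed (use x in \<open>auto simp: D_def\<close>)
      qed
      then have "?H (A - ?F) \<le> ?H (D (2*N) \<union> (\<Union>k. R (2*(k+N)) \<union> R (2*(k+N)+1)))"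
        by (rule hausdorff_outer_mono)
      also have "\<dots> \<le> ?H (D (2*N)) + ?H (\<Union>k. R (2*(k+N)) \<union> R (2*(k+N)+1))"
        by (rule hausdorff_outer_Un[OF d])
      also have "?H (\<Union>k. R (2*(k+N)) \<union> R (2*(k+N)+1)) \<le> (\<Sum>k. c (k+N))"
        unfolding c_def
        by (intro order_trans[OF hausdorff_outer_UN[OF d]] suminf_le hausdorff_outer_Un[OF d]) auto
      also have "\<dots> \<le> ennreal e" by (rule tail)
      finally have "?H (A \<inter> ?F) + ?H (A - ?F) \<le> (?H (A \<inter> ?F) + ?H (D (2*N))) + ennreal e"
        by (simp add: add_left_mono add.assoc)
      also have "?H (A \<inter> ?F) + ?H (D (2*N)) \<le> ?H ((A \<inter> ?F) \<union> D (2*N))"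
      proof (rule hausdorff_outer_separated[OF d s(1)])
        show "s (2*N) \<le> dist x y" if "x \<in> A \<inter> ?F" "y \<in> D (2*N)" for x y
          using that lip[of x y] by (auto simp: D_def)
      qed
      also have "\<dots> \<le> ?H A" by (rule hausdorff_outer_mono) (auto simp: D_def)
      finally show "?H (A \<inter> ?F) + ?H (A - ?F) \<le> ?H A + ennreal e"
        by (simp add: add_right_mono)
    qed
  qed
  have "?H (A \<inter> ?F) + ?H (A - ?F) = ?H A" for A
  proof (rule antisym)
    show "?H (A \<inter> ?F) + ?H (A - ?F) \<le> ?H A"
      using key[of A] by (cases "?H A = top") (auto simp: less_top)
    show "?H A \<le> ?H (A \<inter> ?F) + ?H (A - ?F)"
      using hausdorff_outer_Un[OF d, of "A \<inter> ?F" "A - ?F"] by (simp add: Int_Diff_Un)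
  qed
  then show ?thesis
    by (subst algebra.lambda_system_eq) (auto simp: algebra_Pow simp del: Pow_UNIV)
qed

section \<open>Borel sets, Borel hulls and Borel cores\<close>

lemma space_hausdorff_measure [simp]: "space (hausdorff_measure d) = UNIV"
  by (simp add: hausdorff_measure_def space_measure_of_conv)

lemma borel_sets_hausdorff_measure:
  assumes d: "1 \<le> d"
  shows "sets borel \<subseteq> sets (hausdorff_measure d :: 'a::euclidean_space measure)"
proof -
  have "(\<lambda>(a, i). {x::'a. x \<bullet> i \<le> a}) ` (UNIV \<times> Basis) \<subseteq> sets (hausdorff_measure d)"
    by (auto simp: hausdorff_measure_eq(1)[OF d] simp del: Pow_UNIV intro!: halfspace_lambda_system[OF d])
  then have "sigma_sets UNIV ((\<lambda>(a, i). {x::'a. x \<bullet> i \<le> a}) ` (UNIV \<times> Basis))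
      \<subseteq> sets (hausdorff_measure d)"
    using sets.sigma_sets_subset space_hausdorff_measure by metis
  then show ?thesis
    by (simp add: borel_eq_halfspace_le)
qed

lemma emeasure_hausdorff_borel:
  "1 \<le> d \<Longrightarrow> A \<in> sets borel \<Longrightarrow> emeasure (hausdorff_measure d) A = hausdorff_outer d A"
  using hausdorff_measure_eq(2) borel_sets_hausdorff_measure by blast

text \<open>Near-optimal covers at scales tending to 0 are replaced by their closures, which have
  the same diameters. Intersecting over the scales gives a Borel set to which the same covers still
  apply. If the outer measure is infinite, the whole space will do.\<close>

lemma hausdorff_borel_hull:
  fixes A :: "'a::euclidean_space set"
  assumes d: "1 \<le> d"
  obtains B where "A \<subseteq> B" "B \<in> sets borel" "hausdorff_outer d B = hausdorff_outer d A"
proof (cases "hausdorff_outer d A = top")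
  case True
  then show ?thesis
    using that[of UNIV] hausdorff_outer_mono[of A UNIV d] by (simp add: top_unique)
next
  case False
  define \<delta> where "\<delta> n = 1 / real (Suc n)" for n
  have \<delta>: "0 < \<delta> n" for n by (simp add: \<delta>_def)
  have "\<exists>C. (\<forall>j. bounded (C j) \<and> diameter (C j) \<le> \<delta> n) \<and> A \<subseteq> (\<Union>j::nat. C j) \<and>
      (\<Sum>j. ball_weight d (C j)) < hausdorff_outer d A + ennreal (\<delta> n)" for n
  proof -
    have "hausdorff_pre d (\<delta> n) A < hausdorff_outer d A + ennreal (\<delta> n)"
      using hausdorff_pre_le_outer[OF \<delta>, of d n A] False \<delta>[of n]
      by (metis ennreal_add_left_cancel_less add.right_neutral ennreal_less_zero_iff order_le_less_trans
          infinity_ennreal_def)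
    then show ?thesis by (rule hausdorff_pre_cover) blast
  qed
  then obtain C where C: "\<And>n j. bounded (C n j)" "\<And>n j. diameter (C n j) \<le> \<delta> n"
    "\<And>n. A \<subseteq> (\<Union>j::nat. C n j)"
    "\<And>n. (\<Sum>j. ball_weight d (C n j)) < hausdorff_outer d A + ennreal (\<delta> n)"
    by metis
  define B where "B = (\<Inter>n. \<Union>j. closure (C n j))"
  have AB: "A \<subseteq> B" using C(3) closure_subset unfolding B_def by blast
  have pre: "hausdorff_pre d (\<delta> n) B \<le> hausdorff_outer d A + ennreal (\<delta> n)" for n
  proof -
    have "hausdorff_pre d (\<delta> n) B \<le> (\<Sum>j. ball_weight d (closure (C n j)))"
      by (rule hausdorff_pre_le) (auto simp: C(1,2) diameter_closure B_def)
    then show ?thesis using C(4)[of n] by (simp add: diameter_closure C(1))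
  qed
  have "hausdorff_pre d e B \<le> hausdorff_outer d A" if e: "0 < e" for e
  proof (rule tendsto_lowerbound)
    show "(\<lambda>n. hausdorff_outer d A + ennreal (\<delta> n)) \<longlonglongrightarrow> hausdorff_outer d A"
    proof -
      have "(\<lambda>n. ennreal (\<delta> n)) \<longlonglongrightarrow> ennreal 0"
        unfolding \<delta>_def by (intro tendsto_ennrealI LIMSEQ_inverse_real_of_nat[unfolded inverse_eq_divide])
      then have "(\<lambda>n. hausdorff_outer d A + ennreal (\<delta> n)) \<longlonglongrightarrow> hausdorff_outer d A + ennreal 0"
        by (intro tendsto_add tendsto_const)
      then show ?thesis by simp
    qed
    have "\<forall>\<^sub>F n in sequentially. \<delta> n < e"
      unfolding \<delta>_def using e
      by (intro order_tendstoD(2)[OF LIMSEQ_inverse_real_of_nat[unfolded inverse_eq_divide]])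
    then show "\<forall>\<^sub>F n in sequentially. hausdorff_pre d e B \<le> hausdorff_outer d A + ennreal (\<delta> n)"
    proof eventually_elim
      case (elim n)
      then show ?case using pre[of n] hausdorff_pre_antimono[of "\<delta> n" e d B] by (auto elim: order_trans)
    qed
  qed simp
  then have "hausdorff_outer d B \<le> hausdorff_outer d A"
    unfolding hausdorff_outer_def[of d B] by (auto intro: SUP_least)
  then have "hausdorff_outer d B = hausdorff_outer d A"
    using hausdorff_outer_mono[OF AB, of d] by (rule antisym)
  moreover have "B \<in> sets borel" unfolding B_def by measurable
  ultimately show ?thesis using that AB by blast
qed

text \<open>A hull \<open>B\<close> exceeds \<open>A\<close> by a null set, as finiteness allows
  subtraction. Removing from \<open>B\<close> a Borel hull of that excess leaves a Borel subset of
  \<open>A\<close>.\<close>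

lemma hausdorff_borel_core:
  fixes A :: "'a::euclidean_space set"
  assumes d: "1 \<le> d" and A: "A \<in> sets (hausdorff_measure d)" and fin: "emeasure (hausdorff_measure d) A < top"
  obtains B where "B \<subseteq> A" "B \<in> sets borel" "hausdorff_outer d (A - B) = 0"
proof -
  note eq = hausdorff_measure_eq(2)[OF d]
  obtain B where B: "A \<subseteq> B" "B \<in> sets borel" "hausdorff_outer d B = hausdorff_outer d A"
    using hausdorff_borel_hull[OF d, of A] by blast
  have Bs: "B \<in> sets (hausdorff_measure d)" using B(2) borel_sets_hausdorff_measure[OF d] by blast
  have "emeasure (hausdorff_measure d) (B - A) = 0"
    using B fin A Bs by (subst emeasure_Diff) (auto simp: eq)
  then have "hausdorff_outer d (B - A) = 0" using A Bs eq by (metis sets.Diff)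
  then obtain N where N: "B - A \<subseteq> N" "N \<in> sets borel" "hausdorff_outer d N = 0"
    using hausdorff_borel_hull[OF d, of "B - A"] by metis
  show ?thesis
  proof (rule that[of "B - N"])
    have "hausdorff_outer d (A - (B - N)) \<le> hausdorff_outer d N"
      by (rule hausdorff_outer_mono) (use B(1) in blast)
    then show "hausdorff_outer d (A - (B - N)) = 0" using N(3) by simp
  qed (use B N in auto)
qed

lemma hausdorff_outer_lipschitz_image:
  fixes f :: "'a::euclidean_space \<Rightarrow> 'b::euclidean_space"
  assumes d: "1 \<le> d" and L: "0 < L" and f: "\<And>x y. x \<in> A \<Longrightarrow> y \<in> A \<Longrightarrow> dist (f x) (f y) \<le> L * dist x y"
  shows "hausdorff_outer d (f ` A) \<le> ennreal (L ^ d) * hausdorff_outer d A"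
proof -
  have "hausdorff_pre d \<delta> (f ` A) \<le> ennreal (L ^ d) * hausdorff_outer d A" if \<delta>: "0 < \<delta>" for \<delta>
  proof -
    have "hausdorff_pre d \<delta> (f ` A) \<le> ennreal (L ^ d) * hausdorff_pre d (\<delta> / L) A"
    proof (rule hausdorff_pre_cmult_geI)
      fix C :: "nat \<Rightarrow> 'a set"
      assume C: "\<And>j. bounded (C j)" "\<And>j. diameter (C j) \<le> \<delta> / L" "A \<subseteq> (\<Union>j. C j)"
      \<comment> \<open>\<open>f\<close> is controlled on \<open>A\<close> alone, so the covering
        sets are cut down to \<open>A\<close> before mapping.\<close>
      have diam: "bounded (f ` (C j \<inter> A)) \<and> diameter (f ` (C j \<inter> A)) \<le> L * diameter (C j)" for j
      proof -
        have *: "dist (f x) (f y) \<le> L * diameter (C j)" if "x \<in> C j \<inter> A" "y \<in> C j \<inter> A" for x y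
        proof -
          have "dist (f x) (f y) \<le> L * dist x y" using f that by blast
          also have "\<dots> \<le> L * diameter (C j)"
            using diameter_bounded_bound[OF C(1)] that L by (intro mult_left_mono) auto
          finally show ?thesis .
        qed
        have "bounded (f ` (C j \<inter> A))"
        proof (cases "C j \<inter> A = {}")
          case False
          then obtain x where "x \<in> C j \<inter> A" by blast
          then show ?thesis unfolding bounded_def using * by (intro exI[of _ "f x"]) blast
        qed simp
        moreover have "diameter (f ` (C j \<inter> A)) \<le> L * diameter (C j)"
          by (rule diameter_le) (use * L diameter_ge_0[OF C(1)] in \<open>auto simp: dist_norm\<close>)
        ultimately show ?thesis by blast
      qed
      have "hausdorff_pre d \<delta> (f ` A) \<le> (\<Sum>j. ball_weight d (f ` (C j \<inter> A)))"
      proof (rule hausdorff_pre_le)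
        show "diameter (f ` (C j \<inter> A)) \<le> \<delta>" for j
          using diam[of j] C(2)[of j] L by (simp add: field_simps)
      qed (use diam C(3) in \<open>auto, blast\<close>)
      also have "\<dots> \<le> (\<Sum>j. ennreal (L ^ d) * ball_weight d (C j))"
      proof (intro suminf_le)
        fix j
        have "0 \<le> diameter (f ` (C j \<inter> A))" using diam by (simp add: diameter_ge_0)
        then have "(diameter (f ` (C j \<inter> A)) / 2) ^ d \<le> (L * (diameter (C j) / 2)) ^ d"
          using diam[of j] by (intro power_mono) auto
        then have "(diameter (f ` (C j \<inter> A)) / 2) ^ d \<le> L ^ d * (diameter (C j) / 2) ^ d"
          by (simp only: power_mult_distrib)
        then have "unit_ball_vol (real d) * (diameter (f ` (C j \<inter> A)) / 2) ^ d
            \<le> L ^ d * (unit_ball_vol (real d) * (diameter (C j) / 2) ^ d)"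
          by (subst mult.left_commute) (intro mult_left_mono, auto)
        then show "ball_weight d (f ` (C j \<inter> A)) \<le> ennreal (L ^ d) * ball_weight d (C j)"
          using L by (simp add: ennreal_mult'[symmetric] ennreal_leI)
      qed auto
      also have "\<dots> = ennreal (L ^ d) * (\<Sum>j. ball_weight d (C j))"
        by (rule ennreal_suminf_cmult)
      finally show "hausdorff_pre d \<delta> (f ` A) \<le> ennreal (L ^ d) * (\<Sum>j. ball_weight d (C j))" .
    qed (use L in auto)
    also have "\<dots> \<le> ennreal (L ^ d) * hausdorff_outer d A"
      by (intro mult_left_mono hausdorff_pre_le_outer) (use \<delta> L in auto)
    finally show ?thesis .
  qed
  then show ?thesis unfolding hausdorff_outer_def[of d "f ` A"] by (auto intro: SUP_least)
qed

section \<open>Unit balls of \<open>d\<close>-dimensional subspaces have positive finite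
  measure\<close>

lemma hausdorff_pre_finite_cover:
  fixes C :: "'i \<Rightarrow> 'a::euclidean_space set"
  assumes d: "1 \<le> d" and I: "finite I" and \<delta>: "0 \<le> \<delta>" and A: "A \<subseteq> (\<Union>i\<in>I. C i)"
    and C: "\<And>i. i \<in> I \<Longrightarrow> bounded (C i)" "\<And>i. i \<in> I \<Longrightarrow> diameter (C i) \<le> \<delta>"
  shows "hausdorff_pre d \<delta> A \<le> (\<Sum>i\<in>I. ball_weight d (C i))"
proof -
  obtain h where h: "bij_betw h {0..<card I} I" using ex_bij_betw_nat_finite[OF I] by blast
  define D where "D j = (if j < card I then C (h j) else {})" for j
  have hI: "h j \<in> I" if "j < card I" for j using h that by (auto simp: bij_betw_def)
  have "hausdorff_pre d \<delta> A \<le> (\<Sum>j. ball_weight d (D j))"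
  proof (rule hausdorff_pre_le)
    show "A \<subseteq> (\<Union>j. D j)"
    proof
      fix x assume "x \<in> A"
      then obtain i where i: "i \<in> I" "x \<in> C i" using A by blast
      then have "i \<in> h ` {0..<card I}" using h by (simp add: bij_betw_def)
      then obtain j where "j < card I" "i = h j" by auto
      then show "x \<in> (\<Union>j. D j)" using i by (auto simp: D_def)
    qed
  qed (use C hI \<delta> in \<open>auto simp: D_def\<close>)
  also have "\<dots> = (\<Sum>j<card I. ball_weight d (D j))"
    using d by (intro suminf_finite) (auto simp: D_def zero_power)
  also have "\<dots> = (\<Sum>j\<in>{0..<card I}. ball_weight d (C (h j)))"
    by (intro sum.cong) (auto simp: D_def)
  also have "\<dots> = (\<Sum>i\<in>I. ball_weight d (C i))"
    by (rule sum.reindex_bij_betw[OF h])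
  finally show ?thesis .
qed

text \<open>Cover by grid cells of side \<open>1 / N\<close> inside \<open>span B\<close>: there are
  \<open>(2 * N + 1) ^ d\<close> of them, of diameter at most \<open>d / N\<close> by the l1 bound
  on the norm, and \<open>(2 * N + 1) * (d / N) \<le> 3 * d\<close> independently of
  \<open>N\<close>.\<close>

lemma hausdorff_coordinate_ball_finite:
  fixes B :: "'a::euclidean_space set"
  assumes d: "1 \<le> d" and B: "B \<subseteq> Basis" "card B = d"
  shows "hausdorff_outer d (span B \<inter> cball 0 1) < top"
proof -
  let ?A = "span B \<inter> cball 0 1"
  have fB: "finite B" using B finite_Basis finite_subset by blast
  have pre: "hausdorff_pre d (2 * real d / real N) ?A \<le> ennreal (unit_ball_vol (real d) * (3 * real d) ^ d)"
    if N: "1 \<le> N" for N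
  proof -
    define I where "I = B \<rightarrow>\<^sub>E {-int N..int N}"
    define C where "C g = {x \<in> span B. \<forall>b\<in>B. of_int (g b) \<le> x \<bullet> b * real N \<and> x \<bullet> b * real N < of_int (g b) + 1}" for g :: "'a \<Rightarrow> int"
    have fI: "finite I" unfolding I_def using fB by (intro finite_PiE) auto
    have cI: "card I = (2 * N + 1) ^ d"
      unfolding I_def using fB B by (subst card_PiE) (auto simp: nat_add_distrib nat_mult_distrib)
    have dist: "dist x y \<le> real d / real N" if "x \<in> C g" "y \<in> C g" for x y g
    proof -
      have xy: "x - y \<in> span B" using that by (auto simp: C_def span_diff)
      have co: "\<bar>(x - y) \<bullet> b\<bar> \<le> (if b \<in> B then 1 / real N else 0)" if b: "b \<in> Basis" for b
      proof (cases "b \<in> B")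
        case True
        then have "of_int (g b) \<le> x \<bullet> b * real N" "x \<bullet> b * real N < of_int (g b) + 1"
          "of_int (g b) \<le> y \<bullet> b * real N" "y \<bullet> b * real N < of_int (g b) + 1"
          using \<open>x \<in> C g\<close> \<open>y \<in> C g\<close> by (auto simp: C_def)
        then have "\<bar>x \<bullet> b * real N - y \<bullet> b * real N\<bar> \<le> 1" by linarith
        then have "\<bar>(x - y) \<bullet> b\<bar> * real N \<le> 1"
          by (metis abs_mult abs_of_nat inner_diff_left left_diff_distrib')
        then show ?thesis using N True by (simp add: field_simps)
      next
        case False
        then show ?thesis using xy B b by (simp add: span_substd_basis)
      qed
      have "norm (x - y) \<le> (\<Sum>b\<in>Basis. \<bar>(x - y) \<bullet> b\<bar>)" by (rule norm_le_l1)
      also have "\<dots> \<le> (\<Sum>b\<in>Basis. if b \<in> B then 1 / real N else 0)" by (rule sum_mono) (rule co)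
      also have "\<dots> = (\<Sum>b\<in>B. 1 / real N)"
        using B by (subst sum.inter_restrict[symmetric]) (auto simp: Int_absorb1)
      also have "\<dots> = real d / real N" using B by simp
      finally show ?thesis by (simp add: dist_norm)
    qed
    have bd: "bounded (C g)" for g
    proof (cases "C g = {}")
      case False
      then obtain x where "x \<in> C g" by blast
      then show ?thesis using dist unfolding bounded_def by blast
    qed simp
    have diam: "diameter (C g) \<le> real d / real N" for g
      by (rule diameter_le) (use dist in \<open>auto simp: dist_norm\<close>)
    have cov: "?A \<subseteq> (\<Union>g\<in>I. C g)"
    proof
      fix x assume x: "x \<in> ?A"
      \<comment> \<open>Coordinates are at most 1 in modulus, so the floors lie between
        \<open>- N\<close> and \<open>N\<close>. The value \<open>N\<close> occurs at coordinate 1,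
        hence \<open>2 * N + 1\<close> cells per direction.\<close>
      define g where "g = restrict (\<lambda>b. \<lfloor>x \<bullet> b * real N\<rfloor>) B"
      have "g b \<in> {-int N..int N}" if "b \<in> B" for b
      proof -
        have "\<bar>x \<bullet> b\<bar> \<le> 1" using x B that Basis_le_norm[of b x] by auto
        then have "\<bar>x \<bullet> b * real N\<bar> \<le> real N" by (simp add: abs_mult mult_left_le_one_le)
        then have "- real N \<le> x \<bullet> b * real N" "x \<bullet> b * real N \<le> real N" by linarith+
        then have "- int N \<le> \<lfloor>x \<bullet> b * real N\<rfloor>" "\<lfloor>x \<bullet> b * real N\<rfloor> \<le> int N"
          by (simp_all add: le_floor_iff floor_le_iff)
        then show ?thesis using that by (simp add: g_def)
      qed
      then have "g \<in> I" by (auto simp: I_def g_def)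
      moreover have "x \<in> C g" using x by (auto simp: C_def g_def)
      ultimately show "x \<in> (\<Union>g\<in>I. C g)" by blast
    qed
    have "hausdorff_pre d (2 * real d / real N) ?A \<le> (\<Sum>g\<in>I. ball_weight d (C g))"
    proof (rule hausdorff_pre_finite_cover[OF d fI _ cov])
      show "diameter (C i) \<le> 2 * real d / real N" for i
        using diam[of i] by (rule order_trans) (simp add: divide_right_mono)
    qed (use bd in auto)
    also have "\<dots> \<le> (\<Sum>g\<in>I. ennreal (unit_ball_vol (real d) * (real d / real N) ^ d))"
    proof (intro sum_mono ennreal_leI mult_left_mono power_mono)
      show "diameter (C i) / 2 \<le> real d / real N" for i
        using diam[of i] diameter_ge_0[OF bd, of i] by linarith
    qed (auto simp: diameter_ge_0 bd)
    also have "\<dots> = ennreal (real (card I) * (unit_ball_vol (real d) * (real d / real N) ^ d))"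
      by (simp add: ennreal_mult' ennreal_of_nat_eq_real_of_nat)
    also have "\<dots> \<le> ennreal (unit_ball_vol (real d) * (3 * real d) ^ d)"
    proof (intro ennreal_leI)
      have "real (card I) * (real d / real N) ^ d = ((2 * real N + 1) * (real d / real N)) ^ d"
      proof -
        have "real (card I) = (2 * real N + 1) ^ d" unfolding cI of_nat_power by (simp add: add.commute)
        then show ?thesis using power_mult_distrib[of "2 * real N + 1" "real d / real N" d] by (rule trans[OF arg_cong[where f="\<lambda>u. u * _"] sym])
      qed
      also have "\<dots> \<le> (3 * real d) ^ d"
        using N mult_right_mono[of 1 "real N" "real d"] by (intro power_mono) (auto simp: field_simps)
      finally show "real (card I) * (unit_ball_vol (real d) * (real d / real N) ^ d) \<le> unit_ball_vol (real d) * (3 * real d) ^ d"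
        by (simp add: mult.left_commute mult_left_mono)
    qed
    finally show ?thesis .
  qed
  have "hausdorff_pre d \<delta> ?A \<le> ennreal (unit_ball_vol (real d) * (3 * real d) ^ d)" if "0 < \<delta>" for \<delta>
  proof -
    obtain N :: nat where N: "2 * real d / \<delta> < real N" using reals_Archimedean2 by blast
    then have "1 \<le> N" using that d by (cases N) (auto simp: field_simps)
    moreover from this have "2 * real d / real N \<le> \<delta>" using N that by (simp add: field_simps)
    ultimately show ?thesis using pre hausdorff_pre_antimono order_trans by blast
  qed
  then have "hausdorff_outer d ?A \<le> ennreal (unit_ball_vol (real d) * (3 * real d) ^ d)"
    unfolding hausdorff_outer_def by (auto intro: SUP_least)
  then show ?thesis by (rule le_less_trans) simp
qed

text \<open>Each covering set is replaced by a box over it that has unit width orthogonally to \<open>span B\<close>, so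
  that Lebesgue measure on the ambient space bounds the weights from below.\<close>

lemma hausdorff_coordinate_ball_pos:
  fixes B :: "'a::euclidean_space set"
  assumes d: "1 \<le> d" and B: "B \<subseteq> Basis" "card B = d"
  shows "0 < hausdorff_outer d (span B \<inter> ball 0 1)"
proof -
  let ?A = "span B \<inter> ball 0 1"
  let ?n = "DIM('a)"
  have fB: "finite B" using B finite_Basis finite_subset by blast
  define Z where "Z s c = cbox (\<Sum>b\<in>Basis. (if b \<in> B then c \<bullet> b - s else -1) *\<^sub>R b)
                               (\<Sum>b\<in>Basis. (if b \<in> B then c \<bullet> b + s else 1) *\<^sub>R b)" for s and c :: 'a
  have Z_iff: "x \<in> Z s c \<longleftrightarrow> (\<forall>b\<in>Basis. if b \<in> B then \<bar>x \<bullet> b - c \<bullet> b\<bar> \<le> s else \<bar>x \<bullet> b\<bar> \<le> 1)" for x s c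
    unfolding Z_def mem_box by (intro ball_cong) (auto simp: abs_le_iff)
  have Z_vol: "emeasure lborel (Z s c) = ennreal ((2 * s) ^ d * 2 ^ (?n - d))" if "0 \<le> s" for s c
  proof -
    have "emeasure lborel (Z s c) = ennreal (\<Prod>b\<in>Basis. if b \<in> B then 2 * s else 2)"
      unfolding Z_def using that
      by (subst emeasure_lborel_cbox) (auto intro!: arg_cong[where f=ennreal] prod.cong simp: inner_diff_left)
    also have "(\<Prod>b\<in>Basis. if b \<in> B then 2 * s else 2) = (2 * s) ^ d * 2 ^ (?n - d)"
      using B fB by (simp add: prod.If_cases Int_absorb1 card_Diff_subset Diff_eq[symmetric])
    finally show ?thesis .
  qed
  \<comment> \<open>A box of half-width \<open>diameter C\<close> along \<open>B\<close> has volume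
    \<open>(2 * diameter C) ^ d * 2 ^ (?n - d)\<close>; writing \<open>2 * diameter C\<close> as
    \<open>4 * (diameter C / 2)\<close> produces the \<open>4 ^ d\<close>.\<close>
  define K where "K = 4 ^ d * 2 ^ (?n - d) / unit_ball_vol (real d)"
  have ub: "unit_ball_vol (real d) \<noteq> 0" by (metis of_nat_0_le_iff less_irrefl unit_ball_vol_pos)
  have K: "0 < K" by (simp add: K_def)
  \<comment> \<open>With half-width \<open>1 / (2 * d)\<close>, adding up \<open>d\<close>
    coordinates keeps the projection to \<open>span B\<close> within radius
    \<open>1 / 2\<close>.\<close>
  have lower: "emeasure lborel (Z (1 / (2 * real d)) 0) \<le> ennreal K * hausdorff_pre d 1 ?A"
  proof (rule hausdorff_pre_cmult_geI[OF K])
      fix C :: "nat \<Rightarrow> 'a set"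
      assume C: "\<And>j. bounded (C j)" "\<And>j. diameter (C j) \<le> 1" "?A \<subseteq> (\<Union>j. C j)"
      define c where "c j = (SOME x. x \<in> C j)" for j
      define D where "D j = (if C j = {} then {} else Z (diameter (C j)) (c j))" for j
      have cov: "Z (1 / (2 * real d)) 0 \<subseteq> (\<Union>j. D j)"
      proof
        fix x assume x: "x \<in> Z (1 / (2 * real d)) 0"
        \<comment> \<open>The sets \<open>C j\<close> cover only the projection \<open>p\<close> of
          \<open>x\<close> to \<open>span B\<close>. The box over \<open>C j\<close> recaptures
          \<open>x\<close>, since the other coordinates are merely bounded by 1 in it.\<close>
        define p where "p = (\<Sum>b\<in>B. (x \<bullet> b) *\<^sub>R b)"
        have pb: "p \<bullet> b = (if b \<in> B then x \<bullet> b else 0)" if "b \<in> Basis" for b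
        proof -
          have "p \<bullet> b = (\<Sum>c\<in>B. if c = b then x \<bullet> b else 0)"
            unfolding p_def inner_sum_left using that B
            by (intro sum.cong) (auto simp: inner_Basis subset_iff)
          then show ?thesis by (simp add: fB)
        qed
        have "norm p \<le> (\<Sum>b\<in>B. norm ((x \<bullet> b) *\<^sub>R b))" unfolding p_def by (rule norm_sum)
        also have "\<dots> \<le> (\<Sum>b\<in>B. 1 / (2 * real d))"
        proof (rule sum_mono)
          fix b assume b: "b \<in> B"
          then have bB: "b \<in> Basis" using B by blast
          then show "norm ((x \<bullet> b) *\<^sub>R b) \<le> 1 / (2 * real d)"
            using bspec[OF x[unfolded Z_iff] bB] b bB by simp
        qed
        also have "\<dots> = 1 / 2" using B d by simp
        finally have "norm p \<le> 1 / 2" .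
        moreover have "p \<in> span B" unfolding p_def by (intro span_sum span_scale span_base)
        ultimately have "p \<in> ?A" by (simp add: mem_ball_0)
        then obtain j where j: "p \<in> C j" using C(3) by blast
        then have cj: "c j \<in> C j" unfolding c_def by (rule someI)
        have "\<bar>p \<bullet> b - c j \<bullet> b\<bar> \<le> diameter (C j)" if "b \<in> Basis" for b
        proof -
          have "\<bar>(p - c j) \<bullet> b\<bar> \<le> norm (p - c j)" by (rule Basis_le_norm[OF that])
          also have "\<dots> \<le> diameter (C j)"
            using diameter_bounded_bound[OF C(1) j cj] by (simp add: dist_norm)
          finally show ?thesis by (simp add: inner_diff_left)
        qed
        note close = this
        have "x \<in> Z (diameter (C j)) (c j)"
          unfolding Z_iff
        proof
          fix b :: 'a assume b: "b \<in> Basis"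
          show "if b \<in> B then \<bar>x \<bullet> b - c j \<bullet> b\<bar> \<le> diameter (C j) else \<bar>x \<bullet> b\<bar> \<le> 1"
          proof (cases "b \<in> B")
            case True
            then show ?thesis using close[OF b] unfolding pb[OF b] by simp
          next
            case False
            then show ?thesis using bspec[OF x[unfolded Z_iff] b] by simp
          qed
        qed
        then show "x \<in> (\<Union>j. D j)" using j by (auto simp: D_def)
      qed
      have "emeasure lborel (Z (1 / (2 * real d)) 0) \<le> emeasure lborel (\<Union>j. D j)"
        by (rule emeasure_mono[OF cov]) (auto simp: D_def Z_def)
      also have "\<dots> \<le> (\<Sum>j. emeasure lborel (D j))"
        by (rule emeasure_subadditive_countably) (auto simp: D_def Z_def)
      also have "\<dots> \<le> (\<Sum>j. ennreal K * ball_weight d (C j))"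
      proof (intro suminf_le)
        fix j
        show "emeasure lborel (D j) \<le> ennreal K * ball_weight d (C j)"
        proof (cases "C j = {}")
          case False
          have "(2 * diameter (C j)) ^ d * 2 ^ (?n - d) = K * (unit_ball_vol (real d) * (diameter (C j) / 2) ^ d)"
          proof -
            have "(2 * diameter (C j)) ^ d = 4 ^ d * (diameter (C j) / 2) ^ d"
            proof -
              have "2 * diameter (C j) = 4 * (diameter (C j) / 2)" by simp
              then show ?thesis by (simp only: power_mult_distrib)
            qed
            then show ?thesis using ub by (simp add: K_def)
          qed
          then show ?thesis using False K Z_vol[of "diameter (C j)" "c j"] diameter_ge_0[OF C(1)]
            by (simp add: D_def ennreal_mult'[symmetric])
        qed (simp add: D_def)
      qed auto
      also have "\<dots> = ennreal K * (\<Sum>j. ball_weight d (C j))" by (rule ennreal_suminf_cmult)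
      finally show "emeasure lborel (Z (1 / (2 * real d)) 0) \<le> ennreal K * (\<Sum>j. ball_weight d (C j))" .
  qed
  have "0 < emeasure lborel (Z (1 / (2 * real d)) 0)"
    using d by (subst Z_vol) auto
  then have "0 < hausdorff_pre d 1 ?A"
    using lower by (metis less_le_trans mult_zero_right not_gr_zero)
  then show ?thesis
    using hausdorff_pre_le_outer[of 1 d ?A] by simp
qed

text \<open>A linear isometry carries \<open>P\<close> to the span of \<open>d\<close> coordinate
  vectors and back; being 1-Lipschitz in both directions, it transports both bounds.\<close>

lemma hausdorff_subspace_ball:
  fixes P :: "'a::euclidean_space set"
  assumes d: "1 \<le> d" and P: "subspace P" "dim P = d"
  shows "0 < hausdorff_outer d (P \<inter> ball 0 1)" and "hausdorff_outer d (P \<inter> ball 0 1) < top"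
proof -
  have "d \<le> DIM('a)" using P dim_subset_UNIV by blast
  then obtain B where B: "B \<subseteq> (Basis :: 'a set)" "card B = d" by (meson obtain_subset_with_card_n)
  have "independent B" using B independent_Basis independent_mono by blast
  then have dimB: "dim (span B) = d" using B by (simp add: dim_eq_card_independent)
  obtain f g where fg: "linear f" "linear g" "f ` P = span B" "g ` span B = P"
    "\<And>x. x \<in> P \<Longrightarrow> norm (f x) = norm x" "\<And>x. x \<in> span B \<Longrightarrow> norm (g x) = norm x"
    "\<And>x. x \<in> P \<Longrightarrow> g (f x) = x" "\<And>x. x \<in> span B \<Longrightarrow> f (g x) = x"
    using isometries_subspaces[OF P(1) subspace_span[of B]] P(2) dimB by metis
  have "f ` (P \<inter> ball 0 1) = span B \<inter> ball 0 1"
  proof (intro set_eqI iffI)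
    show "y \<in> f ` (P \<inter> ball 0 1)" if "y \<in> span B \<inter> ball 0 1" for y
      using that fg(4,6,8) by (intro image_eqI[of _ _ "g y"]) auto
  qed (use fg in auto)
  moreover have "hausdorff_outer d (f ` (P \<inter> ball 0 1)) \<le> ennreal (1 ^ d) * hausdorff_outer d (P \<inter> ball 0 1)"
  proof (rule hausdorff_outer_lipschitz_image[OF d])
    show "dist (f x) (f y) \<le> 1 * dist x y" if "x \<in> P \<inter> ball 0 1" "y \<in> P \<inter> ball 0 1" for x y
      using that fg(5)[of "x - y"] P(1) by (simp add: dist_norm linear_diff[OF fg(1), symmetric] subspace_diff)
  qed simp
  ultimately show "0 < hausdorff_outer d (P \<inter> ball 0 1)"
    using hausdorff_coordinate_ball_pos[OF d B] by (metis ennreal_1 less_le_trans mult_1 power_one)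
  have "g ` (span B \<inter> ball 0 1) = P \<inter> ball 0 1"
  proof (intro set_eqI iffI)
    show "y \<in> g ` (span B \<inter> ball 0 1)" if "y \<in> P \<inter> ball 0 1" for y
      using that fg(3,5,7) by (intro image_eqI[of _ _ "f y"]) auto
  qed (use fg in auto)
  moreover have "hausdorff_outer d (g ` (span B \<inter> ball 0 1)) \<le> ennreal (1 ^ d) * hausdorff_outer d (span B \<inter> ball 0 1)"
  proof (rule hausdorff_outer_lipschitz_image[OF d])
    show "dist (g x) (g y) \<le> 1 * dist x y" if "x \<in> span B \<inter> ball 0 1" "y \<in> span B \<inter> ball 0 1" for x y
      using that fg(6)[of "x - y"] by (simp add: dist_norm linear_diff[OF fg(2), symmetric] span_diff)
  qed simp
  ultimately have "hausdorff_outer d (P \<inter> ball 0 1) \<le> hausdorff_outer d (span B \<inter> ball 0 1)" by simp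
  also have "\<dots> \<le> hausdorff_outer d (span B \<inter> cball 0 1)" by (rule hausdorff_outer_mono) auto
  also have "\<dots> < top" by (rule hausdorff_coordinate_ball_finite[OF d B])
  finally show "hausdorff_outer d (P \<inter> ball 0 1) < top" .
qed

text \<open>A dilation is Lipschitz with its ratio as constant. Applying the upper bound to the
  inverse dilation gives the reverse inequality.\<close>

lemma hausdorff_subspace_scale:
  fixes P :: "'a::euclidean_space set"
  assumes d: "1 \<le> d" and P: "subspace P" and r: "0 < r"
  shows "hausdorff_outer d (P \<inter> ball 0 r) = ennreal (r ^ d) * hausdorff_outer d (P \<inter> ball 0 1)"
proof (rule antisym)
  have image: "(*\<^sub>R) s ` (P \<inter> ball 0 t) = P \<inter> ball 0 (s * t)" if "0 < s" for s t
  proof (intro set_eqI iffI)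
    show "y \<in> (*\<^sub>R) s ` (P \<inter> ball 0 t)" if "y \<in> P \<inter> ball 0 (s * t)" for y
      using that \<open>0 < s\<close> P by (intro image_eqI[of _ _ "y /\<^sub>R s"]) (auto simp: subspace_scale field_simps)
  qed (use that P in \<open>auto simp: subspace_scale\<close>)
  have scale: "hausdorff_outer d (P \<inter> ball 0 (s * t)) \<le> ennreal (s ^ d) * hausdorff_outer d (P \<inter> ball 0 t)"
    if "0 < s" for s t
  proof -
    have "hausdorff_outer d ((*\<^sub>R) s ` (P \<inter> ball 0 t)) \<le> ennreal (s ^ d) * hausdorff_outer d (P \<inter> ball 0 t)"
      using that by (intro hausdorff_outer_lipschitz_image[OF d]) (auto simp: dist_norm simp flip: scaleR_diff_right)
    then show ?thesis by (simp only: image[OF that])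
  qed
  show "hausdorff_outer d (P \<inter> ball 0 r) \<le> ennreal (r ^ d) * hausdorff_outer d (P \<inter> ball 0 1)"
    using scale[OF r, of 1] by simp
  have "hausdorff_outer d (P \<inter> ball 0 (1 / r * r)) \<le> ennreal ((1 / r) ^ d) * hausdorff_outer d (P \<inter> ball 0 r)"
    using r by (intro scale) auto
  then have "ennreal (r ^ d) * hausdorff_outer d (P \<inter> ball 0 1)
      \<le> ennreal (r ^ d) * (ennreal ((1 / r) ^ d) * hausdorff_outer d (P \<inter> ball 0 r))"
    using r by (intro mult_left_mono) auto
  also have "\<dots> = hausdorff_outer d (P \<inter> ball 0 r)"
    using r by (simp add: mult.assoc[symmetric] ennreal_mult'[symmetric] power_mult_distrib[symmetric])
  finally show "ennreal (r ^ d) * hausdorff_outer d (P \<inter> ball 0 1) \<le> hausdorff_outer d (P \<inter> ball 0 r)" .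
qed

text \<open>The sign makes open rays to the right pull back to open balls, which have finite
  measure, as the uniqueness theorem for measures agreeing on such rays demands. Scaling then
  determines the measure of each ball up to \<open>\<kappa>\<close>.\<close>

lemma hausdorff_radial_distr:
  fixes P :: "'a::euclidean_space set"
  assumes d: "1 \<le> d" and P: "subspace P" "dim P = d"
  defines "\<kappa> \<equiv> enn2real (hausdorff_outer d (P \<inter> ball 0 1))"
  shows "distr (restrict_space (hausdorff_measure d) P) borel (\<lambda>y. - norm y)
    = density lborel (\<lambda>t. ennreal (\<kappa> * real d * (- t) ^ (d - 1)) * indicator {..0} t)" (is "?N = ?D")
proof -
  have Pb: "P \<in> sets borel" using closed_subspace[OF P(1)] by (rule borel_closed)
  then have Ph: "P \<in> sets (hausdorff_measure d)" using borel_sets_hausdorff_measure[OF d] by blast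
  have \<kappa>: "hausdorff_outer d (P \<inter> ball 0 1) = ennreal \<kappa>" "0 \<le> \<kappa>"
    using hausdorff_subspace_ball(2)[OF d P] by (auto simp: \<kappa>_def)
  have meas: "(\<lambda>y. - norm y) \<in> borel_measurable (restrict_space (hausdorff_measure d) P)"
  proof (rule measurable_restrict_space1)
    have "(\<lambda>y::'a. - norm y) \<in> borel_measurable borel" by measurable
    then show "(\<lambda>y::'a. - norm y) \<in> borel_measurable (hausdorff_measure d)"
      using borel_sets_hausdorff_measure[OF d] by (auto simp: measurable_def)
  qed
  have N: "emeasure ?N {x<..} = ennreal (if x < 0 then \<kappa> * (- x) ^ d else 0)" for x
  proof -
    have eq: "(\<lambda>y. - norm y) -` {x<..} \<inter> space (restrict_space (hausdorff_measure d) P) = P \<inter> ball 0 (- x)"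
      by (auto simp: space_restrict_space)
    have "emeasure ?N {x<..} = emeasure (restrict_space (hausdorff_measure d) P) (P \<inter> ball 0 (- x))"
      using meas by (subst emeasure_distr) (auto simp only: eq, simp)
    also have "\<dots> = hausdorff_outer d (P \<inter> ball 0 (- x))"
      using Ph Pb by (subst emeasure_restrict_space) (auto simp: emeasure_hausdorff_borel[OF d])
    also have "\<dots> = ennreal (if x < 0 then \<kappa> * (- x) ^ d else 0)"
    proof (cases "x < 0")
      case True
      then show ?thesis
        using hausdorff_subspace_scale[OF d P(1), of "- x"] \<kappa> by (simp add: ennreal_mult' mult.commute)
    next
      case False
      then have "ball 0 (- x) = ({} :: 'a set)" by (auto simp: ball_empty)
      then show ?thesis using False by (simp only: Int_empty_right hausdorff_outer_empty[OF d]) simp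
    qed
    finally show ?thesis .
  qed
  have D: "emeasure ?D {x<..} = ennreal (if x < 0 then \<kappa> * (- x) ^ d else 0)" for x
  proof (cases "x < 0")
    case True
    have "emeasure ?D {x<..} = (\<integral>\<^sup>+t. ennreal (\<kappa> * real d * (- t) ^ (d - 1)) * indicator {..0} t * indicator {x<..} t \<partial>lborel)"
      by (rule emeasure_density) auto
    \<comment> \<open>Adding the endpoint \<open>x\<close>, a null set, yields the closed interval
      for the fundamental theorem of calculus.\<close>
    also have "\<dots> = (\<integral>\<^sup>+t. ennreal (\<kappa> * real d * (- t) ^ (d - 1)) * indicator {x..0} t \<partial>lborel)"
      using AE_lborel_singleton[of x] by (intro nn_integral_cong_AE) (auto elim!: eventually_mono split: split_indicator)
    also have "\<dots> = ennreal (- \<kappa> * (- 0) ^ d - (- \<kappa> * (- x) ^ d))"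
    proof (rule nn_integral_FTC_Icc)
      show "((\<lambda>t. - \<kappa> * (- t) ^ d) has_real_derivative \<kappa> * real d * (- t) ^ (d - 1)) (at t)" for t
        by (rule derivative_eq_intros refl | simp)+
    qed (use True \<kappa>(2) in auto)
    finally show ?thesis using True d by (simp add: zero_power)
  next
    case False
    have "emeasure ?D {x<..} = (\<integral>\<^sup>+t. ennreal (\<kappa> * real d * (- t) ^ (d - 1)) * indicator {..0} t * indicator {x<..} t \<partial>lborel)"
      by (rule emeasure_density) auto
    also have "\<dots> = (\<integral>\<^sup>+(t::real). 0 \<partial>lborel)"
      using False by (intro nn_integral_cong) (auto split: split_indicator)
    finally show ?thesis using False by simp
  qed
  show ?thesis
  proof (rule measure_eqI_lessThan)
    show "emeasure ?N {x<..} < \<infinity>" for x unfolding N by simp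
    show "emeasure ?N {x<..} = emeasure ?D {x<..}" for x unfolding N D ..
  qed simp_all
qed

text \<open>Polar coordinates in \<open>P\<close> through the pushforward. The measure of the unit
  ball stays as an unevaluated factor and cancels later between two profiles.\<close>

lemma hausdorff_radial_integral:
  fixes P :: "'a::euclidean_space set" and f :: "real \<Rightarrow> real"
  assumes d: "1 \<le> d" and P: "subspace P" "dim P = d"
    and f: "continuous_on UNIV f" "\<And>t. 1 < \<bar>t\<bar> \<Longrightarrow> f t = 0"
  shows "(\<integral>y\<in>P. f (norm y) \<partial>hausdorff_measure d)
    = enn2real (hausdorff_outer d (P \<inter> ball 0 1)) * real d * integral {0..1} (\<lambda>r. f r * r ^ (d - 1))"
proof -
  define \<kappa> where "\<kappa> = enn2real (hausdorff_outer d (P \<inter> ball 0 1))"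
  have \<kappa>: "0 \<le> \<kappa>" by (simp add: \<kappa>_def)
  have Pb: "P \<in> sets borel" using closed_subspace[OF P(1)] by (rule borel_closed)
  then have Ph: "P \<in> sets (hausdorff_measure d)" using borel_sets_hausdorff_measure[OF d] by blast
  have fm [measurable]: "f \<in> borel_measurable borel" using f(1) by (rule borel_measurable_continuous_onI)
  have meas: "(\<lambda>y. - norm y) \<in> borel_measurable (restrict_space (hausdorff_measure d) P)"
  proof (rule measurable_restrict_space1)
    have "(\<lambda>y::'a. - norm y) \<in> borel_measurable borel" by measurable
    then show "(\<lambda>y::'a. - norm y) \<in> borel_measurable (hausdorff_measure d)"
      using borel_sets_hausdorff_measure[OF d] by (auto simp: measurable_def)
  qed
  have "(\<integral>y\<in>P. f (norm y) \<partial>hausdorff_measure d) = (\<integral>y. f (norm y) \<partial>restrict_space (hausdorff_measure d) P)"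
    using Ph by (simp add: integral_restrict_space set_lebesgue_integral_def)
  also have "\<dots> = (\<integral>s. f (- s) \<partial>distr (restrict_space (hausdorff_measure d) P) borel (\<lambda>y. - norm y))"
    using meas by (subst integral_distr) auto
  also have "\<dots> = (\<integral>s. f (- s) \<partial>density lborel (\<lambda>t. ennreal (\<kappa> * real d * (- t) ^ (d - 1) * indicator {..0} t)))"
    unfolding hausdorff_radial_distr[OF d P] \<kappa>_def[symmetric]
    by (auto intro!: arg_cong2[where f="integral\<^sup>L"] arg_cong2[where f=density] ext split: split_indicator)
  also have "\<dots> = (\<integral>t. (\<kappa> * real d * (- t) ^ (d - 1) * indicator {..0} t) *\<^sub>R f (- t) \<partial>lborel)"
    using \<kappa> by (subst integral_density) (auto split: split_indicator)
  \<comment> \<open>Reflecting \<open>t\<close> undoes the sign of the pushforward.\<close>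
  also have "\<dots> = (\<integral>t. (\<kappa> * real d * t ^ (d - 1) * indicator {..0} (- t)) *\<^sub>R f t \<partial>lborel)"
    by (subst lborel_integral_real_affine[of "-1" _ 0]) auto
  also have "\<dots> = (\<integral>t. \<kappa> * real d * (indicator {0..1} t *\<^sub>R (f t * t ^ (d - 1))) \<partial>lborel)"
    using f(2) by (intro Bochner_Integration.integral_cong) (auto split: split_indicator)
  also have "\<dots> = \<kappa> * real d * (\<integral>t. indicator {0..1} t *\<^sub>R (f t * t ^ (d - 1)) \<partial>lborel)"
    by (rule integral_mult_right_zero)
  also have "(\<integral>t. indicator {0..1} t *\<^sub>R (f t * t ^ (d - 1)) \<partial>lborel) = integral {0..1} (\<lambda>r. f r * r ^ (d - 1))"
  proof -
    have "set_integrable lborel {0..1} (\<lambda>r. f r * r ^ (d - 1))"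
      unfolding set_integrable_def
      by (rule borel_integrable_compact) (auto intro!: continuous_intros continuous_on_subset[OF f(1)])
    from set_borel_integral_eq_integral(2)[OF this] show ?thesis by (simp add: set_lebesgue_integral_def)
  qed
  finally show ?thesis by (simp add: \<kappa>_def)
qed

section \<open>Compactness of the Grassmannian\<close>

lemma
  fixes S :: "'a::euclidean_space set"
  assumes S: "subspace S"
  shows orth_proj_in: "blinfun_apply (orth_proj S) x \<in> S"
    and orth_proj_ident: "x \<in> S \<Longrightarrow> blinfun_apply (orth_proj S) x = x"
    and orth_proj_sym: "blinfun_apply (orth_proj S) x \<bullet> y = x \<bullet> blinfun_apply (orth_proj S) y"
    and norm_orth_proj: "norm (orth_proj S) \<le> 1"
proof -
  let ?A = "blinfun_apply (orth_proj S)"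
  note [simp] = orth_proj_apply[OF S]
  note cp = closest_point_subspace[OF S]
  show mem: "?A x \<in> S" for x using cp(1) by simp
  show "?A x = x" if "x \<in> S"
    using that by (simp add: orth_proj_unique[OF S that] orthogonal_def)
  have o: "(x - ?A x) \<bullet> ?A y = 0" for x y
    using cp(2)[OF mem[of y], of x] by (simp add: orthogonal_def)
  show "?A x \<bullet> y = x \<bullet> ?A y"
    using o[of x y] o[of y x] by (simp add: inner_diff_left inner_diff_right inner_commute)
  show "norm (orth_proj S) \<le> 1"
  proof (rule norm_blinfun_bound)
    show "norm (?A x) \<le> 1 * norm x" for x
    proof -
      have "norm (?A x) ^ 2 = x \<bullet> ?A x"
        using o[of x x] by (simp add: inner_diff_left power2_norm_eq_inner)
      also have "\<dots> \<le> norm x * norm (?A x)" by (rule norm_cauchy_schwarz)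
      finally have "norm (?A x) * norm (?A x) \<le> norm x * norm (?A x)" by (simp add: power2_eq_square)
      then show ?thesis
        by (cases "norm (?A x) = 0") (auto dest: mult_right_le_imp_le)
    qed
  qed simp
qed

text \<open>The residual \<open>x - A x\<close> is orthogonal to the range of \<open>A\<close>,
  which characterises the closest point. This recognises limits of projections as
  projections.\<close>

lemma blinfun_self_adjoint_idempotent:
  fixes A :: "'a::euclidean_space \<Rightarrow>\<^sub>L 'a"
  assumes sym: "\<And>x y. blinfun_apply A x \<bullet> y = x \<bullet> blinfun_apply A y"
    and idem: "\<And>x. blinfun_apply A (blinfun_apply A x) = blinfun_apply A x"
  shows "A = orth_proj (range (blinfun_apply A))"
proof (rule blinfun_eqI)
  have S: "subspace (range (blinfun_apply A))"
    by (intro linear_subspace_image subspace_UNIV bounded_linear.linear blinfun.bounded_linear_right)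
  fix x
  have "closest_point (range (blinfun_apply A)) x = blinfun_apply A x"
  proof (rule orth_proj_unique[OF S])
    fix y assume "y \<in> range (blinfun_apply A)"
    then obtain z where "y = blinfun_apply A z" by blast
    then show "orthogonal (x - blinfun_apply A x) y"
      using sym[of "x - blinfun_apply A x" z] idem[of x]
      by (simp add: orthogonal_def blinfun.diff_right)
  qed simp
  then show "blinfun_apply A x = blinfun_apply (orth_proj (range (blinfun_apply A))) x"
    by (simp add: orth_proj_apply[OF S])
qed

text \<open>\<open>A\<close> is injective on \<open>S\<close>: a kernel vector in \<open>S\<close>
  would be reproduced by \<open>orth_proj S - A\<close>, whose norm is below 1. Used in both
  directions, it shows that a limit of rank \<open>d\<close> projections has rank
  \<open>d\<close>.\<close>

lemma dim_le_of_orth_proj_close: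
  fixes A :: "'a::euclidean_space \<Rightarrow>\<^sub>L 'a"
  assumes S: "subspace S" and close: "norm (orth_proj S - A) < 1"
  shows "dim S \<le> dim (range (blinfun_apply A))"
proof -
  have lin: "linear (blinfun_apply A)"
    by (intro bounded_linear.linear blinfun.bounded_linear_right)
  have "inj_on (blinfun_apply A) (span S)"
  proof (subst linear_inj_on_iff_eq_0[OF lin])
    show "subspace (span S)" by simp
    show "\<forall>x\<in>span S. blinfun_apply A x = 0 \<longrightarrow> x = 0"
    proof (intro ballI impI)
      fix x assume x: "x \<in> span S" "blinfun_apply A x = 0"
      have "x \<in> S" using x(1) S by (metis span_eq_iff)
      then have "blinfun_apply (orth_proj S - A) x = x"
        using orth_proj_ident[OF S] x(2) by (simp add: blinfun.diff_left)
      then have "norm x \<le> norm (orth_proj S - A) * norm x"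
        using norm_blinfun[of "orth_proj S - A" x] by simp
      then show "x = 0"
        using mult_strict_right_mono[OF close, of "norm x"] by (cases "x = 0") auto
    qed
  qed
  then have "dim (blinfun_apply A ` S) = dim S" by (rule dim_image_eq[OF lin])
  then show ?thesis by (metis dim_subset image_mono subset_UNIV)
qed

text \<open>Compact fibres make \<open>K \<times> grassmannian d\<close> compact for compact
  \<open>K\<close>, so that the mass of a varifold is locally finite. Self-adjointness and
  idempotence pass to limits, and the rank is stable at distance below 1.\<close>

lemma compact_grassmannian: "compact (grassmannian d :: ('a::euclidean_space \<Rightarrow>\<^sub>L 'a) set)"
proof -
  have "closed (grassmannian d :: ('a \<Rightarrow>\<^sub>L 'a) set)"
  proof (unfold closed_sequential_limits, intro allI impI, elim conjE)
    fix F and A :: "'a \<Rightarrow>\<^sub>L 'a"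
    assume F: "\<forall>n. F n \<in> grassmannian d" and lim: "F \<longlonglongrightarrow> A"
    obtain S where S: "\<And>n. F n = orth_proj (S n)" "\<And>n. subspace (S n)" "\<And>n. dim (S n) = d"
      using F unfolding grassmannian_def by simp metis
    have limx: "(\<lambda>n. blinfun_apply (F n) (f n)) \<longlonglongrightarrow> blinfun_apply A y" if "f \<longlonglongrightarrow> y" for f y
      by (intro blinfun.tendsto lim that)
    have sym: "blinfun_apply A x \<bullet> y = x \<bullet> blinfun_apply A y" for x y
    proof (rule LIMSEQ_unique)
      show "(\<lambda>n. blinfun_apply (F n) x \<bullet> y) \<longlonglongrightarrow> blinfun_apply A x \<bullet> y"
        by (intro tendsto_inner limx tendsto_const)
      show "(\<lambda>n. blinfun_apply (F n) x \<bullet> y) \<longlonglongrightarrow> x \<bullet> blinfun_apply A y"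
        unfolding S(1) orth_proj_sym[OF S(2)]
        unfolding S(1)[symmetric] by (intro tendsto_inner limx tendsto_const)
    qed
    have idem: "blinfun_apply A (blinfun_apply A x) = blinfun_apply A x" for x
    proof (rule LIMSEQ_unique)
      show "(\<lambda>n. blinfun_apply (F n) (blinfun_apply (F n) x)) \<longlonglongrightarrow> blinfun_apply A (blinfun_apply A x)"
        by (intro limx tendsto_const)
      show "(\<lambda>n. blinfun_apply (F n) (blinfun_apply (F n) x)) \<longlonglongrightarrow> blinfun_apply A x"
        unfolding S(1) orth_proj_ident[OF S(2) orth_proj_in[OF S(2)]]
        unfolding S(1)[symmetric] by (intro limx tendsto_const)
    qed
    let ?R = "range (blinfun_apply A)"
    have R: "subspace ?R"
      by (intro linear_subspace_image subspace_UNIV bounded_linear.linear blinfun.bounded_linear_right)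
    have A: "A = orth_proj ?R" by (rule blinfun_self_adjoint_idempotent[OF sym idem])
    obtain n where n: "norm (F n - A) < 1"
      using LIMSEQ_D[OF lim zero_less_one] by blast
    have "dim (S n) \<le> dim ?R"
      by (rule dim_le_of_orth_proj_close[OF S(2)]) (use n S(1) in simp)
    moreover have "dim ?R \<le> dim (range (blinfun_apply (F n)))"
      by (rule dim_le_of_orth_proj_close[OF R]) (use n A in \<open>simp add: norm_minus_commute\<close>)
    moreover have "range (blinfun_apply (F n)) \<subseteq> S n"
      using orth_proj_in[OF S(2)] S(1) by auto
    then have "dim (range (blinfun_apply (F n))) \<le> dim (S n)" by (rule dim_subset)
    ultimately have "dim ?R = d" using S(3)[of n] by simp
    then show "A \<in> grassmannian d" unfolding grassmannian_def using A R by blast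
  qed
  moreover have "bounded (grassmannian d :: ('a \<Rightarrow>\<^sub>L 'a) set)"
    unfolding bounded_iff grassmannian_def using norm_orth_proj by blast
  ultimately show ?thesis by (simp add: compact_eq_bounded_closed)
qed

lemma norm_grassmannian_le: "A \<in> grassmannian d \<Longrightarrow> norm A \<le> 1"
  unfolding grassmannian_def using norm_orth_proj by blast

section \<open>Differentiation of Radon measures\<close>

lemma radon_sets_iff:
  assumes "open \<Omega>" "radon_measure_on \<Omega> \<mu>"
  shows "A \<in> sets \<mu> \<longleftrightarrow> A \<in> sets borel \<and> A \<subseteq> \<Omega>"
  using assms by (auto simp: radon_measure_on_def sets_restrict_space_iff)

lemma space_radon: "radon_measure_on \<Omega> \<mu> \<Longrightarrow> space \<mu> = \<Omega>"
  unfolding radon_measure_on_def by (metis sets_eq_imp_space_eq space_restrict_space space_borel Int_UNIV_right)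

text \<open>Extending the trace on \<open>D\<close> by zero to all Borel sets gives a measure to
  which the regularity theorems for finite Borel measures apply.\<close>

lemma emeasure_radon_trace:
  fixes \<Omega> :: "'a::euclidean_space set"
  assumes \<Omega>: "open \<Omega>" and \<mu>: "radon_measure_on \<Omega> \<mu>" and D: "D \<in> sets borel" "D \<subseteq> \<Omega>"
    and B: "B \<in> sets borel"
  shows "emeasure (distr (restrict_space \<mu> D) borel id) B = emeasure \<mu> (B \<inter> D)"
proof -
  have Ds: "D \<inter> space \<mu> \<in> sets \<mu>"
    using D by (auto simp: radon_sets_iff[OF \<Omega> \<mu>] space_radon[OF \<mu>] Int_absorb2)
  have "id \<in> measurable (restrict_space \<mu> D) borel"
  proof (rule measurable_restrict_space1, rule measurableI)
    show "id -` A \<inter> space \<mu> \<in> sets \<mu>" if "A \<in> sets borel" for A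
      using that \<Omega> by (auto simp: radon_sets_iff[OF \<Omega> \<mu>] space_radon[OF \<mu>])
  qed simp
  then have "emeasure (distr (restrict_space \<mu> D) borel id) B = emeasure (restrict_space \<mu> D) (B \<inter> D)"
    using B D(2) by (subst emeasure_distr) (auto simp: space_restrict_space space_radon[OF \<mu>] Int_absorb1 Int_absorb2 Int_commute)
  also have "\<dots> = emeasure \<mu> (B \<inter> D)"
    using Ds by (intro emeasure_restrict_space) auto
  finally show "emeasure (distr (restrict_space \<mu> D) borel id) B = emeasure \<mu> (B \<inter> D)" .
qed

text \<open>The trace on \<open>interior K\<close> is finite because \<open>K\<close> is compact;
  intersecting with the interior keeps the approximating set open.\<close>

lemma radon_null_outer_regular:
  fixes \<Omega> :: "'a::euclidean_space set"
  assumes \<Omega>: "open \<Omega>" and \<mu>: "radon_measure_on \<Omega> \<mu>"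
    and K: "compact K" "K \<subseteq> \<Omega>" and E: "E \<in> sets borel" "E \<subseteq> interior K" "emeasure \<mu> E = 0" and e: "0 < e"
  obtains U where "open U" "E \<subseteq> U" "U \<subseteq> interior K" "emeasure \<mu> U < e"
proof -
  let ?D = "interior K"
  have D: "?D \<in> sets borel" "?D \<subseteq> \<Omega>" using K interior_subset by auto
  let ?\<nu> = "distr (restrict_space \<mu> ?D) borel id"
  note em = emeasure_radon_trace[OF \<Omega> \<mu> D]
  have Ks: "K \<in> sets \<mu>" using K by (auto simp: radon_sets_iff[OF \<Omega> \<mu>] compact_imp_closed)
  have "emeasure ?\<nu> (space ?\<nu>) \<le> emeasure \<mu> K"
    using interior_subset Ks by (auto simp: em intro!: emeasure_mono)
  also have "\<dots> < \<infinity>" using \<mu> K by (auto simp: radon_measure_on_def)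
  finally have fin: "emeasure ?\<nu> (space ?\<nu>) \<noteq> \<infinity>" by simp
  have "emeasure ?\<nu> E = 0" using E em by (simp add: Int_absorb2)
  then have "(INF U\<in>{U. E \<subseteq> U \<and> open U}. emeasure ?\<nu> U) < e"
    using outer_regular[of ?\<nu>, OF _ fin E(1)] e by simp
  then obtain U where U: "E \<subseteq> U" "open U" "emeasure ?\<nu> U < e"
    by (auto simp: INF_less_iff)
  then show ?thesis
    using that[of "U \<inter> ?D"] E(2) em[of U] by auto
qed

text \<open>Exhaust \<open>\<Omega>\<close> by compact sets: one of them meets \<open>B\<close> in
  positive measure, and the trace on it is finite.\<close>

lemma radon_inner_regular_pos:
  fixes \<Omega> :: "'a::euclidean_space set"
  assumes \<Omega>: "open \<Omega>" and \<mu>: "radon_measure_on \<Omega> \<mu>"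
    and B: "B \<in> sets borel" "B \<subseteq> \<Omega>" "emeasure \<mu> B \<noteq> 0"
  obtains K where "compact K" "K \<subseteq> B" "emeasure \<mu> K \<noteq> 0"
proof -
  obtain C :: "nat \<Rightarrow> 'a set" where C: "\<And>n. compact (C n)" "\<And>n. C n \<subseteq> \<Omega>" "\<Union>(range C) = \<Omega>"
    using open_Union_compact_subsets[OF \<Omega>] by metis
  have Cb: "C n \<in> sets borel" for n using C(1) by (simp add: borel_compact)
  have "emeasure \<mu> (\<Union>n. B \<inter> C n) \<le> (\<Sum>n. emeasure \<mu> (B \<inter> C n))"
    using B Cb by (intro emeasure_subadditive_countably) (auto simp: radon_sets_iff[OF \<Omega> \<mu>])
  moreover have "(\<Union>n. B \<inter> C n) = B" using C(3) B(2) by blast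
  ultimately obtain n where n: "emeasure \<mu> (B \<inter> C n) \<noteq> 0"
    using B(3) by fastforce
  let ?\<nu> = "distr (restrict_space \<mu> (C n)) borel id"
  note em = emeasure_radon_trace[OF \<Omega> \<mu> Cb[of n] C(2)[of n]]
  have "emeasure ?\<nu> (space ?\<nu>) = emeasure \<mu> (C n)" by (simp add: em)
  also have "\<dots> < \<infinity>" using \<mu> C by (auto simp: radon_measure_on_def)
  finally have fin: "emeasure ?\<nu> (space ?\<nu>) \<noteq> \<infinity>" by simp
  have "0 < (SUP K\<in>{K. K \<subseteq> B \<and> compact K}. emeasure ?\<nu> K)"
    using inner_regular[of ?\<nu>, OF _ fin B(1)] n em[OF B(1)] by (simp add: zero_less_iff_neq_zero)
  then obtain K where K: "K \<subseteq> B" "compact K" "0 < emeasure ?\<nu> K"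
    by (auto simp: less_SUP_iff)
  then have "emeasure \<mu> (K \<inter> C n) \<noteq> 0" using em[of K] by (simp add: borel_compact)
  then show ?thesis using that[of "K \<inter> C n"] K C(1) by (auto intro: compact_Int)
qed

text \<open>Made for Vitali coverings: \<open>B\<close> will consist of disjoint balls and
  \<open>A\<close> of their enlargements, for which subadditivity is enough. The index set is
  renumbered by naturals with empty sets as padding.\<close>

lemma emeasure_countable_UN_compare:
  fixes A B :: "'i \<Rightarrow> 'a set"
  assumes C: "countable C" and A: "\<And>i. i \<in> C \<Longrightarrow> A i \<in> sets M" and B: "\<And>i. i \<in> C \<Longrightarrow> B i \<in> sets N"
    and disj: "disjoint_family_on B C" and le: "\<And>i. i \<in> C \<Longrightarrow> emeasure M (A i) \<le> c * emeasure N (B i)"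
  shows "emeasure M (\<Union>i\<in>C. A i) \<le> c * emeasure N (\<Union>i\<in>C. B i)"
proof -
  define T where "T = to_nat_on C ` C"
  define h where "h = from_nat_into C"
  have hC: "h n \<in> C" "to_nat_on C (h n) = n" if "n \<in> T" for n
    using that C by (auto simp: T_def h_def)
  have hs: "\<exists>n\<in>T. h n = i" if "i \<in> C" for i
    using that C by (intro bexI[of _ "to_nat_on C i"]) (auto simp: T_def h_def)
  let ?A = "\<lambda>n. if n \<in> T then A (h n) else {}" and ?B = "\<lambda>n. if n \<in> T then B (h n) else {}"
  have "C = h ` T" using hC hs by blast
  then have UA: "(\<Union>i\<in>C. A i) = (\<Union>n. ?A n)" and UB: "(\<Union>i\<in>C. B i) = (\<Union>n. ?B n)"
    by auto
  have "disjoint_family ?B"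
    unfolding disjoint_family_on_def
  proof (intro ballI impI)
    fix m n :: nat assume mn: "m \<noteq> n"
    show "?B m \<inter> ?B n = {}"
    proof (cases "m \<in> T \<and> n \<in> T")
      case True
      then have "h m \<noteq> h n" using hC mn by metis
      then show ?thesis using disj True hC unfolding disjoint_family_on_def by simp
    qed auto
  qed
  then have "(\<Sum>n. emeasure N (?B n)) = emeasure N (\<Union>n. ?B n)"
    using B hC by (intro suminf_emeasure) auto
  moreover have "emeasure M (\<Union>n. ?A n) \<le> (\<Sum>n. emeasure M (?A n))"
    using A hC by (intro emeasure_subadditive_countably) auto
  moreover have "(\<Sum>n. emeasure M (?A n)) \<le> (\<Sum>n. c * emeasure N (?B n))"
    using le hC by (intro suminf_le) auto
  moreover have "(\<Sum>n. c * emeasure N (?B n)) = c * (\<Sum>n. emeasure N (?B n))"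
    by (rule ennreal_suminf_cmult)
  ultimately show ?thesis unfolding UA UB by simp
qed

text \<open>Intersect measurable covers of measure at most \<open>1 / (n + 1)\<close>; the set
  \<open>A\<close> may fail to be measurable, so only a null superset results.\<close>

lemma null_sets_if_small_covers:
  assumes "\<And>e::real. 0 < e \<Longrightarrow> \<exists>W\<in>sets M. A \<subseteq> W \<and> emeasure M W \<le> ennreal e"
  shows "\<exists>N\<in>null_sets M. A \<subseteq> N"
proof -
  obtain W where W: "\<And>n::nat. W n \<in> sets M \<and> A \<subseteq> W n \<and> emeasure M (W n) \<le> ennreal (1 / Suc n)"
    using assms[of "1 / Suc _"] by simp metis
  have "emeasure M (\<Inter>n. W n) \<le> ennreal e" if "0 < e" for e
  proof -
    obtain n where "1 / Suc n < e" using nat_approx_posE[OF \<open>0 < e\<close>] by blast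
    have "emeasure M (\<Inter>n. W n) \<le> emeasure M (W n)" using W by (intro emeasure_mono) auto
    also have "\<dots> \<le> ennreal (1 / Suc n)" using W by blast
    also have "\<dots> \<le> ennreal e" using \<open>1 / Suc n < e\<close> by (intro ennreal_leI) simp
    finally show ?thesis .
  qed
  then have "emeasure M (\<Inter>n. W n) = 0"
    by (metis add_0 ennreal_le_epsilon le_zero_eq)
  then show ?thesis using W by (intro bexI[of _ "\<Inter>n. W n"]) (auto simp: null_sets_def)
qed

text \<open>Points of \<open>A\<close> have small balls of \<open>l\<close>-mass at least
  \<open>s * r ^ d\<close> inside an open set of tiny \<open>l\<close>-mass. Vitali selects disjoint
  ones whose fivefold enlargements cover \<open>A\<close>, and the upper bound on
  \<open>\<mu>\<close> there transfers the smallness to \<open>\<mu>\<close>.\<close>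

lemma upper_density_null:
  fixes \<Omega> :: "'a::euclidean_space set" and c \<delta> s :: real
  assumes \<Omega>: "open \<Omega>" and \<mu>: "radon_measure_on \<Omega> \<mu>" and l: "radon_measure_on \<Omega> l"
    and K: "compact K" "K \<subseteq> \<Omega>" and E: "E \<in> sets borel" "E \<subseteq> interior K" "emeasure l E = 0"
    and pos: "0 < c" "0 < \<delta>" "0 < s" and AE: "A \<subseteq> E"
    and up: "\<And>x r. x \<in> A \<Longrightarrow> 0 < r \<Longrightarrow> r < \<delta> \<Longrightarrow> ball x r \<subseteq> \<Omega> \<and> emeasure \<mu> (ball x r) \<le> ennreal (c * r ^ d)"
    and low: "\<And>x t. x \<in> A \<Longrightarrow> 0 < t \<Longrightarrow> \<exists>r>0. r < t \<and> ennreal (s * r ^ d) \<le> emeasure l (ball x r)"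
  shows "\<exists>N\<in>null_sets \<mu>. A \<subseteq> N"
proof (rule null_sets_if_small_covers)
  fix e :: real assume e: "0 < e"
  \<comment> \<open>The ratio of \<open>c * (5 * r) ^ d\<close>, the bound for the enlarged ball, to
    \<open>s * r ^ d\<close>.\<close>
  define k where "k = c * 5 ^ d / s"
  have k: "0 < k" using pos by (simp add: k_def)
  obtain U where U: "open U" "E \<subseteq> U" "U \<subseteq> interior K" "emeasure l U < ennreal (e / k)"
    using radon_null_outer_regular[OF \<Omega> l K E, of "ennreal (e / k)"] e k by auto
  \<comment> \<open>Radii below \<open>\<delta> / 5\<close> keep the enlarged balls within the range
    of the growth bound.\<close>
  have "\<exists>r>0. r < \<delta> / 5 \<and> ball x r \<subseteq> U \<and> ennreal (s * r ^ d) \<le> emeasure l (ball x r)" if x: "x \<in> A" for x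
  proof -
    obtain t where t: "0 < t" "ball x t \<subseteq> U" using U AE x openE by (metis subsetD)
    obtain r where r: "0 < r" "r < min t (\<delta> / 5)" "ennreal (s * r ^ d) \<le> emeasure l (ball x r)"
      using low[OF x, of "min t (\<delta> / 5)"] t pos by auto
    moreover have "ball x r \<subseteq> U" using r(2) t(2) subset_ball[of r t x] by auto
    ultimately show ?thesis by auto
  qed
  then obtain r where r: "\<And>x. x \<in> A \<Longrightarrow> 0 < r x \<and> r x < \<delta> / 5 \<and> ball x (r x) \<subseteq> U \<and>
      ennreal (s * r x ^ d) \<le> emeasure l (ball x (r x))"
    by metis
  have cover: "A \<subseteq> (\<Union>x\<in>A. ball x (r x))" using r by fastforce
  have rB: "\<And>x. x \<in> A \<Longrightarrow> 0 < r x \<and> r x \<le> \<delta> / 5" using r by force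
  obtain C where C: "countable C" "C \<subseteq> A"
    "pairwise (\<lambda>i j. disjnt (ball i (r i)) (ball j (r j))) C" "A \<subseteq> (\<Union>i\<in>C. ball i (5 * r i))"
    using Vitali_covering_lemma_balls[OF cover rB] by blast
  have U\<Omega>: "U \<subseteq> \<Omega>" using U(3) K interior_subset by blast
  have ball5: "ball x (5 * r x) \<subseteq> \<Omega>" if "x \<in> C" for x
  proof -
    have "x \<in> A" using that C(2) by blast
    then show ?thesis using up[of x "5 * r x"] r[of x] by simp
  qed
  let ?W = "\<Union>i\<in>C. ball i (5 * r i)"
  have "emeasure \<mu> ?W \<le> ennreal k * emeasure l (\<Union>i\<in>C. ball i (r i))"
  proof (rule emeasure_countable_UN_compare[OF C(1)])
    show "disjoint_family_on (\<lambda>i. ball i (r i)) C"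
      using C(3) by (auto simp: disjoint_family_on_def pairwise_def disjnt_def)
    fix i assume i: "i \<in> C"
    then have iA: "i \<in> A" using C(2) by blast
    show "ball i (5 * r i) \<in> sets \<mu>" using ball5[OF i] by (simp add: radon_sets_iff[OF \<Omega> \<mu>])
    show "ball i (r i) \<in> sets l" using subset_trans[OF _ U\<Omega>] r[OF iA] by (simp add: radon_sets_iff[OF \<Omega> l])
    have "emeasure \<mu> (ball i (5 * r i)) \<le> ennreal (c * (5 * r i) ^ d)"
      using up[OF iA, of "5 * r i"] r[OF iA] by auto
    also have "c * (5 * r i) ^ d = k * (s * r i ^ d)"
      using pos by (simp add: k_def power_mult_distrib)
    also have "ennreal (k * (s * r i ^ d)) = ennreal k * ennreal (s * r i ^ d)"
      using k pos r[OF iA] by (intro ennreal_mult) auto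
    also have "\<dots> \<le> ennreal k * emeasure l (ball i (r i))"
      using r[OF iA] by (intro mult_left_mono) auto
    finally show "emeasure \<mu> (ball i (5 * r i)) \<le> ennreal k * emeasure l (ball i (r i))" .
  qed
  also have "\<dots> \<le> ennreal k * emeasure l U"
    using r C(2) U U\<Omega> by (intro mult_left_mono emeasure_mono) (auto simp: radon_sets_iff[OF \<Omega> l])
  also have "\<dots> \<le> ennreal k * ennreal (e / k)"
    using U(4) by (intro mult_left_mono) auto
  also have "\<dots> = ennreal e" using k e by (simp add: ennreal_mult'[symmetric])
  finally have "emeasure \<mu> ?W \<le> ennreal e" .
  moreover have "?W \<in> sets \<mu>"
    unfolding radon_sets_iff[OF \<Omega> \<mu>] using ball5 by (intro conjI borel_open open_UN) auto
  ultimately show "\<exists>W\<in>sets \<mu>. A \<subseteq> W \<and> emeasure \<mu> W \<le> ennreal e" using C(4) by blast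
qed

text \<open>Under this growth condition the elementary Vitali covering lemma replaces Besicovitch's theorem in
  the differentiation of measures.\<close>

definition growth_at :: "nat \<Rightarrow> 'a::metric_space measure \<Rightarrow> 'a \<Rightarrow> bool" where
  "growth_at d \<mu> x \<longleftrightarrow> (\<exists>c. \<forall>\<^sub>F r in at_right 0. emeasure \<mu> (ball x r) \<le> ennreal (c * r ^ d))"

text \<open>Bad points fall into countably many sets: \<open>m\<close> localises to a compact set,
  \<open>k\<close> makes both constant and radius of the growth bound uniform, and \<open>j\<close>
  quantifies the failure of \<open>l\<close> to be \<open>o(r ^ d)\<close>.\<close>

lemma AE_null_density:
  fixes \<Omega> :: "'a::euclidean_space set"
  assumes \<Omega>: "open \<Omega>" and \<mu>: "radon_measure_on \<Omega> \<mu>" and l: "radon_measure_on \<Omega> l"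
    and E: "E \<in> sets borel" "E \<subseteq> \<Omega>" "emeasure l E = 0"
  shows "AE x in \<mu>. x \<in> E \<and> growth_at d \<mu> x \<longrightarrow>
    (\<forall>e>0. \<forall>\<^sub>F r in at_right 0. emeasure l (ball x r) \<le> ennreal (e * r ^ d))"
proof -
  obtain C :: "nat \<Rightarrow> 'a set" where C: "\<And>n. compact (C n)" "\<And>n. C n \<subseteq> \<Omega>" "\<And>n. C n \<subseteq> interior (C (Suc n))" "\<Union>(range C) = \<Omega>"
    using open_Union_compact_subsets[OF \<Omega>] by metis
  define A where "A m k j = {x \<in> E \<inter> interior (C m).
      (\<forall>r. 0 < r \<and> r < 1 / real (Suc k) \<longrightarrow> ball x r \<subseteq> \<Omega> \<and> emeasure \<mu> (ball x r) \<le> ennreal (real (Suc k) * r ^ d)) \<and>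
      (\<forall>t>0. \<exists>r>0. r < t \<and> ennreal (1 / real (Suc j) * r ^ d) \<le> emeasure l (ball x r))}" for m k j
  have nullA: "\<exists>N\<in>null_sets \<mu>. A m k j \<subseteq> N" for m k j
  proof (rule upper_density_null[OF \<Omega> \<mu> l C(1,2)])
    have "emeasure l (E \<inter> interior (C m)) \<le> emeasure l E"
      using E by (intro emeasure_mono) (auto simp: radon_sets_iff[OF \<Omega> l])
    then show "emeasure l (E \<inter> interior (C m)) = 0" using E by simp
    show "A m k j \<subseteq> E \<inter> interior (C m)" by (auto simp: A_def)
    show "ball x r \<subseteq> \<Omega> \<and> emeasure \<mu> (ball x r) \<le> ennreal (real (Suc k) * r ^ d)"
      if "x \<in> A m k j" "0 < r" "r < 1 / real (Suc k)" for x r using that by (auto simp: A_def)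
    show "\<exists>r>0. r < t \<and> ennreal (1 / real (Suc j) * r ^ d) \<le> emeasure l (ball x r)"
      if "x \<in> A m k j" "0 < t" for x t using that by (auto simp: A_def)
  qed (use E in auto)
  have "AE x in \<mu>. x \<notin> A m k j" for m k j
  proof -
    from nullA obtain N where "N \<in> null_sets \<mu>" "A m k j \<subseteq> N" by blast
    then show ?thesis by (intro AE_I') auto
  qed
  then have "AE x in \<mu>. \<forall>m k j. x \<notin> A m k j" by (simp add: AE_all_countable)
  moreover have "AE x in \<mu>. x \<in> space \<mu>" by (rule AE_space)
  ultimately show ?thesis
  proof (eventually_elim, intro allI impI)
    fix x and e :: real
    assume x0: "\<forall>m k j. x \<notin> A m k j" "x \<in> space \<mu>" "x \<in> E \<and> growth_at d \<mu> x" and e: "0 < e"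
    then have x: "x \<in> space \<mu>" "\<forall>m k j. x \<notin> A m k j" "x \<in> E" "growth_at d \<mu> x" by auto
    have x\<Omega>: "x \<in> \<Omega>" using x space_radon[OF \<mu>] by simp
    then obtain m where m: "x \<in> interior (C m)" using C(3,4) by blast
    obtain t where t: "0 < t" "ball x t \<subseteq> \<Omega>" using \<Omega> x\<Omega> openE by blast
    obtain c b where c: "0 < b" "\<And>r. 0 < r \<Longrightarrow> r < b \<Longrightarrow> emeasure \<mu> (ball x r) \<le> ennreal (c * r ^ d)"
      using x(4) unfolding growth_at_def eventually_at_right_field by blast
    obtain k1 :: nat where k1: "c < real k1" using reals_Archimedean2 by blast
    obtain k2 :: nat where k2: "1 / min t b < real k2" using reals_Archimedean2 by blast
    \<comment> \<open>One index serves twice: as a bound above \<open>c\<close> and as the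
      reciprocal of a radius below \<open>t\<close> and \<open>b\<close>.\<close>
    define k where "k = max k1 k2"
    have k: "c \<le> real (Suc k)" "1 / real (Suc k) \<le> min t b"
    proof -
      show "c \<le> real (Suc k)" using k1 unfolding k_def by linarith
      have "1 / min t b \<le> real (Suc k)" using k2 unfolding k_def by linarith
      then have "1 \<le> real (Suc k) * min t b" using t(1) c(1) by (simp only: pos_divide_le_eq min_less_iff_conj)
      then show "1 / real (Suc k) \<le> min t b" by (subst pos_divide_le_eq) (simp_all only: of_nat_0_less_iff zero_less_Suc mult.commute)
    qed
    obtain j where j: "1 / real (Suc j) < e" by (rule nat_approx_posE[OF e])
    have growth: "ball x r \<subseteq> \<Omega> \<and> emeasure \<mu> (ball x r) \<le> ennreal (real (Suc k) * r ^ d)"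
      if "0 < r" "r < 1 / real (Suc k)" for r
    proof
      show "ball x r \<subseteq> \<Omega>" using that k(2) t(2) subset_ball[of r t x] by auto
      have "c * r ^ d \<le> real (Suc k) * r ^ d" using k(1) that by (intro mult_right_mono) auto
      moreover have "emeasure \<mu> (ball x r) \<le> ennreal (c * r ^ d)" by (rule c(2)) (use that k(2) in auto)
      ultimately show "emeasure \<mu> (ball x r) \<le> ennreal (real (Suc k) * r ^ d)"
        by (meson ennreal_leI order_trans)
    qed
    define G where "G r \<longleftrightarrow> ennreal (1 / real (Suc j) * r ^ d) \<le> emeasure l (ball x r)" for r
    have "\<not> (\<forall>t>0. \<exists>r>0. r < t \<and> G r)"
    proof
      assume "\<forall>t>0. \<exists>r>0. r < t \<and> G r"
      then have "x \<in> A m k j"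
        unfolding A_def G_def mem_Collect_eq using x(3) m growth by (intro conjI allI impI IntI) simp_all
      then show False using x(2) by simp
    qed
    then obtain s where s: "0 < s" "\<forall>r>0. r < s \<longrightarrow> \<not> G r" by blast
    have bound: "emeasure l (ball x r) \<le> ennreal (e * r ^ d)" if "0 < r" "r < s" for r
    proof (rule order_trans)
      show "emeasure l (ball x r) \<le> ennreal (1 / real (Suc j) * r ^ d)"
        using s(2) that unfolding G_def by (simp add: not_le less_imp_le)
      show "ennreal (1 / real (Suc j) * r ^ d) \<le> ennreal (e * r ^ d)"
        using j that by (intro ennreal_leI mult_right_mono) auto
    qed
    show "\<forall>\<^sub>F r in at_right 0. emeasure l (ball x r) \<le> ennreal (e * r ^ d)"
      unfolding eventually_at_right_field by (rule exI[of _ s]) (simp add: s(1) bound)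
  qed
qed

lemma radon_measure_on_density:
  fixes \<Omega> :: "'a::euclidean_space set"
  assumes \<Omega>: "open \<Omega>" and \<mu>: "radon_measure_on \<Omega> \<mu>" and f: "f \<in> borel_measurable \<mu>"
    and fin: "\<And>K. compact K \<Longrightarrow> K \<subseteq> \<Omega> \<Longrightarrow> (\<integral>\<^sup>+x\<in>K. f x \<partial>\<mu>) < \<infinity>"
  shows "radon_measure_on \<Omega> (density \<mu> f)"
  unfolding radon_measure_on_def
proof (intro conjI allI impI)
  show "sets (density \<mu> f) = sets (restrict_space borel \<Omega>)" using \<mu> by (simp add: radon_measure_on_def)
  fix K assume K: "compact K \<and> K \<subseteq> \<Omega>"
  then have "K \<in> sets \<mu>" by (auto simp: radon_sets_iff[OF \<Omega> \<mu>] compact_imp_closed)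
  then show "emeasure (density \<mu> f) K < \<infinity>" using fin K f by (simp add: emeasure_density)
qed

text \<open>For \<open>q\<close> in a countable dense set, \<open>l q k\<close> is the measure with
  density \<open>norm (H - q)\<close>, erased on the set \<open>E q k\<close> where \<open>H\<close>
  is close to \<open>q\<close>. It vanishes there, so at almost every point of \<open>E q k\<close>
  with the growth bound the far part of the oscillation is \<open>o(r ^ d)\<close>. The near part is
  at most \<open>2 / (k + 1)\<close> times the mass of the ball.\<close>

lemma AE_Lebesgue_point:
  fixes \<Omega> :: "'a::euclidean_space set" and H :: "'a \<Rightarrow> 'b::euclidean_space"
  assumes \<Omega>: "open \<Omega>" and \<mu>: "radon_measure_on \<Omega> \<mu>"
    and H: "H \<in> borel_measurable \<mu>" and int: "\<And>K. compact K \<Longrightarrow> K \<subseteq> \<Omega> \<Longrightarrow> set_integrable \<mu> K H"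
  shows "AE x in \<mu>. growth_at d \<mu> x \<longrightarrow>
    (\<forall>e>0. \<forall>\<^sub>F r in at_right 0. (\<integral>\<^sup>+y\<in>ball x r. norm (H y - H x) \<partial>\<mu>) \<le> ennreal (e * r ^ d))"
proof -
  obtain Q :: "'b set" where Q: "countable Q" "\<And>X. open X \<Longrightarrow> X \<noteq> {} \<Longrightarrow> \<exists>q\<in>Q. q \<in> X"
    using countable_dense_setE by metis
  note [measurable] = H
  note sp = space_radon[OF \<mu>]
  define E where "E q k = {x \<in> \<Omega>. norm (H x - q) < 1 / real (Suc k)}" for q and k :: nat
  define l where "l q k = density \<mu> (\<lambda>y. (if y \<in> E q k then 0 else ennreal (norm (H y - q))))" for q k
  have Eb: "E q k \<in> sets \<mu>" for q k
  proof -
    have "{x \<in> space \<mu>. norm (H x - q) < 1 / real (Suc k)} \<in> sets \<mu>" by measurable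
    then show ?thesis by (simp add: E_def sp)
  qed
  note [measurable] = Eb
  have f [measurable]: "(\<lambda>y. (if y \<in> E q k then 0 else ennreal (norm (H y - q)))) \<in> borel_measurable \<mu>" for q k
    by measurable
  have l: "radon_measure_on \<Omega> (l q k)" for q k
    unfolding l_def
  proof (rule radon_measure_on_density[OF \<Omega> \<mu> f])
    fix K assume K: "compact K" "K \<subseteq> \<Omega>"
    then have Ks [measurable]: "K \<in> sets \<mu>" by (auto simp: radon_sets_iff[OF \<Omega> \<mu>] compact_imp_closed)
    have "(\<integral>\<^sup>+x\<in>K. (if x \<in> E q k then 0 else ennreal (norm (H x - q))) \<partial>\<mu>)
        \<le> (\<integral>\<^sup>+x. ennreal (norm (indicator K x *\<^sub>R H x)) + ennreal (norm q) * indicator K x \<partial>\<mu>)"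
    proof (rule nn_integral_mono)
      fix x
      show "(if x \<in> E q k then 0 else ennreal (norm (H x - q))) * indicator K x
          \<le> ennreal (norm (indicator K x *\<^sub>R H x)) + ennreal (norm q) * indicator K x"
        using norm_triangle_ineq4[of "H x" q]
        by (auto split: split_indicator simp flip: ennreal_plus intro!: ennreal_leI)
    qed
    also have "\<dots> = (\<integral>\<^sup>+x. ennreal (norm (indicator K x *\<^sub>R H x)) \<partial>\<mu>) + ennreal (norm q) * emeasure \<mu> K"
      by (subst nn_integral_add) (auto simp: nn_integral_cmult_indicator)
    also have "\<dots> < \<infinity>"
    proof -
      have "(\<integral>\<^sup>+x. ennreal (norm (indicator K x *\<^sub>R H x)) \<partial>\<mu>) < \<infinity>"
        using int[OF K] unfolding set_integrable_def integrable_iff_bounded by simp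
      moreover have "emeasure \<mu> K < \<infinity>" using \<mu> K by (auto simp: radon_measure_on_def)
      ultimately show ?thesis by (simp add: ennreal_mult_less_top)
    qed
    finally show "(\<integral>\<^sup>+x\<in>K. (if x \<in> E q k then 0 else ennreal (norm (H x - q))) \<partial>\<mu>) < \<infinity>" .
  qed
  have "AE x in \<mu>. x \<in> E q k \<and> growth_at d \<mu> x \<longrightarrow>
    (\<forall>e>0. \<forall>\<^sub>F r in at_right 0. emeasure (l q k) (ball x r) \<le> ennreal (e * r ^ d))" for q and k :: nat
  proof (rule AE_null_density[OF \<Omega> \<mu> l])
    show "E q k \<in> sets borel" "E q k \<subseteq> \<Omega>" using Eb[of q k] by (auto simp: radon_sets_iff[OF \<Omega> \<mu>])
    have "emeasure (l q k) (E q k) = (\<integral>\<^sup>+x\<in>E q k. (if x \<in> E q k then 0 else ennreal (norm (H x - q))) \<partial>\<mu>)"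
      unfolding l_def using f Eb by (rule emeasure_density)
    also have "\<dots> = (\<integral>\<^sup>+x. 0 \<partial>\<mu>)"
      by (rule nn_integral_cong) (simp split: split_indicator)
    finally show "emeasure (l q k) (E q k) = 0" by simp
  qed
  then have "AE x in \<mu>. \<forall>q\<in>Q. \<forall>k. x \<in> E q k \<and> growth_at d \<mu> x \<longrightarrow>
    (\<forall>e>0. \<forall>\<^sub>F r in at_right 0. emeasure (l q k) (ball x r) \<le> ennreal (e * r ^ d))"
    unfolding AE_ball_countable[OF Q(1)] AE_all_countable by blast
  moreover have "AE x in \<mu>. x \<in> space \<mu>" by (rule AE_space)
  ultimately show ?thesis
  proof (eventually_elim, intro allI impI)
    fix x and e :: real
    assume x: "\<forall>q\<in>Q. \<forall>k. x \<in> E q k \<and> growth_at d \<mu> x \<longrightarrow>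
      (\<forall>e>0. \<forall>\<^sub>F r in at_right 0. emeasure (l q k) (ball x r) \<le> ennreal (e * r ^ d))"
      and xs: "x \<in> space \<mu>" and gr: "growth_at d \<mu> x" and e: "0 < e"
    obtain c where c: "\<forall>\<^sub>F r in at_right 0. emeasure \<mu> (ball x r) \<le> ennreal (c * r ^ d)"
      using gr unfolding growth_at_def by blast
    define c' where "c' = max c 1"
    have c': "1 \<le> c'" "c \<le> c'" by (auto simp: c'_def)
    \<comment> \<open>The near part contributes at most \<open>2 * s * c' * r ^ d\<close>, which
      stays below \<open>e / 2 * r ^ d\<close> for \<open>s < e / (4 * c')\<close>;
      \<open>c' \<ge> 1\<close> makes the division legitimate.\<close>
    obtain k :: nat where k: "1 / real (Suc k) < e / (4 * c')" using nat_approx_posE[of "e / (4 * c')"] e c' by auto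
    define s where "s = 1 / real (Suc k)"
    have s: "0 < s" "s < e / (4 * c')" using k by (simp_all add: s_def)
    then have "ball (H x) s \<noteq> {}" by simp
    then obtain q where q: "q \<in> Q" "q \<in> ball (H x) s" using Q(2)[OF open_ball] by blast
    then have qx: "norm (H x - q) < s" by (simp add: dist_norm)
    then have "x \<in> E q k" using xs by (simp add: E_def sp s_def del: of_nat_Suc)
    then have ev1: "\<forall>\<^sub>F r in at_right 0. emeasure (l q k) (ball x r) \<le> ennreal (e / 2 * r ^ d)"
    proof -
      have "0 < e / 2" using e by simp
      moreover have "\<forall>e>0. \<forall>\<^sub>F r in at_right 0. emeasure (l q k) (ball x r) \<le> ennreal (e * r ^ d)"
        using bspec[OF x q(1)] gr \<open>x \<in> E q k\<close> by simp
      ultimately show ?thesis by blast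
    qed
    obtain t where t: "0 < t" "ball x t \<subseteq> \<Omega>" using \<Omega> xs sp openE by blast
    have ev2: "\<forall>\<^sub>F r in at_right 0. 0 < r \<and> r < t"
      unfolding eventually_at_right_field using t by (intro exI[of _ t]) simp
    show "\<forall>\<^sub>F r in at_right 0. (\<integral>\<^sup>+y\<in>ball x r. norm (H y - H x) \<partial>\<mu>) \<le> ennreal (e * r ^ d)"
      using ev1 ev2 c
    proof eventually_elim
      case (elim r)
      have bs [measurable]: "ball x r \<in> sets \<mu>"
        using elim t subset_ball[of r t x] by (auto simp: radon_sets_iff[OF \<Omega> \<mu>])
      have "(\<integral>\<^sup>+y\<in>ball x r. norm (H y - H x) \<partial>\<mu>)
          \<le> (\<integral>\<^sup>+y. (if y \<in> E q k then 0 else ennreal (norm (H y - q))) * indicator (ball x r) y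
               + ennreal (2 * s) * indicator (ball x r) y \<partial>\<mu>)"
      proof (rule nn_integral_mono)
        fix y assume y: "y \<in> space \<mu>"
        have tri: "norm (H y - H x) \<le> norm (H y - q) + s"
          using norm_triangle_ineq4[of "H y - q" "H x - q"] qx by simp
        have "ennreal (norm (H y - H x)) \<le> (if y \<in> E q k then 0 else ennreal (norm (H y - q))) + ennreal (2 * s)"
        proof (cases "y \<in> E q k")
          case True
          then have "norm (H y - H x) \<le> 2 * s" using tri by (simp add: E_def s_def del: of_nat_Suc)
          then show ?thesis using True by (simp add: ennreal_leI)
        next
          case False
          have "norm (H y - H x) \<le> norm (H y - q) + 2 * s" using tri s(1) by linarith
          then have "ennreal (norm (H y - H x)) \<le> ennreal (norm (H y - q) + 2 * s)" by (rule ennreal_leI)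
          then show ?thesis using False s(1) by (simp add: ennreal_plus)
        qed
        then show "ennreal (norm (H y - H x)) * indicator (ball x r) y
          \<le> (if y \<in> E q k then 0 else ennreal (norm (H y - q))) * indicator (ball x r) y
               + ennreal (2 * s) * indicator (ball x r) y"
          by (auto split: split_indicator)
      qed
      also have "\<dots> = emeasure (l q k) (ball x r) + ennreal (2 * s) * emeasure \<mu> (ball x r)"
        unfolding l_def by (subst nn_integral_add) (auto simp: emeasure_density nn_integral_cmult_indicator)
      also have "\<dots> \<le> ennreal (e / 2 * r ^ d) + ennreal (2 * s) * ennreal (c' * r ^ d)"
      proof (intro add_mono mult_left_mono)
        have "c * r ^ d \<le> c' * r ^ d" using c' elim by (intro mult_right_mono) auto
        then show "emeasure \<mu> (ball x r) \<le> ennreal (c' * r ^ d)"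
          using elim by (meson ennreal_leI order_trans)
      qed (use elim in auto)
      also have "\<dots> = ennreal (e / 2 * r ^ d + 2 * s * (c' * r ^ d))"
        using e elim c' s(1)
        by (subst ennreal_plus) (auto simp del: ennreal_plus simp: ennreal_mult'[symmetric])
      also have "\<dots> \<le> ennreal (e * r ^ d)"
      proof (rule ennreal_leI)
        have "2 * s * c' \<le> e / 2" using s(2) c' by (simp add: field_simps)
        then have "2 * s * c' * r ^ d \<le> e / 2 * r ^ d" using elim by (intro mult_right_mono) auto
        then show "e / 2 * r ^ d + 2 * s * (c' * r ^ d) \<le> e * r ^ d" by (simp add: mult.assoc)
      qed
      finally show ?case .
    qed
  qed
qed

section \<open>Radial kernels as test functions\<close>

lemma
  assumes "varifold d \<Omega> V"
  shows sets_varifold: "sets V = sets (restrict_space borel (\<Omega> \<times> grassmannian d))"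
    and space_varifold: "space V = \<Omega> \<times> grassmannian d"
proof -
  show s: "sets V = sets (restrict_space borel (\<Omega> \<times> grassmannian d))"
    using assms by (simp add: varifold_def radon_measure_on_def)
  show "space V = \<Omega> \<times> grassmannian d"
    using sets_eq_imp_space_eq[OF s] by (simp add: space_restrict_space)
qed

lemma borel_measurable_varifold:
  assumes V: "varifold d \<Omega> V" and f: "continuous_on (\<Omega> \<times> grassmannian d) f"
  shows "f \<in> borel_measurable V"
  using borel_measurable_continuous_on_restrict[OF f]
  by (simp add: measurable_cong_sets[OF sets_varifold[OF V] refl])

lemma measurable_fst_varifold:
  fixes \<Omega> :: "'a::euclidean_space set"
  assumes V: "varifold d \<Omega> V"
  shows "fst \<in> measurable V (restrict_space borel \<Omega>)"
proof (rule measurable_restrict_space2)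
  show "fst \<in> space V \<rightarrow> \<Omega>" by (auto simp: space_varifold[OF V])
  show "fst \<in> borel_measurable V"
    by (intro borel_measurable_varifold[OF V] continuous_intros)
qed

lemma emeasure_varifold_compact:
  fixes \<Omega> :: "'a::euclidean_space set"
  assumes V: "varifold d \<Omega> V" and K: "compact K" "K \<subseteq> \<Omega>"
  shows "K \<times> grassmannian d \<in> sets V" "emeasure V (K \<times> grassmannian d) < \<infinity>"
proof -
  have c: "compact (K \<times> (grassmannian d :: ('a \<Rightarrow>\<^sub>L 'a) set))"
    by (intro compact_Times K compact_grassmannian)
  then show "emeasure V (K \<times> grassmannian d) < \<infinity>"
    using V K by (auto simp: varifold_def radon_measure_on_def)
  have "K \<times> grassmannian d = (\<Omega> \<times> grassmannian d) \<inter> (K \<times> (grassmannian d :: ('a \<Rightarrow>\<^sub>L 'a) set))"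
    using K by auto
  then show "K \<times> grassmannian d \<in> sets V"
    unfolding sets_varifold[OF V] sets_restrict_space
    using compact_imp_closed[OF c] by (metis borel_closed imageI)
qed

lemma sets_mass: "sets (mass \<Omega> V) = sets (restrict_space borel \<Omega>)"
  by (simp add: mass_def)

lemma radon_mass:
  fixes \<Omega> :: "'a::euclidean_space set"
  assumes \<Omega>: "open \<Omega>" and V: "varifold d \<Omega> V"
  shows "radon_measure_on \<Omega> (mass \<Omega> V)"
  unfolding radon_measure_on_def
proof (intro conjI allI impI)
  fix K assume K: "compact K \<and> K \<subseteq> \<Omega>"
  then have "K \<in> sets (restrict_space borel \<Omega>)"
    using \<Omega> by (auto simp: sets_restrict_space_iff borel_compact)
  then show "emeasure (mass \<Omega> V) K < \<infinity>"
    using emeasure_mass[OF V] emeasure_varifold_compact(2)[OF V, of K] K by simp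
qed (rule sets_mass)

lemma integral_mass:
  fixes f :: "'a::euclidean_space \<Rightarrow> 'b::{banach, second_countable_topology}"
  assumes V: "varifold d \<Omega> V" and f: "f \<in> borel_measurable (restrict_space borel \<Omega>)"
  shows "(\<integral>y. f y \<partial>mass \<Omega> V) = (\<integral>p. f (fst p) \<partial>V)"
  unfolding mass_def by (rule integral_distr[OF measurable_fst_varifold[OF V] f])

text \<open>Compactness of the Grassmannian bounds both \<open>f\<close> over \<open>K\<close> and
  the measure of \<open>K \<times> grassmannian d\<close>.\<close>

lemma integrable_varifold:
  fixes f :: "'a::euclidean_space \<times> ('a \<Rightarrow>\<^sub>L 'a) \<Rightarrow> 'b::{banach, second_countable_topology}"
  assumes V: "varifold d \<Omega> V" and f: "continuous_on (\<Omega> \<times> grassmannian d) f"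
    and K: "compact K" "K \<subseteq> \<Omega>" and z: "\<And>y S. y \<in> \<Omega> \<Longrightarrow> y \<notin> K \<Longrightarrow> f (y, S) = 0"
  shows "integrable V f"
proof -
  have c: "compact (K \<times> (grassmannian d :: ('a \<Rightarrow>\<^sub>L 'a) set))"
    by (intro compact_Times K compact_grassmannian)
  have "compact (f ` (K \<times> grassmannian d))"
    by (rule compact_continuous_image[OF continuous_on_subset[OF f] c]) (use K in auto)
  then have "bounded (f ` (K \<times> grassmannian d))" by (rule compact_imp_bounded)
  then obtain B where "\<forall>y\<in>f ` (K \<times> grassmannian d). norm y \<le> B" unfolding bounded_iff ..
  then have B: "norm (f p) \<le> B" if "p \<in> K \<times> grassmannian d" for p using that by (cases p) auto
  show ?thesis
  proof (rule integrableI_bounded_set)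
    show "AE p in V. p \<notin> K \<times> grassmannian d \<longrightarrow> f p = 0"
    proof (rule AE_I2, rule impI)
      show "f p = 0" if "p \<in> space V" "p \<notin> K \<times> grassmannian d" for p
        using that z[of "fst p" "snd p"] by (cases p) (auto simp: space_varifold[OF V])
    qed
    show "AE p in V. p \<in> K \<times> grassmannian d \<longrightarrow> norm (f p) \<le> B"
      by (rule AE_I2) (use B in blast)
  qed (rule emeasure_varifold_compact[OF V K] borel_measurable_varifold[OF V f])+
qed

lemma integrable_radon:
  fixes f :: "'a::euclidean_space \<Rightarrow> 'b::{banach, second_countable_topology}"
  assumes \<Omega>: "open \<Omega>" and \<mu>: "radon_measure_on \<Omega> \<mu>" and f: "continuous_on \<Omega> f"
    and K: "compact K" "K \<subseteq> \<Omega>" and z: "\<And>y. y \<in> \<Omega> \<Longrightarrow> y \<notin> K \<Longrightarrow> f y = 0"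
  shows "integrable \<mu> f"
proof -
  have "compact (f ` K)"
    by (rule compact_continuous_image[OF continuous_on_subset[OF f] K(1)]) (use K in auto)
  then have "bounded (f ` (K))" by (rule compact_imp_bounded)
  then obtain B where "\<forall>y\<in>f ` (K). norm y \<le> B" unfolding bounded_iff ..
  then have B: "norm (f p) \<le> B" if "p \<in> K" for p using that by simp
  have s: "sets \<mu> = sets (restrict_space borel \<Omega>)" using \<mu> by (simp add: radon_measure_on_def)
  show ?thesis
  proof (rule integrableI_bounded_set)
    show "K \<in> sets \<mu>" using K by (simp add: radon_sets_iff[OF \<Omega> \<mu>] borel_compact)
    show "f \<in> borel_measurable \<mu>"
      using borel_measurable_continuous_on_restrict[OF f] by (simp add: measurable_cong_sets[OF s refl])
    show "emeasure \<mu> K < \<infinity>" using \<mu> K by (auto simp: radon_measure_on_def)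
    show "AE p in \<mu>. p \<notin> K \<longrightarrow> f p = 0"
      by (rule AE_I2) (auto simp: space_radon[OF \<mu>] z)
    show "AE p in \<mu>. p \<in> K \<longrightarrow> norm (f p) \<le> B"
      by (rule AE_I2) (use B in blast)
  qed
qed

section \<open>Scaled radial kernels and their gradients\<close>

lemma scaled_kernel_eq:
  fixes x :: "'a::euclidean_space"
  shows "0 < \<epsilon> \<Longrightarrow> scaled_kernel f \<epsilon> x = f (norm x / \<epsilon>) / \<epsilon> ^ DIM('a)"
  by (simp add: scaled_kernel_def divide_inverse mult.commute)

lemma scaled_kernel_zero:
  assumes "\<And>t. 1 < \<bar>t\<bar> \<Longrightarrow> f t = 0" "0 < \<epsilon>" "\<epsilon> < norm x"
  shows "scaled_kernel f \<epsilon> x = 0"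
  using assms by (simp add: scaled_kernel_eq)

lemma continuous_scaled_kernel:
  assumes f: "continuous_on UNIV f" and "0 < \<epsilon>"
  shows "continuous_on UNIV (\<lambda>y. scaled_kernel f \<epsilon> (y - x :: 'a::euclidean_space))"
  unfolding scaled_kernel_def using assms(2)
  by (intro continuous_intros continuous_on_compose2[OF f]) auto

text \<open>The direction field is singular at the origin, but the weight \<open>norm y\<close>
  compensates. This tames the angular part of a radial gradient.\<close>

lemma norm_mult_sgn_diff_le:
  fixes x y :: "'a::real_normed_vector"
  shows "norm y * norm (sgn x - sgn y) \<le> 2 * norm (x - y)"
proof (cases "x = 0 \<or> y = 0")
  case False
  then have "norm y *\<^sub>R (sgn x - sgn y) = (norm y - norm x) *\<^sub>R sgn x + (x - y)"
    by (simp add: sgn_div_norm algebra_simps)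
  then have "norm y * norm (sgn x - sgn y) = norm ((norm y - norm x) *\<^sub>R sgn x + (x - y))"
    by (metis abs_norm_cancel norm_scaleR)
  also have "\<dots> \<le> \<bar>norm y - norm x\<bar> * norm (sgn x) + norm (x - y)"
    by (metis norm_scaleR norm_triangle_ineq)
  also have "\<dots> \<le> 2 * norm (x - y)"
    using norm_triangle_ineq3[of y x] False by (simp add: norm_sgn norm_minus_commute)
  finally show ?thesis .
qed (auto simp: norm_sgn)

text \<open>\<open>N\<close> plays the role of \<open>W2_infinity_norm\<close>. The condition
  \<open>deriv0\<close> is what evenness contributes: it makes the radial function differentiable at
  the origin.\<close>

locale c11_profile =
  fixes \<rho> \<rho>' :: "real \<Rightarrow> real" and N :: real
  assumes zero: "1 < \<bar>t\<bar> \<Longrightarrow> \<rho> t = 0"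
    and deriv: "(\<rho> has_real_derivative \<rho>' t) (at t)"
    and deriv0: "\<rho>' 0 = 0"
    and bound: "\<bar>\<rho> t\<bar> \<le> N"
    and bound': "\<bar>\<rho>' t\<bar> \<le> N"
    and lipschitz: "\<bar>\<rho>' s - \<rho>' t\<bar> \<le> N * \<bar>s - t\<bar>"
begin

text \<open>At the origin the convention \<open>sgn 0 = 0\<close> gives the true gradient because
  \<open>\<rho>' 0 = 0\<close>.\<close>

definition kgrad :: "real \<Rightarrow> 'a::euclidean_space \<Rightarrow> 'a" where
  "kgrad \<epsilon> x = (\<rho>' (norm x / \<epsilon>) / \<epsilon> ^ Suc DIM('a)) *\<^sub>R sgn x"

lemma N_nonneg: "0 \<le> N"
  using bound[of 0] by linarith

lemma continuous: "continuous_on UNIV \<rho>"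
  by (rule continuous_at_imp_continuous_on) (use deriv DERIV_isCont in blast)

lemma deriv_zero: "1 < \<bar>t\<bar> \<Longrightarrow> \<rho>' t = 0"
proof -
  assume t: "1 < \<bar>t\<bar>"
  have "open {s :: real. 1 < \<bar>s\<bar>}" by (intro open_Collect_less continuous_intros)
  then have "\<forall>\<^sub>F s in nhds t. s \<in> {s. 1 < \<bar>s\<bar>}" using t by (intro eventually_nhds_in_open) auto
  then have "\<forall>\<^sub>F s in nhds t. \<rho> s = 0" by eventually_elim (simp add: zero)
  then have "((\<lambda>_. 0) has_real_derivative \<rho>' t) (at t)"
    using deriv[of t] DERIV_cong_ev[OF refl, of \<rho> "\<lambda>_. 0" t] by blast
  then show ?thesis using DERIV_const DERIV_unique by blast
qed

lemma GDERIV_scaled_kernel: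
  fixes x :: "'a::euclidean_space"
  assumes \<epsilon>: "0 < \<epsilon>"
  shows "GDERIV (scaled_kernel \<rho> \<epsilon>) x :> kgrad \<epsilon> x"
proof -
  let ?n = "DIM('a)"
  define h where "h t = \<rho> (t / \<epsilon>) / \<epsilon> ^ ?n" for t
  have sk: "scaled_kernel \<rho> \<epsilon> = (\<lambda>x::'a. h (norm x))"
    using \<epsilon> by (simp add: scaled_kernel_eq h_def fun_eq_iff)
  have hd: "DERIV h t :> \<rho>' (t / \<epsilon>) / \<epsilon> ^ Suc ?n" for t
  proof -
    have "((\<lambda>t. \<rho> (t / \<epsilon>)) has_real_derivative \<rho>' (t / \<epsilon>) * (1 / \<epsilon>)) (at t)"
      by (rule DERIV_chain2[OF deriv]) (use \<epsilon> in \<open>auto intro!: derivative_eq_intros\<close>)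
    then have "DERIV h t :> \<rho>' (t / \<epsilon>) * (1 / \<epsilon>) / \<epsilon> ^ ?n"
      unfolding h_def by (rule DERIV_cdivide)
    then show ?thesis by (simp add: mult.commute)
  qed
  show ?thesis
  proof (cases "x = 0")
    case False
    show ?thesis unfolding sk kgrad_def
      by (rule GDERIV_DERIV_compose[OF GDERIV_norm[OF False] hd])
  next
    \<comment> \<open>The norm is not differentiable at the origin, so there the difference quotient
      of \<open>h\<close> is composed with the norm; it tends to the derivative of \<open>h\<close>
      at 0, which vanishes.\<close>
    case True
    have "DERIV h 0 :> 0" using hd[of 0] deriv0 by simp
    then have "((\<lambda>t. (h t - h 0) / t) \<longlongrightarrow> 0) (at 0)"
      by (simp add: has_field_derivative_iff)
    moreover have "filterlim norm (at (0::real)) (at (0::'a))"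
      by (auto simp: filterlim_at eventually_at_filter intro!: tendsto_eq_intros)
    ultimately have "((\<lambda>y::'a. (h (norm y) - h 0) / norm y) \<longlongrightarrow> 0) (at 0)"
      by (rule filterlim_compose)
    then have "((\<lambda>y::'a. norm ((h (norm y) - h 0) / norm y)) \<longlongrightarrow> 0) (at 0)"
      by (rule tendsto_norm_zero)
    then show ?thesis
      unfolding True sk kgrad_def gderiv_def has_derivative_at by simp
  qed
qed

lemma gradient_scaled_kernel: "0 < \<epsilon> \<Longrightarrow> gradient (scaled_kernel \<rho> \<epsilon>) x = kgrad \<epsilon> x"
  by (rule gradient_eqI[OF GDERIV_scaled_kernel])

lemma kgrad_zero:
  assumes "0 < \<epsilon>" "\<epsilon> < norm x"
  shows "kgrad \<epsilon> x = 0"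
proof -
  have "\<rho>' (norm x / \<epsilon>) = 0" using assms by (intro deriv_zero) simp
  then show ?thesis by (simp add: kgrad_def)
qed

lemma norm_kgrad_le:
  fixes x :: "'a::euclidean_space"
  assumes \<epsilon>: "0 < \<epsilon>"
  shows "norm (kgrad \<epsilon> x) \<le> N / \<epsilon> ^ Suc DIM('a)"
proof -
  have "norm (kgrad \<epsilon> x) = \<bar>\<rho>' (norm x / \<epsilon>)\<bar> / \<epsilon> ^ Suc DIM('a) * norm (sgn x)"
    using \<epsilon> by (simp add: kgrad_def)
  also have "\<dots> \<le> N / \<epsilon> ^ Suc DIM('a) * 1"
    using \<epsilon> bound' N_nonneg by (intro mult_mono divide_right_mono) (auto simp: norm_sgn)
  finally show ?thesis by simp
qed

text \<open>The radial variation costs \<open>N\<close>, the angular one \<open>2 * N\<close>: since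
  \<open>\<rho>' 0 = 0\<close>, the factor \<open>\<rho>' (norm y / \<epsilon>)\<close> is at most
  \<open>N * norm y / \<epsilon>\<close> in modulus and supplies the weight that the direction field
  requires near the origin.\<close>

lemma kgrad_lipschitz:
  fixes x y :: "'a::euclidean_space"
  assumes \<epsilon>: "0 < \<epsilon>"
  shows "norm (kgrad \<epsilon> x - kgrad \<epsilon> y) \<le> 3 * N / \<epsilon> ^ (DIM('a) + 2) * norm (x - y)"
proof -
  define a b where "a = \<rho>' (norm x / \<epsilon>)" and "b = \<rho>' (norm y / \<epsilon>)"
  have "a *\<^sub>R sgn x - b *\<^sub>R sgn y = (a - b) *\<^sub>R sgn x + b *\<^sub>R (sgn x - sgn y)"
    by (simp add: algebra_simps)
  then have "norm (a *\<^sub>R sgn x - b *\<^sub>R sgn y) \<le> \<bar>a - b\<bar> * norm (sgn x) + \<bar>b\<bar> * norm (sgn x - sgn y)"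
    by (metis norm_scaleR norm_triangle_ineq)
  also have "\<dots> \<le> N * (norm (x - y) / \<epsilon>) + N * (2 * norm (x - y) / \<epsilon>)"
  proof (rule add_mono)
    have "\<bar>a - b\<bar> \<le> N * \<bar>norm x / \<epsilon> - norm y / \<epsilon>\<bar>" unfolding a_def b_def by (rule lipschitz)
    also have "\<dots> = N * (\<bar>norm x - norm y\<bar> / \<epsilon>)"
      using \<epsilon> by (simp add: diff_divide_distrib[symmetric])
    also have "\<dots> \<le> N * (norm (x - y) / \<epsilon>)"
      using \<epsilon> N_nonneg by (intro mult_left_mono divide_right_mono norm_triangle_ineq3) auto
    finally have "\<bar>a - b\<bar> \<le> N * (norm (x - y) / \<epsilon>)" .
    then show "\<bar>a - b\<bar> * norm (sgn x) \<le> N * (norm (x - y) / \<epsilon>)"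
      using \<epsilon> N_nonneg by (auto simp: norm_sgn)
    have "\<bar>b\<bar> \<le> N * (norm y / \<epsilon>)"
      using lipschitz[of "norm y / \<epsilon>" 0] deriv0 \<epsilon> by (simp add: b_def)
    then have "\<bar>b\<bar> * norm (sgn x - sgn y) \<le> N * (norm y / \<epsilon>) * norm (sgn x - sgn y)"
      by (rule mult_right_mono) simp
    also have "\<dots> = N / \<epsilon> * (norm y * norm (sgn x - sgn y))" by simp
    also have "\<dots> \<le> N / \<epsilon> * (2 * norm (x - y))"
      using \<epsilon> N_nonneg by (intro mult_left_mono norm_mult_sgn_diff_le) auto
    finally show "\<bar>b\<bar> * norm (sgn x - sgn y) \<le> N * (2 * norm (x - y) / \<epsilon>)" by simp
  qed
  also have "\<dots> = 3 * N / \<epsilon> * norm (x - y)" by (simp add: field_simps)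
  finally have *: "norm (a *\<^sub>R sgn x - b *\<^sub>R sgn y) \<le> 3 * N / \<epsilon> * norm (x - y)" .
  have "kgrad \<epsilon> x - kgrad \<epsilon> y = (1 / \<epsilon> ^ Suc DIM('a)) *\<^sub>R (a *\<^sub>R sgn x - b *\<^sub>R sgn y)"
    by (simp add: kgrad_def a_def b_def scaleR_diff_right)
  then have "norm (kgrad \<epsilon> x - kgrad \<epsilon> y) = 1 / \<epsilon> ^ Suc DIM('a) * norm (a *\<^sub>R sgn x - b *\<^sub>R sgn y)"
    using \<epsilon> by simp
  also have "\<dots> \<le> 1 / \<epsilon> ^ Suc DIM('a) * (3 * N / \<epsilon> * norm (x - y))"
    using \<epsilon> * by (intro mult_left_mono) auto
  also have "\<dots> = 3 * N / \<epsilon> ^ (DIM('a) + 2) * norm (x - y)"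
    by (simp add: mult.commute mult.left_commute)
  finally show ?thesis .
qed

lemma continuous_kgrad:
  assumes "0 < \<epsilon>"
  shows "continuous_on UNIV (kgrad \<epsilon> :: 'a::euclidean_space \<Rightarrow> 'a)"
proof -
  have "(3 * N / \<epsilon> ^ (DIM('a) + 2))-lipschitz_on UNIV (kgrad \<epsilon> :: 'a \<Rightarrow> 'a)"
    using kgrad_lipschitz[OF assms] assms N_nonneg by (intro lipschitz_onI) (auto simp: dist_norm)
  then show ?thesis by (rule lipschitz_on_continuous_on)
qed

lemma has_derivative_kernel_field:
  fixes x e :: "'a::euclidean_space"
  assumes "0 < \<epsilon>"
  shows "((\<lambda>y. scaled_kernel \<rho> \<epsilon> (y - x) *\<^sub>R e) has_derivative (\<lambda>h. (h \<bullet> kgrad \<epsilon> (y - x)) *\<^sub>R e)) (at y)"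
proof -
  have "((\<lambda>y. scaled_kernel \<rho> \<epsilon> (y - x)) has_derivative (\<lambda>h. h \<bullet> kgrad \<epsilon> (y - x))) (at y)"
  proof -
    have h1: "((\<lambda>y. y - x) has_derivative (\<lambda>h. h)) (at y)" by (auto intro!: derivative_eq_intros)
    have h2: "(scaled_kernel \<rho> \<epsilon> has_derivative (\<lambda>h. h \<bullet> kgrad \<epsilon> (y - x))) (at (y - x))"
      using GDERIV_scaled_kernel[OF assms] unfolding gderiv_def .
    show ?thesis by (rule has_derivative_compose[OF h1 h2])
  qed
  then show ?thesis by (rule has_derivative_scaleR_left)
qed

lemma C1_compact_support_kernel_field:
  fixes x e :: "'a::euclidean_space"
  assumes \<epsilon>: "0 < \<epsilon>" and sub: "cball x \<epsilon> \<subseteq> \<Omega>"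
  shows "C1_compact_support \<Omega> (\<lambda>y. scaled_kernel \<rho> \<epsilon> (y - x) *\<^sub>R e)"
  unfolding C1_compact_support_def
proof (intro conjI)
  let ?X' = "\<lambda>y. blinfun_scaleR_left e o\<^sub>L blinfun_inner_left (kgrad \<epsilon> (y - x))"
  have "continuous_on UNIV (\<lambda>y. kgrad \<epsilon> (y - x))"
    by (rule continuous_on_compose2[OF continuous_kgrad[OF \<epsilon>]]) (auto intro!: continuous_intros)
  then have "continuous_on UNIV ?X'"
    by (intro bounded_bilinear.continuous_on[OF bounded_bilinear_blinfun_compose] continuous_on_const
        bounded_linear.continuous_on[OF bounded_linear_blinfun_inner_left])
  moreover have "blinfun_apply (?X' y) = (\<lambda>h. (h \<bullet> kgrad \<epsilon> (y - x)) *\<^sub>R e)" for y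
    by (simp add: fun_eq_iff)
  ultimately show "\<exists>X'. (\<forall>y. ((\<lambda>y. scaled_kernel \<rho> \<epsilon> (y - x) *\<^sub>R e) has_derivative blinfun_apply (X' y)) (at y)) \<and>
      continuous_on UNIV X'"
    using has_derivative_kernel_field[OF \<epsilon>, of x e] by (intro exI[of _ ?X'] conjI allI) simp_all
  have "{y. scaled_kernel \<rho> \<epsilon> (y - x) *\<^sub>R e \<noteq> 0} \<subseteq> cball x \<epsilon>"
    using scaled_kernel_zero[OF zero \<epsilon>] by (force simp: dist_norm norm_minus_commute)
  then have cl: "closure {y. scaled_kernel \<rho> \<epsilon> (y - x) *\<^sub>R e \<noteq> 0} \<subseteq> cball x \<epsilon>"
    by (rule closure_minimal) simp
  then show "compact (closure {y. scaled_kernel \<rho> \<epsilon> (y - x) *\<^sub>R e \<noteq> 0})"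
    by (meson bounded_cball bounded_subset closed_closure compact_eq_bounded_closed)
  show "closure {y. scaled_kernel \<rho> \<epsilon> (y - x) *\<^sub>R e \<noteq> 0} \<subseteq> \<Omega>" using cl sub by blast
qed

text \<open>With a constant direction \<open>e\<close> all coordinate gradients are multiples of one
  kernel gradient, and summing over the basis reassembles the inner product with
  \<open>e\<close>.\<close>

lemma tangential_div_kernel_field:
  fixes x e :: "'a::euclidean_space"
  assumes \<epsilon>: "0 < \<epsilon>"
  shows "tangential_div S (\<lambda>y. scaled_kernel \<rho> \<epsilon> (y - x) *\<^sub>R e) y = blinfun_apply S (kgrad \<epsilon> (y - x)) \<bullet> e"
proof -
  have "gradient (\<lambda>y. (scaled_kernel \<rho> \<epsilon> (y - x) *\<^sub>R e) \<bullet> b) y = (e \<bullet> b) *\<^sub>R kgrad \<epsilon> (y - x)" for b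
  proof (rule gradient_eqI, unfold gderiv_def)
    have "((\<lambda>y. (scaled_kernel \<rho> \<epsilon> (y - x) *\<^sub>R e) \<bullet> b) has_derivative (\<lambda>h. ((h \<bullet> kgrad \<epsilon> (y - x)) *\<^sub>R e) \<bullet> b)) (at y)"
      by (rule has_derivative_inner_left[OF has_derivative_kernel_field[OF \<epsilon>]])
    then show "((\<lambda>y. (scaled_kernel \<rho> \<epsilon> (y - x) *\<^sub>R e) \<bullet> b) has_derivative (\<lambda>h. h \<bullet> (e \<bullet> b) *\<^sub>R kgrad \<epsilon> (y - x))) (at y)"
      by (simp add: mult.commute)
  qed
  then have "tangential_div S (\<lambda>y. scaled_kernel \<rho> \<epsilon> (y - x) *\<^sub>R e) y
      = (\<Sum>b\<in>Basis. (e \<bullet> b) * (blinfun_apply S (kgrad \<epsilon> (y - x)) \<bullet> b))"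
    by (simp add: tangential_div_def blinfun.scaleR_right)
  also have "\<dots> = blinfun_apply S (kgrad \<epsilon> (y - x)) \<bullet> e"
    by (subst euclidean_inner[of _ e]) (simp add: mult.commute)
  finally show ?thesis .
qed

lemma continuous_kgrad_test:
  assumes "0 < \<epsilon>"
  shows "continuous_on A (\<lambda>p. blinfun_apply (snd p) (kgrad \<epsilon> (fst p - x :: 'a::euclidean_space)))"
  by (intro continuous_intros continuous_on_compose2[OF continuous_kgrad[OF assms]]) auto

lemma integrable_kgrad_test:
  assumes "varifold d \<Omega> V" "0 < \<epsilon>" "cball x \<epsilon> \<subseteq> \<Omega>"
  shows "integrable V (\<lambda>p. blinfun_apply (snd p) (kgrad \<epsilon> (fst p - x :: 'a::euclidean_space)))"
  by (rule integrable_varifold[OF assms(1) continuous_kgrad_test[OF assms(2)] compact_cball assms(3)])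
     (simp add: kgrad_zero[OF assms(2)] dist_norm norm_minus_commute)

lemma first_variation_kernel_field:
  fixes x e :: "'a::euclidean_space"
  assumes V: "varifold d \<Omega> V" and \<epsilon>: "0 < \<epsilon>" and sub: "cball x \<epsilon> \<subseteq> \<Omega>"
  shows "first_variation V (\<lambda>y. scaled_kernel \<rho> \<epsilon> (y - x) *\<^sub>R e) = first_variation_conv V \<rho> \<epsilon> x \<bullet> e"
  unfolding first_variation_def first_variation_conv_def gradient_scaled_kernel[OF \<epsilon>]
    tangential_div_kernel_field[OF \<epsilon>]
  by (rule integral_inner_left) (use integrable_kgrad_test[OF V \<epsilon> sub] in simp)

end

text \<open>Evenness makes the derivative vanish at the origin. The infimum of the Lipschitz
  constants is itself one, because each difference quotient lies below all of them, and the norm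
  dominates each of its three non-negative summands. It is positive since a zero profile could not
  have integral 1.\<close>

lemma c11_profile_W2:
  assumes k: "kernel_profile TYPE('a::euclidean_space) \<rho>" and c1: "\<rho> C1_differentiable_on UNIV"
    and w: "W2_infinity \<rho>"
  shows "c11_profile \<rho> (deriv \<rho>) (W2_infinity_norm \<rho>)"
    and "0 < W2_infinity_norm \<rho>"
proof -
  have even: "\<rho> (- t) = \<rho> t" and zero: "1 < \<bar>t\<bar> \<Longrightarrow> \<rho> t = 0" and nn: "0 \<le> \<rho> t" for t
    using k by (auto simp: kernel_profile_def)
  have d: "(\<rho> has_real_derivative deriv \<rho> t) (at t)" for t
  proof -
    have "\<rho> differentiable at t" using c1 by (simp add: C1_differentiable_on_eq)
    then show ?thesis using real_differentiable_def DERIV_imp_deriv by metis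
  qed
  obtain L where L: "L-lipschitz_on UNIV (deriv \<rho>)"
    and b: "bounded (range \<rho>)" and b': "bounded (range (deriv \<rho>))"
    using w by (auto simp: W2_infinity_def W1_infinity_def)
  let ?I = "{L. L-lipschitz_on UNIV (deriv \<rho>)}"
  have bdd: "bdd_above (range (\<lambda>t. \<bar>f t\<bar>))" if "bounded (range f)" for f :: "real \<Rightarrow> real"
    using that unfolding bounded_iff bdd_above_def by auto
  have sup: "\<bar>f t\<bar> \<le> (SUP t. \<bar>f t\<bar>)" if "bounded (range f)" for f :: "real \<Rightarrow> real" and t
    by (rule cSUP_upper[OF UNIV_I bdd[OF that]])
  have sup0: "0 \<le> (SUP t. \<bar>f t\<bar>)" if "bounded (range f)" for f :: "real \<Rightarrow> real"
    using sup[OF that, of 0] by linarith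
  have I0: "0 \<le> Inf ?I" using L by (intro cInf_greatest) (auto dest: lipschitz_on_nonneg)
  have lipI: "\<bar>deriv \<rho> s - deriv \<rho> t\<bar> \<le> Inf ?I * \<bar>s - t\<bar>" for s t
  proof (cases "s = t")
    case False
    have "\<bar>deriv \<rho> s - deriv \<rho> t\<bar> / \<bar>s - t\<bar> \<le> Inf ?I"
      using L False by (intro cInf_greatest) (auto simp: divide_le_eq dist_real_def dest: lipschitz_onD)
    then show ?thesis using False by (simp add: divide_le_eq)
  qed simp
  have N: "W2_infinity_norm \<rho> = (SUP t. \<bar>\<rho> t\<bar>) + (SUP t. \<bar>deriv \<rho> t\<bar>) + Inf ?I"
    by (simp add: W2_infinity_norm_def)
  show "c11_profile \<rho> (deriv \<rho>) (W2_infinity_norm \<rho>)"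
  proof
    show "deriv \<rho> 0 = 0"
    proof -
      have "((\<lambda>t. \<rho> (- t)) has_real_derivative deriv \<rho> (- 0) * (- 1)) (at 0)"
        by (rule DERIV_chain2[OF d]) (auto intro!: derivative_eq_intros)
      then have "(\<rho> has_real_derivative - deriv \<rho> 0) (at 0)" by (simp add: even)
      then have "deriv \<rho> 0 = - deriv \<rho> 0" by (rule DERIV_unique[OF d])
      then show ?thesis by simp
    qed
    show "\<bar>\<rho> t\<bar> \<le> W2_infinity_norm \<rho>" for t
      using sup[OF b, of t] sup0[OF b'] I0 unfolding N by linarith
    show "\<bar>deriv \<rho> t\<bar> \<le> W2_infinity_norm \<rho>" for t
      using sup[OF b', of t] sup0[OF b] I0 unfolding N by linarith
    show "\<bar>deriv \<rho> s - deriv \<rho> t\<bar> \<le> W2_infinity_norm \<rho> * \<bar>s - t\<bar>" for s t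
      using sup0[OF b] sup0[OF b'] unfolding N
      by (intro order_trans[OF lipI] mult_right_mono) auto
  qed (use zero d in auto)
  have "\<exists>t. \<rho> t \<noteq> 0"
  proof (rule ccontr)
    assume "\<not> (\<exists>t. \<rho> t \<noteq> 0)"
    then have "(\<integral>x. \<rho> (norm (x :: 'a)) \<partial>lborel) = 0" by simp
    then show False using k by (simp add: kernel_profile_def)
  qed
  then obtain t where "0 < \<bar>\<rho> t\<bar>" by auto
  then have "0 < (SUP t. \<bar>\<rho> t\<bar>)" using sup[OF b, of t] by linarith
  then show "0 < W2_infinity_norm \<rho>" using sup0[OF b'] I0 unfolding N by linarith
qed

text \<open>A continuous non-negative integrand with zero integral vanishes on
  \<open>[0, 1]\<close>. Then \<open>f\<close> would vanish on all positive reals and the radial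
  kernel off the origin, against its normalisation.\<close>

lemma kernel_radial_integral_pos:
  assumes d: "1 \<le> d" and k: "kernel_profile TYPE('a::euclidean_space) f" and c: "continuous_on UNIV f"
  shows "0 < integral {0..1} (\<lambda>r. f r * r ^ (d - 1))"
proof -
  have zero: "1 < \<bar>t\<bar> \<Longrightarrow> f t = 0" and nn: "0 \<le> f t" for t
    using k by (auto simp: kernel_profile_def)
  have ci: "continuous_on {0..1} (\<lambda>r. f r * r ^ (d - 1))"
  proof -
    have "continuous_on UNIV (\<lambda>r. f r * r ^ (d - 1))"
      by (intro continuous_on_mult c continuous_on_power continuous_on_id)
    then show ?thesis by (rule continuous_on_subset) simp
  qed
  have nonneg: "0 \<le> integral {0..1} (\<lambda>r. f r * r ^ (d - 1))"
    by (rule integral_nonneg[OF integrable_continuous_interval[OF ci]]) (simp add: nn)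
  have "integral {0..1} (\<lambda>r. f r * r ^ (d - 1)) \<noteq> 0"
  proof
    assume "integral {0..1} (\<lambda>r. f r * r ^ (d - 1)) = 0"
    then have "\<forall>r\<in>{0..1}. f r * r ^ (d - 1) = 0"
      by (subst (asm) integral_eq_0_iff[OF ci]) (auto simp: nn)
    then have pos: "f r = 0" if "0 < r" for r
      using that zero[of r] by (cases "r \<le> 1") auto
    have "AE x in lborel. f (norm (x :: 'a)) = 0"
      using AE_lborel_singleton[of "0::'a"] by eventually_elim (simp add: pos)
    then have "(\<integral>x. f (norm (x :: 'a)) \<partial>lborel) = 0"
      by (rule integral_eq_zero_AE)
    then show False using k by (simp add: kernel_profile_def)
  qed
  then show ?thesis using nonneg by simp
qed

section \<open>Blow-up of rectifiable varifolds\<close>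

text \<open>A test function that ignores the plane eliminates the tangent field; compactness of the
  Grassmannian makes its support compact.\<close>

lemma rectifiable_varifold_integral:
  fixes \<Omega> :: "'a::euclidean_space set" and f :: "'a \<Rightarrow> real"
  assumes rect: "rectifiable_varifold d \<Omega> M \<theta> V" and f: "continuous_on UNIV f"
    and K: "compact K" "K \<subseteq> \<Omega>" and z: "\<And>y. y \<notin> K \<Longrightarrow> f y = 0"
  shows "(\<integral>y. f y \<partial>mass \<Omega> V) = (\<integral>y\<in>M. f y * \<theta> y \<partial>hausdorff_measure d)"
proof -
  have V: "varifold d \<Omega> V" using rect by (simp add: rectifiable_varifold_def)
  have "(\<integral>y. f y \<partial>mass \<Omega> V) = (\<integral>p. f (fst p) \<partial>V)"
    using borel_measurable_continuous_on_restrict[OF continuous_on_subset[OF f subset_UNIV]]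
    by (rule integral_mass[OF V])
  also have "\<dots> = (\<integral>y\<in>M. f y * \<theta> y \<partial>hausdorff_measure d)"
  proof -
    have c: "continuous_on (\<Omega> \<times> grassmannian d) (\<lambda>p :: 'a \<times> ('a \<Rightarrow>\<^sub>L 'a). f (fst p))"
      by (rule continuous_on_compose2[OF f]) (auto intro!: continuous_intros)
    have "\<exists>K'. compact K' \<and> K' \<subseteq> \<Omega> \<times> grassmannian d \<and>
        (\<forall>p \<in> \<Omega> \<times> grassmannian d - K'. f (fst (p :: 'a \<times> ('a \<Rightarrow>\<^sub>L 'a))) = 0)"
    proof (intro exI[of _ "K \<times> grassmannian d"] conjI ballI)
      show "f (fst p) = 0" if "p \<in> \<Omega> \<times> grassmannian d - K \<times> grassmannian d" for p :: "'a \<times> ('a \<Rightarrow>\<^sub>L 'a)"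
        using that by (intro z) auto
    qed (use K in \<open>auto intro!: compact_Times compact_grassmannian\<close>)
    then show ?thesis
      using rect c unfolding rectifiable_varifold_def by fastforce
  qed
  finally show ?thesis .
qed

text \<open>The two measures can be compared through continuous functions only. If \<open>B\<close>
  had positive mass, so would some compact \<open>K\<close> in it. Cut-offs decreasing to the
  indicator of \<open>K\<close> have integrals at least the mass of \<open>K\<close>, yet dominated
  convergence on the Hausdorff side sends them to 0.\<close>

lemma rectifiable_varifold_null:
  fixes \<Omega> :: "'a::euclidean_space set"
  assumes \<Omega>: "open \<Omega>" and d: "1 \<le> d" and rect: "rectifiable_varifold d \<Omega> M \<theta> V"
    and B: "B \<in> sets borel" "B \<subseteq> \<Omega>" and null: "AE x in hausdorff_measure d. x \<in> M \<longrightarrow> x \<notin> B"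
  shows "emeasure (mass \<Omega> V) B = 0"
proof (rule ccontr)
  assume "emeasure (mass \<Omega> V) B \<noteq> 0"
  have V: "varifold d \<Omega> V" using rect by (simp add: rectifiable_varifold_def)
  note \<mu> = radon_mass[OF \<Omega> V]
  obtain K where K: "compact K" "K \<subseteq> B" "emeasure (mass \<Omega> V) K \<noteq> 0"
    using radon_inner_regular_pos[OF \<Omega> \<mu> B] \<open>emeasure (mass \<Omega> V) B \<noteq> 0\<close> by blast
  then have K\<Omega>: "K \<subseteq> \<Omega>" and Kne: "K \<noteq> {}" using B(2) by auto
  obtain e where e: "0 < e" "(\<Union>x\<in>K. ball x e) \<subseteq> \<Omega>"
    using compact_subset_open_imp_ball_epsilon_subset[OF K(1) \<Omega> K\<Omega>] by blast
  define C where "C = {x. infdist x K \<le> e / 2}"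
  have C: "compact C" unfolding C_def by (rule compact_infdist_le[OF Kne K(1)]) (use e in simp)
  have C\<Omega>: "C \<subseteq> \<Omega>"
  proof
    fix x assume x: "x \<in> C"
    have "\<exists>y\<in>K. dist x y < e"
    proof (rule ccontr)
      assume "\<not> (\<exists>y\<in>K. dist x y < e)"
      then have "e \<le> infdist x K" unfolding infdist_notempty[OF Kne]
        by (intro cINF_greatest Kne) (auto simp: not_less)
      then show False using x e by (simp add: C_def)
    qed
    then obtain y where "y \<in> K" "x \<in> ball y e" by (auto simp: dist_commute)
    then show "x \<in> \<Omega>" using e(2) \<open>y \<in> K\<close> by blast
  qed
  \<comment> \<open>In the slope, \<open>2 / e\<close> makes all cut-offs vanish outside the common
    compact set \<open>C\<close>, and \<open>n\<close> makes them tend to 0 off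
    \<open>K\<close>.\<close>
  define f where "f n x = max 0 (1 - (real n + 2 / e) * infdist x K)" for n :: nat and x :: 'a
  have fc: "continuous_on UNIV (f n)" for n unfolding f_def by (intro continuous_intros)
  have f01: "0 \<le> f n x" "f n x \<le> 1" for n x
    using e infdist_nonneg[of x K] by (auto simp: f_def)
  have fC: "f n x = 0" if "x \<notin> C" for n x
  proof -
    have "1 \<le> 2 / e * infdist x K" using that e by (simp add: C_def field_simps)
    also have "\<dots> \<le> (real n + 2 / e) * infdist x K" by (intro mult_right_mono infdist_nonneg) simp
    finally show ?thesis by (simp add: f_def)
  qed
  have fK: "f n x = 1" if "x \<in> K" for n x using that by (simp add: f_def)
  have flim: "(\<lambda>n. f n x) \<longlonglongrightarrow> 0" if "x \<notin> K" for x
  proof -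
    have pos: "0 < infdist x K"
      using infdist_pos_not_in_closed[OF compact_imp_closed[OF K(1)] Kne that] .
    obtain m :: nat where m: "1 / infdist x K < real m" using reals_Archimedean2 by blast
    have "f n x = 0" if "m \<le> n" for n
    proof -
      have "1 / infdist x K \<le> real n + 2 / e" using m that e by (smt (verit) divide_pos_pos of_nat_mono)
      then have "1 \<le> (real n + 2 / e) * infdist x K" using pos by (simp add: divide_le_eq)
      then show ?thesis by (simp add: f_def)
    qed
    then have "\<forall>\<^sub>F n in sequentially. f n x = 0" unfolding eventually_sequentially by blast
    then show ?thesis by (rule tendsto_eventually)
  qed
  let ?H = "hausdorff_measure d :: 'a measure" and ?g = "\<lambda>y. indicator (M \<inter> C) y *\<^sub>R \<theta> y"
  have Ms: "M \<in> sets (?H)" using rect by (simp add: rectifiable_varifold_def countably_rectifiable_def)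
  have Cs: "C \<in> sets (?H)" using C borel_sets_hausdorff_measure[OF d] borel_compact by blast
  have \<theta>int: "integrable (?H) (\<lambda>x. ?g x)"
    using rect C C\<Omega> by (auto simp: rectifiable_varifold_def set_integrable_def)
  have fm: "f n \<in> borel_measurable (?H)" for n
  proof -
    have "f n \<in> borel_measurable borel" using fc by (rule borel_measurable_continuous_onI)
    then show ?thesis using borel_sets_hausdorff_measure[OF d] by (auto simp: measurable_def)
  qed
  have eq: "(\<integral>y. f n y \<partial>mass \<Omega> V) = (\<integral>y. f n y * (?g y) \<partial>?H)" for n
  proof -
    have "(\<integral>y. f n y \<partial>mass \<Omega> V) = (\<integral>y\<in>M. f n y * \<theta> y \<partial>?H)"
      by (rule rectifiable_varifold_integral[OF rect fc C C\<Omega> fC])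
    also have "\<dots> = (\<integral>y. f n y * (?g y) \<partial>?H)"
      unfolding set_lebesgue_integral_def
      by (rule Bochner_Integration.integral_cong[OF refl]) (auto split: split_indicator simp: fC)
    finally show ?thesis .
  qed
  have "(\<lambda>n. \<integral>y. f n y * (?g y) \<partial>?H) \<longlonglongrightarrow> (\<integral>y. 0 \<partial>?H)"
  proof (rule integral_dominated_convergence)
    show "integrable (?H) (\<lambda>x. norm (?g x))"
      using \<theta>int by (rule integrable_norm)
    show "(\<lambda>y. f n y * (?g y)) \<in> borel_measurable (?H)" for n
      by (intro borel_measurable_times fm borel_measurable_integrable[OF \<theta>int])
    show "AE y in ?H. (\<lambda>n. f n y * (?g y)) \<longlonglongrightarrow> 0"
      using null
    proof eventually_elim
      case (elim y)
      show ?case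
      proof (cases "y \<in> M")
        case True
        then have "y \<notin> K" using elim K(2) by blast
        then show ?thesis by (intro tendsto_mult_left_zero flim)
      qed simp
    qed
    show "AE y in ?H. norm (f n y * (?g y)) \<le> norm (?g y)" for n
    proof (rule AE_I2)
      show "norm (f n y * (?g y)) \<le> norm (?g y)" for y
        using mult_right_mono[OF f01(2)[of n y], of "norm (?g y)"] f01(1)[of n y]
        by (simp add: abs_mult)
    qed
  qed simp
  then have lim: "(\<lambda>n. \<integral>y. f n y \<partial>mass \<Omega> V) \<longlonglongrightarrow> 0" by (simp add: eq)
  have Ksets: "K \<in> sets (mass \<Omega> V)" using K K\<Omega> by (simp add: radon_sets_iff[OF \<Omega> \<mu>] borel_compact)
  have Kfin: "emeasure (mass \<Omega> V) K < \<infinity>" using \<mu> K K\<Omega> by (auto simp: radon_measure_on_def)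
  have "measure (mass \<Omega> V) K \<le> (\<integral>y. f n y \<partial>mass \<Omega> V)" for n
  proof -
    have "measure (mass \<Omega> V) K = (\<integral>y. indicator K y \<partial>mass \<Omega> V)"
      using K\<Omega> by (simp add: space_radon[OF \<mu>] Int_absorb2)
    also have "\<dots> \<le> (\<integral>y. f n y \<partial>mass \<Omega> V)"
    proof (rule integral_mono)
      show "integrable (mass \<Omega> V) (indicator K :: 'a \<Rightarrow> real)" using Ksets Kfin by simp
      show "integrable (mass \<Omega> V) (f n)"
        by (rule integrable_radon[OF \<Omega> \<mu> continuous_on_subset[OF fc] C C\<Omega> fC]) auto
      show "indicator K y \<le> f n y" for y by (auto split: split_indicator simp: f01 fK)
    qed
    finally show ?thesis .
  qed
  then have "measure (mass \<Omega> V) K \<le> 0" by (intro LIMSEQ_le_const[OF lim]) blast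
  then have "measure (mass \<Omega> V) K = 0" using measure_nonneg[of "mass \<Omega> V" K] by linarith
  then have "emeasure (mass \<Omega> V) K = 0"
    using Kfin by (simp add: emeasure_eq_ennreal_measure less_top)
  then show False using K(3) by contradiction
qed

text \<open>Sets measurable for Hausdorff measure need not be Borel, while the mass sees only Borel
  sets. So \<open>M\<close> is replaced by a Borel subset \<open>B0\<close> and the exceptional set
  by a Borel null superset \<open>N1\<close>; both replacements lose only a set of mass
  zero.\<close>

lemma rectifiable_varifold_AE:
  fixes \<Omega> :: "'a::euclidean_space set"
  assumes \<Omega>: "open \<Omega>" and d: "1 \<le> d" and rect: "rectifiable_varifold d \<Omega> M \<theta> V"
  shows "AE x in mass \<Omega> V. x \<in> \<Omega> \<and> 0 < \<theta> x \<and> (\<exists>P. approx_tangent_space d M \<theta> x P)"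
proof -
  let ?H = "hausdorff_measure d :: 'a measure"
  have V: "varifold d \<Omega> V" using rect by (simp add: rectifiable_varifold_def)
  note \<mu> = radon_mass[OF \<Omega> V]
  have Ms: "M \<in> sets ?H" using rect by (simp add: rectifiable_varifold_def countably_rectifiable_def)
  have M\<Omega>: "M \<subseteq> \<Omega>" using rect by (simp add: rectifiable_varifold_def)
  have \<theta>pos: "AE x in ?H. x \<in> M \<longrightarrow> 0 < \<theta> x" using rect by (simp add: rectifiable_varifold_def)
  have \<theta>m: "(\<lambda>x. indicator M x *\<^sub>R \<theta> x) \<in> borel_measurable ?H"
    using rect by (simp add: rectifiable_varifold_def set_borel_measurable_def)
  obtain C :: "nat \<Rightarrow> 'a set" where C: "\<And>n. compact (C n)" "\<And>n. C n \<subseteq> \<Omega>" "\<Union>(range C) = \<Omega>"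
    using open_Union_compact_subsets[OF \<Omega>] by metis
  have Cs: "C m \<in> sets ?H" for m using C(1) borel_sets_hausdorff_measure[OF d] borel_compact by blast
  \<comment> \<open>Cutting at levels of \<open>\<theta>\<close> and at compact sets gives pieces of
    finite Hausdorff measure by Chebyshev's inequality, as Borel cores require.\<close>
  define Mk where "Mk m k = {x \<in> space ?H. 1 / real (Suc k) < indicator M x *\<^sub>R \<theta> x} \<inter> M \<inter> C m" for m k :: nat
  have Mks: "Mk m k \<in> sets ?H" for m k
  proof -
    have "{x \<in> space ?H. 1 / real (Suc k) < indicator M x *\<^sub>R \<theta> x} \<in> sets ?H"
      by (intro borel_measurable_less borel_measurable_const \<theta>m)
    then show ?thesis unfolding Mk_def using Ms Cs by blast
  qed
  have Mkfin: "emeasure ?H (Mk m k) < top" for m k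
  proof -
    have int: "integrable ?H (\<lambda>x. indicator (M \<inter> C m) x *\<^sub>R \<theta> x)"
      using rect C by (auto simp: rectifiable_varifold_def set_integrable_def)
    have "ennreal (1 / real (Suc k)) * emeasure ?H (Mk m k)
        = (\<integral>\<^sup>+x. ennreal (1 / real (Suc k)) * indicator (Mk m k) x \<partial>?H)"
      using Mks by (simp add: nn_integral_cmult_indicator)
    also have "\<dots> \<le> (\<integral>\<^sup>+x. ennreal (norm (indicator (M \<inter> C m) x *\<^sub>R \<theta> x)) \<partial>?H)"
    proof (rule nn_integral_mono)
      show "ennreal (1 / real (Suc k)) * indicator (Mk m k) x \<le> ennreal (norm (indicator (M \<inter> C m) x *\<^sub>R \<theta> x))" for x
      proof (cases "x \<in> Mk m k")
        case True
        then have "1 / real (Suc k) \<le> \<bar>\<theta> x\<bar>" "x \<in> M" "x \<in> C m" by (auto simp: Mk_def)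
        then show ?thesis using True by (simp add: ennreal_leI del: of_nat_Suc)
      qed simp
    qed
    also have "\<dots> < \<infinity>" using int unfolding integrable_iff_bounded by blast
    finally show ?thesis by (auto simp: ennreal_mult_less_top simp del: of_nat_Suc)
  qed
  have "\<exists>B. B \<subseteq> Mk m k \<and> B \<in> sets borel \<and> hausdorff_outer d (Mk m k - B) = 0" for m k
    using hausdorff_borel_core[OF d Mks Mkfin] by metis
  then obtain B where B: "\<And>m k. B m k \<subseteq> Mk m k" "\<And>m k. B m k \<in> sets borel"
    "\<And>m k. hausdorff_outer d (Mk m k - B m k) = 0" by metis
  define B0 where "B0 = (\<Union>m k. B m k)"
  have B0b: "B0 \<in> sets borel" unfolding B0_def using B(2) by blast
  have B0M: "B0 \<subseteq> M" using B(1) by (auto simp: B0_def Mk_def)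
  have "AE x in ?H. x \<notin> Mk m k - B m k" for m k
  proof (rule AE_not_in)
    have s: "Mk m k - B m k \<in> sets ?H"
      using Mks B(2) borel_sets_hausdorff_measure[OF d] by blast
    then show "Mk m k - B m k \<in> null_sets ?H"
      using hausdorff_measure_eq(2)[OF d s] B(3) by (simp add: null_sets_def)
  qed
  then have "AE x in ?H. \<forall>m k. x \<notin> Mk m k - B m k" by (simp only: AE_all_countable) simp
  with \<theta>pos have AE1: "AE x in ?H. x \<in> M \<longrightarrow> x \<notin> \<Omega> - B0"
  proof eventually_elim
    case (elim x)
    show ?case
    proof
      assume x: "x \<in> M"
      then obtain m where "x \<in> C m" using M\<Omega> C(3) by blast
      moreover obtain k where "1 / real (Suc k) < \<theta> x" using elim(1) x nat_approx_posE by blast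
      ultimately have "x \<in> Mk m k" using x by (simp add: Mk_def)
      then show "x \<notin> \<Omega> - B0" using elim(2) by (auto simp: B0_def)
    qed
  qed
  have n1: "emeasure (mass \<Omega> V) (\<Omega> - B0) = 0"
    by (rule rectifiable_varifold_null[OF \<Omega> d rect _ _ AE1]) (use \<Omega> B0b in auto)
  have "AE x in ?H. x \<in> M \<longrightarrow> 0 < \<theta> x \<and> (\<exists>P. approx_tangent_space d M \<theta> x P)"
  proof -
    obtain T where "AE x in ?H. x \<in> M \<longrightarrow> approx_tangent_space d M \<theta> x (T x)"
      using rect unfolding rectifiable_varifold_def by blast
    then show ?thesis using \<theta>pos by eventually_elim blast
  qed
  then obtain N0 where N0: "{x \<in> space ?H. \<not> (x \<in> M \<longrightarrow> 0 < \<theta> x \<and> (\<exists>P. approx_tangent_space d M \<theta> x P))} \<subseteq> N0"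
    "emeasure ?H N0 = 0" "N0 \<in> sets ?H"
    by (rule AE_E)
  then have "hausdorff_outer d N0 = 0" using hausdorff_measure_eq(2)[OF d] by metis
  then obtain N1 where N1: "N0 \<subseteq> N1" "N1 \<in> sets borel" "hausdorff_outer d N1 = 0"
    using hausdorff_borel_hull[OF d, of N0] by metis
  have "N1 \<in> null_sets ?H"
    using N1 emeasure_hausdorff_borel[OF d N1(2)] borel_sets_hausdorff_measure[OF d] by (auto simp: null_sets_def)
  then have "AE x in ?H. x \<notin> N1" by (rule AE_not_in)
  then have AE2: "AE x in ?H. x \<in> M \<longrightarrow> x \<notin> \<Omega> \<inter> N1" by eventually_elim blast
  have n2: "emeasure (mass \<Omega> V) (\<Omega> \<inter> N1) = 0"
    by (rule rectifiable_varifold_null[OF \<Omega> d rect _ _ AE2]) (use \<Omega> N1 in auto)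
  have "AE x in mass \<Omega> V. x \<notin> \<Omega> - B0"
    using n1 \<Omega> B0b by (intro AE_not_in) (auto simp: null_sets_def radon_sets_iff[OF \<Omega> \<mu>])
  moreover have "AE x in mass \<Omega> V. x \<notin> \<Omega> \<inter> N1"
    using n2 \<Omega> N1(2) by (intro AE_not_in) (auto simp: null_sets_def radon_sets_iff[OF \<Omega> \<mu>])
  moreover have "AE x in mass \<Omega> V. x \<in> space (mass \<Omega> V)" by (rule AE_space)
  ultimately show ?thesis
  proof eventually_elim
    case (elim x)
    then have x: "x \<in> \<Omega>" "x \<in> M" "x \<notin> N0" using B0M N1(1) space_radon[OF \<mu>] by auto
    then show ?case using N0(1) by auto
  qed
qed

text \<open>The factor \<open>\<epsilon> ^ n / \<epsilon> ^ d\<close> removes the normalisation of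
  the kernel and leaves the blow-up that defines the approximate tangent space. For small
  \<open>\<epsilon>\<close> the kernel lives inside \<open>\<Omega>\<close>, so its mass integral is
  a Hausdorff integral.\<close>

lemma mass_conv_blowup:
  fixes \<Omega> :: "'a::euclidean_space set"
  assumes \<Omega>: "open \<Omega>" and rect: "rectifiable_varifold d \<Omega> M \<theta> V" and x: "x \<in> \<Omega>"
    and P: "approx_tangent_space d M \<theta> x P"
    and f: "continuous_on UNIV f" and zero: "\<And>t. 1 < \<bar>t\<bar> \<Longrightarrow> f t = 0"
  shows "((\<lambda>\<epsilon>. \<epsilon> ^ DIM('a) / \<epsilon> ^ d * mass_conv \<Omega> V f \<epsilon> x)
    \<longlongrightarrow> \<theta> x * (\<integral>y\<in>P. f (norm y) \<partial>hausdorff_measure d)) (at_right 0)"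
proof -
  have fc: "continuous_on UNIV (\<lambda>y::'a. f (norm y))"
    by (rule continuous_on_compose2[OF f]) (auto intro!: continuous_intros)
  have "{y::'a. f (norm y) \<noteq> 0} \<subseteq> cball 0 1" using zero by (force simp: not_less[symmetric])
  then have "closure {y::'a. f (norm y) \<noteq> 0} \<subseteq> cball 0 1" by (rule closure_minimal) simp
  then have "compact (closure {y::'a. f (norm y) \<noteq> 0})"
    by (meson bounded_cball bounded_subset closed_closure compact_eq_bounded_closed)
  then have lim: "((\<lambda>r. (\<integral>y\<in>M. f (norm ((y - x) /\<^sub>R r)) * \<theta> y \<partial>hausdorff_measure d) / r ^ d)
      \<longlongrightarrow> \<theta> x * (\<integral>y\<in>P. f (norm y) \<partial>hausdorff_measure d)) (at_right 0)"
    using P fc unfolding approx_tangent_space_def by blast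
  obtain t where t: "0 < t" "cball x t \<subseteq> \<Omega>" using \<Omega> x open_contains_cball by blast
  have "\<forall>\<^sub>F r in at_right 0. (\<integral>y\<in>M. f (norm ((y - x) /\<^sub>R r)) * \<theta> y \<partial>hausdorff_measure d) / r ^ d
      = r ^ DIM('a) / r ^ d * mass_conv \<Omega> V f r x"
    unfolding eventually_at_right_field
  proof (intro exI[of _ t] conjI allI impI)
    fix r :: real assume r: "0 < r" "r < t"
    have sub: "cball x r \<subseteq> \<Omega>" using t r by auto
    have "(\<integral>y. f (norm ((y - x) /\<^sub>R r)) \<partial>mass \<Omega> V) = (\<integral>y\<in>M. f (norm ((y - x) /\<^sub>R r)) * \<theta> y \<partial>hausdorff_measure d)"
    proof (rule rectifiable_varifold_integral[OF rect _ compact_cball sub])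
      show "continuous_on UNIV (\<lambda>y. f (norm ((y - x) /\<^sub>R r)))"
        using r by (intro continuous_on_compose2[OF f] continuous_intros) auto
      show "f (norm ((y - x) /\<^sub>R r)) = 0" if "y \<notin> cball x r" for y
      proof -
        have "norm ((y - x) /\<^sub>R r) = norm (y - x) / r"
          using r by (simp only: norm_scaleR) (simp add: divide_inverse mult.commute)
        moreover have "1 < norm (y - x) / r" using that r by (simp add: dist_norm norm_minus_commute)
        ultimately show ?thesis using r by (intro zero) simp
      qed
    qed
    moreover have "mass_conv \<Omega> V f r x = (\<integral>y. f (norm ((y - x) /\<^sub>R r)) \<partial>mass \<Omega> V) / r ^ DIM('a)"
      unfolding mass_conv_def scaled_kernel_def by (rule integral_divide_zero)
    ultimately show "(\<integral>y\<in>M. f (norm ((y - x) /\<^sub>R r)) * \<theta> y \<partial>hausdorff_measure d) / r ^ d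
      = r ^ DIM('a) / r ^ d * mass_conv \<Omega> V f r x"
      using r by simp
  qed (rule t)
  then show ?thesis using lim by (rule Lim_transform_eventually[rotated])
qed

text \<open>A cut-off equal to 1 up to radius \<open>1 / 2\<close>, used at scale
  \<open>2 * r\<close>, dominates the indicator of the ball of radius \<open>r\<close>. Its rescaled
  integral converges and is eventually below \<open>L + 1\<close>; the factor \<open>2 ^ d\<close>
  comes from the scale.\<close>

lemma growth_at_approx_tangent_space:
  fixes \<Omega> :: "'a::euclidean_space set"
  assumes \<Omega>: "open \<Omega>" and rect: "rectifiable_varifold d \<Omega> M \<theta> V" and x: "x \<in> \<Omega>"
    and P: "approx_tangent_space d M \<theta> x P"
  shows "growth_at d (mass \<Omega> V) x"
proof -
  have V: "varifold d \<Omega> V" using rect by (simp add: rectifiable_varifold_def)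
  note \<mu> = radon_mass[OF \<Omega> V]
  define f where "f t = max 0 (min 1 (2 - 2 * \<bar>t\<bar>))" for t :: real
  have f: "continuous_on UNIV f" unfolding f_def by (intro continuous_intros)
  have zero: "f t = 0" if "1 < \<bar>t\<bar>" for t using that by (simp add: f_def)
  define L where "L = \<theta> x * (\<integral>y\<in>P. f (norm y) \<partial>hausdorff_measure d)"
  have "((\<lambda>\<epsilon>. \<epsilon> ^ DIM('a) / \<epsilon> ^ d * mass_conv \<Omega> V f \<epsilon> x) \<longlongrightarrow> L) (at_right 0)"
    unfolding L_def by (rule mass_conv_blowup[OF \<Omega> rect x P f zero])
  then have "\<forall>\<^sub>F \<epsilon> in at_right 0. \<epsilon> ^ DIM('a) / \<epsilon> ^ d * mass_conv \<Omega> V f \<epsilon> x < L + 1"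
    by (rule order_tendstoD) simp
  then obtain b where b: "0 < b" "\<And>\<epsilon>. 0 < \<epsilon> \<Longrightarrow> \<epsilon> < b \<Longrightarrow> \<epsilon> ^ DIM('a) / \<epsilon> ^ d * mass_conv \<Omega> V f \<epsilon> x < L + 1"
    unfolding eventually_at_right_field by blast
  obtain t where t: "0 < t" "cball x t \<subseteq> \<Omega>" using \<Omega> x open_contains_cball by blast
  have "emeasure (mass \<Omega> V) (ball x r) \<le> ennreal ((L + 1) * 2 ^ d * r ^ d)" if r: "0 < r" "r < min b t / 2" for r
  proof -
    define \<epsilon> where "\<epsilon> = 2 * r"
    have \<epsilon>: "0 < \<epsilon>" "\<epsilon> < b" "\<epsilon> < t" using r by (auto simp: \<epsilon>_def)
    have sub: "cball x \<epsilon> \<subseteq> \<Omega>" using t \<epsilon> by auto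
    have cont: "continuous_on UNIV (\<lambda>y. \<epsilon> ^ DIM('a) * scaled_kernel f \<epsilon> (y - x))"
      by (intro continuous_intros continuous_scaled_kernel f \<epsilon>)
    have int: "integrable (mass \<Omega> V) (\<lambda>y. \<epsilon> ^ DIM('a) * scaled_kernel f \<epsilon> (y - x))"
    proof (rule integrable_radon[OF \<Omega> \<mu> continuous_on_subset[OF cont] compact_cball sub])
      show "\<epsilon> ^ DIM('a) * scaled_kernel f \<epsilon> (y - x) = 0" if "y \<notin> cball x \<epsilon>" for y
        using that scaled_kernel_zero[OF zero \<epsilon>(1), where x="y - x"] by (simp add: dist_norm norm_minus_commute)
    qed simp
    have sets: "ball x r \<in> sets (mass \<Omega> V)"
      using sub r by (auto simp: radon_sets_iff[OF \<Omega> \<mu>] \<epsilon>_def subset_iff)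
    have "emeasure (mass \<Omega> V) (ball x r) = (\<integral>\<^sup>+y. indicator (ball x r) y \<partial>mass \<Omega> V)"
      using sets by simp
    also have "\<dots> \<le> (\<integral>\<^sup>+y. ennreal (\<epsilon> ^ DIM('a) * scaled_kernel f \<epsilon> (y - x)) \<partial>mass \<Omega> V)"
    proof (rule nn_integral_mono)
      fix y
      show "indicator (ball x r) y \<le> ennreal (\<epsilon> ^ DIM('a) * scaled_kernel f \<epsilon> (y - x))"
      proof (cases "y \<in> ball x r")
        case True
        then have "norm (y - x) / \<epsilon> \<le> 1 / 2" using r by (simp add: \<epsilon>_def dist_norm norm_minus_commute)
        then have "f (norm (y - x) / \<epsilon>) = 1" using \<epsilon> by (simp add: f_def)
        then show ?thesis using True \<epsilon> by (simp add: scaled_kernel_eq)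
      qed simp
    qed
    also have "\<dots> = ennreal (\<integral>y. \<epsilon> ^ DIM('a) * scaled_kernel f \<epsilon> (y - x) \<partial>mass \<Omega> V)"
      by (rule nn_integral_eq_integral[OF int]) (use \<epsilon> in \<open>simp add: scaled_kernel_eq f_def\<close>)
    also have "(\<integral>y. \<epsilon> ^ DIM('a) * scaled_kernel f \<epsilon> (y - x) \<partial>mass \<Omega> V) = \<epsilon> ^ DIM('a) * mass_conv \<Omega> V f \<epsilon> x"
      unfolding mass_conv_def by (rule integral_mult_right_zero)
    also have "ennreal (\<epsilon> ^ DIM('a) * mass_conv \<Omega> V f \<epsilon> x) \<le> ennreal ((L + 1) * 2 ^ d * r ^ d)"
    proof (rule ennreal_leI)
      have "\<epsilon> ^ DIM('a) * mass_conv \<Omega> V f \<epsilon> x < (L + 1) * \<epsilon> ^ d"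
        using b(2)[OF \<epsilon>(1,2)] \<epsilon>(1) by (simp add: pos_divide_less_eq)
      then show "\<epsilon> ^ DIM('a) * mass_conv \<Omega> V f \<epsilon> x \<le> (L + 1) * 2 ^ d * r ^ d"
        by (simp add: \<epsilon>_def power_mult_distrib mult.assoc)
    qed
    finally show ?thesis .
  qed
  then show ?thesis
    unfolding growth_at_def eventually_at_right_field
    using b(1) t(1) by (intro exI[of _ "(L + 1) * 2 ^ d"] exI[of _ "min b t / 2"]) simp
qed

section \<open>The convolved first variation at a Lebesgue point\<close>

lemma norm_integral_le_nn_integral:
  fixes f :: "'b \<Rightarrow> 'a::{banach, second_countable_topology}"
  shows "ennreal (norm (\<integral>x. f x \<partial>M)) \<le> (\<integral>\<^sup>+x. norm (f x) \<partial>M)"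
  by (cases "integrable M f") (auto simp: integral_norm_bound_ennreal not_integrable_integral_eq)

lemma (in c11_profile) scaled_kernel_bound:
  "0 < \<epsilon> \<Longrightarrow> \<bar>scaled_kernel \<rho> \<epsilon> (x :: 'a::euclidean_space)\<bar> \<le> N / \<epsilon> ^ DIM('a)"
  using bound by (simp add: scaled_kernel_eq divide_right_mono)

text \<open>Test the first variation with \<open>\<rho>\<^sub>\<epsilon>(\<cdot> - x) b\<close> for the basis vectors \<open>b\<close>: at a Lebesgue point of
  \<open>H\<close> where the singular part has density \<open>0\<close>, only \<open>H(x)\<close> survives at the scale \<open>\<epsilon>\<^sup>d\<close>.\<close>

lemma (in c11_profile) first_variation_conv_blowup:
  fixes \<Omega> :: "'a::euclidean_space set" and H \<nu> :: "'a \<Rightarrow> 'a"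
  assumes \<Omega>: "open \<Omega>" and V: "varifold d \<Omega> V" and x: "x \<in> \<Omega>"
    and H: "H \<in> borel_measurable (mass \<Omega> V)"
    and Hint: "\<And>K. compact K \<Longrightarrow> K \<subseteq> \<Omega> \<Longrightarrow> set_integrable (mass \<Omega> V) K H"
    and \<sigma>: "radon_measure_on \<Omega> \<sigma>" and \<nu>1: "AE x in \<sigma>. norm (\<nu> x) = 1"
    and fv: "\<And>X. C1_compact_support \<Omega> X \<Longrightarrow>
      first_variation V X = - (\<integral>x. X x \<bullet> H x \<partial>mass \<Omega> V) + (\<integral>x. X x \<bullet> \<nu> x \<partial>\<sigma>)"
    and leb: "\<forall>e>0. \<forall>\<^sub>F r in at_right 0. (\<integral>\<^sup>+y\<in>ball x r. norm (H y - H x) \<partial>mass \<Omega> V) \<le> ennreal (e * r ^ d)"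
    and sing: "\<forall>e>0. \<forall>\<^sub>F r in at_right 0. emeasure \<sigma> (ball x r) \<le> ennreal (e * r ^ d)"
  shows "((\<lambda>\<epsilon>. (\<epsilon> ^ DIM('a) / \<epsilon> ^ d) *\<^sub>R (first_variation_conv V \<rho> \<epsilon> x + mass_conv \<Omega> V \<rho> \<epsilon> x *\<^sub>R H x)) \<longlongrightarrow> 0) (at_right 0)"
proof -
  let ?\<mu> = "mass \<Omega> V" and ?n = "DIM('a)"
  note \<mu> = radon_mass[OF \<Omega> V]
  define D where "D \<epsilon> = first_variation_conv V \<rho> \<epsilon> x + mass_conv \<Omega> V \<rho> \<epsilon> x *\<^sub>R H x" for \<epsilon>
  obtain t where t: "0 < t" "cball x t \<subseteq> \<Omega>" using \<Omega> x open_contains_cball by blast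
  \<comment> \<open>The closed ball carrying the kernel is enlarged to the open ball of twice the
    radius, to match the open balls in the density hypotheses; hence the powers of
    \<open>2 * \<epsilon>\<close>.\<close>
  have main: "\<bar>D \<epsilon> \<bullet> b\<bar> \<le> 2 * (N / \<epsilon> ^ ?n) * (e * (2 * \<epsilon>) ^ d)"
    if \<epsilon>: "0 < \<epsilon>" "2 * \<epsilon> < t" and b: "b \<in> Basis" and e: "0 < e"
      and l: "(\<integral>\<^sup>+y\<in>ball x (2 * \<epsilon>). norm (H y - H x) \<partial>?\<mu>) \<le> ennreal (e * (2 * \<epsilon>) ^ d)"
      and s: "emeasure \<sigma> (ball x (2 * \<epsilon>)) \<le> ennreal (e * (2 * \<epsilon>) ^ d)" for \<epsilon> b e
  proof -
    define q where "q = N / \<epsilon> ^ ?n"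
    define k where "k y = scaled_kernel \<rho> \<epsilon> (y - x)" for y
    have sub: "cball x \<epsilon> \<subseteq> \<Omega>" using t \<epsilon> by auto
    have ballsub: "ball x (2 * \<epsilon>) \<subseteq> \<Omega>" using t \<epsilon> by (auto simp: subset_iff)
    have kc: "continuous_on UNIV k" unfolding k_def by (rule continuous_scaled_kernel[OF continuous \<epsilon>(1)])
    have kz: "k y = 0" if "y \<notin> cball x \<epsilon>" for y
      using that unfolding k_def by (intro scaled_kernel_zero[OF zero \<epsilon>(1)]) (auto simp: dist_norm norm_minus_commute)
    have kb: "\<bar>k y\<bar> \<le> q" for y unfolding k_def q_def by (rule scaled_kernel_bound[OF \<epsilon>(1)])
    have kb0: "0 \<le> q" using N_nonneg \<epsilon> by (simp add: q_def)
    have kball: "\<bar>k y\<bar> \<le> q * indicator (ball x (2 * \<epsilon>)) y" for y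
      using kb[of y] kz[of y] \<epsilon>(1) by (auto split: split_indicator)
    have ms: "sets ?\<mu> = sets (restrict_space borel \<Omega>)" by (rule sets_mass)
    have km: "k \<in> borel_measurable ?\<mu>"
      using borel_measurable_continuous_on_restrict[OF continuous_on_subset[OF kc subset_UNIV]]
      by (simp add: measurable_cong_sets[OF ms refl])
    have kint: "integrable ?\<mu> k"
      by (rule integrable_radon[OF \<Omega> \<mu> continuous_on_subset[OF kc] compact_cball sub kz]) auto
    have kH: "integrable ?\<mu> (\<lambda>y. k y * (H y \<bullet> b))"
    proof (rule Bochner_Integration.integrable_bound)
      show "integrable ?\<mu> (\<lambda>y. q * norm (indicator (cball x \<epsilon>) y *\<^sub>R H y))"
        using Hint[OF compact_cball sub] unfolding set_integrable_def by (intro integrable_mult_right integrable_norm)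
      show "(\<lambda>y. k y * (H y \<bullet> b)) \<in> borel_measurable ?\<mu>"
        by (intro borel_measurable_times km borel_measurable_inner H borel_measurable_const)
      show "AE y in ?\<mu>. norm (k y * (H y \<bullet> b)) \<le> norm (q * norm (indicator (cball x \<epsilon>) y *\<^sub>R H y))"
      proof (rule AE_I2)
        fix y
        show "norm (k y * (H y \<bullet> b)) \<le> norm (q * norm (indicator (cball x \<epsilon>) y *\<^sub>R H y))"
        proof (cases "y \<in> cball x \<epsilon>")
          case True
          have "\<bar>k y\<bar> * \<bar>H y \<bullet> b\<bar> \<le> q * norm (H y)"
            by (intro mult_mono kb Basis_le_norm[OF b] kb0) auto
          then show ?thesis using True kb0 by (simp add: abs_mult)
        qed (simp add: kz)
      qed
    qed
    have "first_variation_conv V \<rho> \<epsilon> x \<bullet> b = first_variation V (\<lambda>y. k y *\<^sub>R b)"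
      unfolding k_def by (rule first_variation_kernel_field[OF V \<epsilon>(1) sub, symmetric])
    also have "\<dots> = - (\<integral>y. k y * (H y \<bullet> b) \<partial>?\<mu>) + (\<integral>y. k y * (\<nu> y \<bullet> b) \<partial>\<sigma>)"
      using fv[OF C1_compact_support_kernel_field[OF \<epsilon>(1) sub, of b]] by (simp add: k_def inner_commute)
    finally have eq1: "first_variation_conv V \<rho> \<epsilon> x \<bullet> b = - (\<integral>y. k y * (H y \<bullet> b) \<partial>?\<mu>) + (\<integral>y. k y * (\<nu> y \<bullet> b) \<partial>\<sigma>)" .
    have eq2: "mass_conv \<Omega> V \<rho> \<epsilon> x * (H x \<bullet> b) = (\<integral>y. k y * (H x \<bullet> b) \<partial>?\<mu>)"
      unfolding mass_conv_def k_def by simp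
    have "D \<epsilon> \<bullet> b = - (\<integral>y. k y * (H y \<bullet> b) \<partial>?\<mu>) + (\<integral>y. k y * (H x \<bullet> b) \<partial>?\<mu>) + (\<integral>y. k y * (\<nu> y \<bullet> b) \<partial>\<sigma>)"
      unfolding D_def by (simp add: inner_add_left eq1 eq2)
    also have "- (\<integral>y. k y * (H y \<bullet> b) \<partial>?\<mu>) + (\<integral>y. k y * (H x \<bullet> b) \<partial>?\<mu>)
        = - (\<integral>y. k y * (H y \<bullet> b) - k y * (H x \<bullet> b) \<partial>?\<mu>)"
      using kH kint by (subst Bochner_Integration.integral_diff) auto
    finally have eq3: "\<bar>D \<epsilon> \<bullet> b\<bar> \<le> \<bar>\<integral>y. k y * (H y \<bullet> b) - k y * (H x \<bullet> b) \<partial>?\<mu>\<bar> + \<bar>\<integral>y. k y * (\<nu> y \<bullet> b) \<partial>\<sigma>\<bar>"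
      by linarith
    have b0: "0 \<le> q * (e * (2 * \<epsilon>) ^ d)" using kb0 e \<epsilon> by (intro mult_nonneg_nonneg) auto
    have "ennreal \<bar>\<integral>y. k y * (H y \<bullet> b) - k y * (H x \<bullet> b) \<partial>?\<mu>\<bar>
        \<le> (\<integral>\<^sup>+y. ennreal (norm (k y * (H y \<bullet> b) - k y * (H x \<bullet> b))) \<partial>?\<mu>)"
      using norm_integral_le_nn_integral[of ?\<mu> "\<lambda>y. k y * (H y \<bullet> b) - k y * (H x \<bullet> b)"] by simp
    also have "\<dots> \<le> (\<integral>\<^sup>+y. ennreal (q) * (ennreal (norm (H y - H x)) * indicator (ball x (2 * \<epsilon>)) y) \<partial>?\<mu>)"
    proof (rule nn_integral_mono)
      fix y
      have "\<bar>k y\<bar> * \<bar>(H y - H x) \<bullet> b\<bar> \<le> (q * indicator (ball x (2 * \<epsilon>)) y) * norm (H y - H x)"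
        using kb0 by (intro mult_mono kball Basis_le_norm[OF b]) auto
      moreover have "norm (k y * (H y \<bullet> b) - k y * (H x \<bullet> b)) = \<bar>k y\<bar> * \<bar>(H y - H x) \<bullet> b\<bar>"
        by (simp add: abs_mult[symmetric] inner_diff_left right_diff_distrib)
      ultimately have "ennreal (norm (k y * (H y \<bullet> b) - k y * (H x \<bullet> b)))
          \<le> ennreal (q * indicator (ball x (2 * \<epsilon>)) y * norm (H y - H x))"
        by (intro ennreal_leI) simp
      then show "ennreal (norm (k y * (H y \<bullet> b) - k y * (H x \<bullet> b)))
          \<le> ennreal (q) * (ennreal (norm (H y - H x)) * indicator (ball x (2 * \<epsilon>)) y)"
        using kb0 by (cases "y \<in> ball x (2 * \<epsilon>)") (simp_all add: ennreal_mult)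
    qed
    also have "\<dots> = ennreal (q) * (\<integral>\<^sup>+y\<in>ball x (2 * \<epsilon>). norm (H y - H x) \<partial>?\<mu>)"
    proof (rule nn_integral_cmult)
      have [measurable]: "ball x (2 * \<epsilon>) \<in> sets ?\<mu>" using ballsub by (simp add: radon_sets_iff[OF \<Omega> \<mu>])
      note [measurable] = H
      show "(\<lambda>y. ennreal (norm (H y - H x)) * indicator (ball x (2 * \<epsilon>)) y) \<in> borel_measurable ?\<mu>" by measurable
    qed
    also have "\<dots> \<le> ennreal (q) * ennreal (e * (2 * \<epsilon>) ^ d)" by (intro mult_left_mono l) simp
    also have "\<dots> = ennreal (q * (e * (2 * \<epsilon>) ^ d))" using kb0 by (rule ennreal_mult'[symmetric])
    finally have p1: "\<bar>\<integral>y. k y * (H y \<bullet> b) - k y * (H x \<bullet> b) \<partial>?\<mu>\<bar> \<le> q * (e * (2 * \<epsilon>) ^ d)"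
      using b0 by (simp only: ennreal_le_iff)
    have "ennreal \<bar>\<integral>y. k y * (\<nu> y \<bullet> b) \<partial>\<sigma>\<bar> \<le> (\<integral>\<^sup>+y. ennreal (norm (k y * (\<nu> y \<bullet> b))) \<partial>\<sigma>)"
      using norm_integral_le_nn_integral[of \<sigma> "\<lambda>y. k y * (\<nu> y \<bullet> b)"] by simp
    also have "\<dots> \<le> (\<integral>\<^sup>+y. ennreal (q) * indicator (ball x (2 * \<epsilon>)) y \<partial>\<sigma>)"
    proof (rule nn_integral_mono_AE)
      show "AE y in \<sigma>. ennreal (norm (k y * (\<nu> y \<bullet> b))) \<le> ennreal (q) * indicator (ball x (2 * \<epsilon>)) y"
        using \<nu>1
      proof eventually_elim
        case (elim y)
        have "\<bar>k y\<bar> * \<bar>\<nu> y \<bullet> b\<bar> \<le> (q * indicator (ball x (2 * \<epsilon>)) y) * 1"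
          using kb0 Basis_le_norm[OF b, of "\<nu> y"] elim by (intro mult_mono kball) auto
        then have "ennreal (norm (k y * (\<nu> y \<bullet> b))) \<le> ennreal (q * indicator (ball x (2 * \<epsilon>)) y)"
          by (intro ennreal_leI) (simp add: abs_mult)
        then show ?case by (cases "y \<in> ball x (2 * \<epsilon>)") simp_all
      qed
    qed
    also have "\<dots> = ennreal (q) * emeasure \<sigma> (ball x (2 * \<epsilon>))"
      using ballsub by (intro nn_integral_cmult_indicator) (simp add: radon_sets_iff[OF \<Omega> \<sigma>])
    also have "\<dots> \<le> ennreal (q) * ennreal (e * (2 * \<epsilon>) ^ d)" by (intro mult_left_mono s) simp
    also have "\<dots> = ennreal (q * (e * (2 * \<epsilon>) ^ d))" using kb0 by (rule ennreal_mult'[symmetric])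
    finally have p2: "\<bar>\<integral>y. k y * (\<nu> y \<bullet> b) \<partial>\<sigma>\<bar> \<le> q * (e * (2 * \<epsilon>) ^ d)"
      using b0 by (simp only: ennreal_le_iff)
    show ?thesis using eq3 p1 p2 unfolding q_def[symmetric] by linarith
  qed
  have "\<forall>\<^sub>F \<epsilon> in at_right 0. norm ((\<epsilon> ^ ?n / \<epsilon> ^ d) *\<^sub>R D \<epsilon>) < a" if a: "0 < a" for a
  proof -
    \<comment> \<open>Summing over the basis costs the dimension and the radius
      \<open>2 * \<epsilon>\<close> costs \<open>2 ^ d\<close>; \<open>N + 1\<close> in place of
      \<open>N\<close> keeps the divisor positive.\<close>
    define e where "e = a / (2 * (real ?n * (N + 1) * 2 ^ d))"
    have Q: "0 < real ?n * (N + 1) * 2 ^ d" using N_nonneg by (intro mult_pos_pos) auto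
    have e: "0 < e" using a Q by (simp add: e_def)
    obtain b1 where b1: "0 < b1" "\<And>r. 0 < r \<Longrightarrow> r < b1 \<Longrightarrow>
        (\<integral>\<^sup>+y\<in>ball x r. norm (H y - H x) \<partial>?\<mu>) \<le> ennreal (e / 2 * r ^ d)"
      using leb e unfolding eventually_at_right_field by (meson half_gt_zero)
    obtain b2 where b2: "0 < b2" "\<And>r. 0 < r \<Longrightarrow> r < b2 \<Longrightarrow> emeasure \<sigma> (ball x r) \<le> ennreal (e / 2 * r ^ d)"
      using sing e unfolding eventually_at_right_field by (meson half_gt_zero)
    define B where "B = min t (min b1 b2) / 2"
    have "norm ((\<epsilon> ^ ?n / \<epsilon> ^ d) *\<^sub>R D \<epsilon>) < a" if \<epsilon>: "0 < \<epsilon>" "\<epsilon> < B" for \<epsilon>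
    proof -
      have c: "\<bar>D \<epsilon> \<bullet> b\<bar> \<le> 2 * (N / \<epsilon> ^ ?n) * (e / 2 * (2 * \<epsilon>) ^ d)" if "b \<in> Basis" for b
        using \<epsilon> e that by (intro main b1 b2) (auto simp: B_def)
      have "norm (D \<epsilon>) \<le> (\<Sum>b\<in>Basis. \<bar>D \<epsilon> \<bullet> b\<bar>)" by (rule norm_le_l1)
      also have "\<dots> \<le> (\<Sum>b\<in>(Basis::'a set). 2 * (N / \<epsilon> ^ ?n) * (e / 2 * (2 * \<epsilon>) ^ d))" by (rule sum_mono) (rule c)
      also have "\<dots> = real ?n * N * 2 ^ d * e * (\<epsilon> ^ d / \<epsilon> ^ ?n)"
        by (simp add: power_mult_distrib)
      also have "\<dots> \<le> real ?n * (N + 1) * 2 ^ d * e * (\<epsilon> ^ d / \<epsilon> ^ ?n)"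
        using e \<epsilon> N_nonneg by (intro mult_right_mono mult_left_mono) auto
      also have "real ?n * (N + 1) * 2 ^ d * e = a / 2" using Q N_nonneg by (simp add: e_def)
      finally have "norm (D \<epsilon>) \<le> a / 2 * (\<epsilon> ^ d / \<epsilon> ^ ?n)" .
      then have "\<epsilon> ^ ?n / \<epsilon> ^ d * norm (D \<epsilon>) \<le> \<epsilon> ^ ?n / \<epsilon> ^ d * (a / 2 * (\<epsilon> ^ d / \<epsilon> ^ ?n))"
        using \<epsilon> by (intro mult_left_mono) auto
      also have "\<dots> = a / 2" using \<epsilon> by simp
      also have "\<dots> < a" using a by simp
      finally show ?thesis using \<epsilon> by simp
    qed
    moreover have "0 < B" using t b1 b2 by (simp add: B_def)
    ultimately show ?thesis unfolding eventually_at_right_field by (intro exI[of _ B]) simp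
  qed
  then show ?thesis unfolding D_def[symmetric] by (intro tendstoI) (simp only: dist_norm diff_zero)
qed

section \<open>Stability of the approximate mean curvature\<close>

text \<open>Both convolved masses have blow-up limits
  \<open>\<theta> x * (\<kappa> * d * I f)\<close>. In their quotient the density and the unit ball
  measure cancel, and the factor \<open>profile_const d \<xi> / profile_const d \<rho>\<close>
  removes the profile integrals. The lower bound for \<open>\<xi>\<close> serves later
  divisions.\<close>

lemma approx_mean_curvature_blowup:
  fixes \<Omega> :: "'a::euclidean_space set"
  assumes \<Omega>: "open \<Omega>" and d: "1 \<le> d" and rect: "rectifiable_varifold d \<Omega> M \<theta> V" and x: "x \<in> \<Omega>"
    and P: "approx_tangent_space d M \<theta> x P" and \<theta>: "0 < \<theta> x"
    and \<rho>: "kernel_profile TYPE('a) \<rho>" "continuous_on UNIV \<rho>"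
    and \<xi>: "kernel_profile TYPE('a) \<xi>" "continuous_on UNIV \<xi>"
    and fv: "((\<lambda>\<epsilon>. (\<epsilon> ^ DIM('a) / \<epsilon> ^ d) *\<^sub>R (first_variation_conv V \<rho> \<epsilon> x + mass_conv \<Omega> V \<rho> \<epsilon> x *\<^sub>R h)) \<longlongrightarrow> 0) (at_right 0)"
  shows "((\<lambda>\<epsilon>. approx_mean_curvature d \<Omega> V \<rho> \<xi> \<epsilon> x) \<longlongrightarrow> h) (at_right 0)"
    and "\<exists>a>0. \<forall>\<^sub>F \<epsilon> in at_right 0. a \<le> \<epsilon> ^ DIM('a) / \<epsilon> ^ d * mass_conv \<Omega> V \<xi> \<epsilon> x"
proof -
  let ?n = "DIM('a)"
  define \<kappa> where "\<kappa> = enn2real (hausdorff_outer d (P \<inter> ball 0 1))"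
  define I where "I f = integral {0..1} (\<lambda>r. f r * r ^ (d - 1))" for f :: "real \<Rightarrow> real"
  have P': "subspace P" "dim P = d" using P by (auto simp: approx_tangent_space_def)
  have \<kappa>: "0 < \<kappa>"
    using hausdorff_subspace_ball[OF d P'] by (simp add: \<kappa>_def enn2real_positive_iff)
  have I: "0 < I \<rho>" "0 < I \<xi>"
    using kernel_radial_integral_pos[OF d \<rho>] kernel_radial_integral_pos[OF d \<xi>] by (simp_all add: I_def)
  have zero: "\<rho> t = 0" "\<xi> t = 0" if "1 < \<bar>t\<bar>" for t using that \<rho> \<xi> by (auto simp: kernel_profile_def)
  define A where "A f = \<theta> x * (\<kappa> * real d * I f)" for f
  have A: "0 < A \<rho>" "0 < A \<xi>" using \<theta> \<kappa> I d by (simp_all add: A_def)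
  have lim: "((\<lambda>\<epsilon>. \<epsilon> ^ ?n / \<epsilon> ^ d * mass_conv \<Omega> V f \<epsilon> x) \<longlongrightarrow> A f) (at_right 0)"
    if "continuous_on UNIV f" "\<And>t. 1 < \<bar>t\<bar> \<Longrightarrow> f t = 0" for f
    using mass_conv_blowup[OF \<Omega> rect x P that] hausdorff_radial_integral[OF d P' that]
    by (simp add: A_def I_def \<kappa>_def)
  let ?c = "profile_const d \<xi> / profile_const d \<rho>"
  have l\<rho>: "((\<lambda>\<epsilon>. \<epsilon> ^ ?n / \<epsilon> ^ d * mass_conv \<Omega> V \<rho> \<epsilon> x) \<longlongrightarrow> A \<rho>) (at_right 0)"
    by (rule lim[OF \<rho>(2) zero(1)])
  have l\<xi>: "((\<lambda>\<epsilon>. \<epsilon> ^ ?n / \<epsilon> ^ d * mass_conv \<Omega> V \<xi> \<epsilon> x) \<longlongrightarrow> A \<xi>) (at_right 0)"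
    by (rule lim[OF \<xi>(2) zero(2)])
  let ?s = "\<lambda>\<epsilon>. \<epsilon> ^ ?n / \<epsilon> ^ d"
  have "((\<lambda>\<epsilon>. ?s \<epsilon> *\<^sub>R (first_variation_conv V \<rho> \<epsilon> x + mass_conv \<Omega> V \<rho> \<epsilon> x *\<^sub>R h)
      - (?s \<epsilon> * mass_conv \<Omega> V \<rho> \<epsilon> x) *\<^sub>R h) \<longlongrightarrow> 0 - A \<rho> *\<^sub>R h) (at_right 0)"
    by (intro tendsto_diff fv tendsto_scaleR l\<rho> tendsto_const)
  then have l1: "((\<lambda>\<epsilon>. ?s \<epsilon> *\<^sub>R first_variation_conv V \<rho> \<epsilon> x) \<longlongrightarrow> - (A \<rho> *\<^sub>R h)) (at_right 0)"
    by (simp add: scaleR_add_right)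
  have "((\<lambda>\<epsilon>. - ((?c) *\<^sub>R ((?s \<epsilon> *\<^sub>R first_variation_conv V \<rho> \<epsilon> x) /\<^sub>R (?s \<epsilon> * mass_conv \<Omega> V \<xi> \<epsilon> x))))
      \<longlongrightarrow> - ((?c) *\<^sub>R (- (A \<rho> *\<^sub>R h) /\<^sub>R A \<xi>))) (at_right 0)"
    using A by (intro tendsto_minus tendsto_scaleR tendsto_const tendsto_inverse l1 l\<xi>) auto
  also have "- ((?c) *\<^sub>R (- (A \<rho> *\<^sub>R h) /\<^sub>R A \<xi>)) = h"
  proof -
    have u: "unit_ball_vol (real d) \<noteq> 0" by (metis of_nat_0_le_iff less_irrefl unit_ball_vol_pos)
    have "?c * A \<rho> / A \<xi> = 1"
    proof -
      have "profile_const d f = real d * unit_ball_vol (real d) * I f" for f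
        by (simp only: profile_const_def I_def)
      then show ?thesis using u I \<kappa> \<theta> d by (simp add: A_def)
    qed
    then show ?thesis by (simp add: divide_inverse mult.commute mult.left_commute)
  qed
  finally show "((\<lambda>\<epsilon>. approx_mean_curvature d \<Omega> V \<rho> \<xi> \<epsilon> x) \<longlongrightarrow> h) (at_right 0)"
  proof (rule Lim_transform_eventually)
    show "\<forall>\<^sub>F \<epsilon> in at_right 0. - ((?c) *\<^sub>R ((?s \<epsilon> *\<^sub>R first_variation_conv V \<rho> \<epsilon> x) /\<^sub>R (?s \<epsilon> * mass_conv \<Omega> V \<xi> \<epsilon> x)))
        = approx_mean_curvature d \<Omega> V \<rho> \<xi> \<epsilon> x"
      unfolding eventually_at_right_field
    proof (intro exI[of _ 1] conjI allI impI)
      fix \<epsilon> :: real assume "0 < \<epsilon>"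
      then have "?s \<epsilon> \<noteq> 0" by simp
      \<comment> \<open>The scale factor cancels even for \<open>m = 0\<close>, where both sides are
        zero.\<close>
      moreover have "(s *\<^sub>R v) /\<^sub>R (s * m) = v /\<^sub>R m" if "s \<noteq> 0" for s m :: real and v :: 'a
        using that by (cases "m = 0") simp_all
      ultimately show "- ((?c) *\<^sub>R ((?s \<epsilon> *\<^sub>R first_variation_conv V \<rho> \<epsilon> x) /\<^sub>R (?s \<epsilon> * mass_conv \<Omega> V \<xi> \<epsilon> x)))
        = approx_mean_curvature d \<Omega> V \<rho> \<xi> \<epsilon> x"
        unfolding approx_mean_curvature_def by metis
    qed simp
  qed
  have "\<forall>\<^sub>F \<epsilon> in at_right 0. A \<xi> / 2 < ?s \<epsilon> * mass_conv \<Omega> V \<xi> \<epsilon> x"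
    using A(2) by (intro order_tendstoD(1)[OF l\<xi>]) simp
  then have "\<forall>\<^sub>F \<epsilon> in at_right 0. A \<xi> / 2 \<le> ?s \<epsilon> * mass_conv \<Omega> V \<xi> \<epsilon> x"
    by eventually_elim simp
  then show "\<exists>a>0. \<forall>\<^sub>F \<epsilon> in at_right 0. a \<le> ?s \<epsilon> * mass_conv \<Omega> V \<xi> \<epsilon> x"
    using A by (intro exI[of _ "A \<xi> / 2"]) simp
qed

text \<open>Division by \<open>L\<close> makes the function admissible. Compact support gives
  integrability against both varifolds and keeps the closure of the support over
  \<open>U\<close>.\<close>

lemma bounded_lipschitz_dist_test:
  fixes \<phi> :: "'a::euclidean_space \<times> ('a \<Rightarrow>\<^sub>L 'a) \<Rightarrow> real"
  assumes V: "varifold d \<Omega> V" and W: "varifold d \<Omega> W"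
    and L: "0 < L" and D: "0 \<le> D" and bl: "bounded_lipschitz_dist d \<Omega> U V W \<le> ennreal D"
    and cont: "continuous_on (\<Omega> \<times> grassmannian d) \<phi>"
    and lip: "\<And>x y S T. S \<in> grassmannian d \<Longrightarrow> T \<in> grassmannian d \<Longrightarrow>
      \<bar>\<phi> (x, S) - \<phi> (y, T)\<bar> \<le> L * (dist x y + dist S T)"
    and bd: "\<And>x S. S \<in> grassmannian d \<Longrightarrow> \<bar>\<phi> (x, S)\<bar> \<le> L"
    and K: "compact K" "K \<subseteq> \<Omega>" "K \<subseteq> U" and z: "\<And>y S. y \<notin> K \<Longrightarrow> \<phi> (y, S) = 0"
  shows "\<bar>(\<integral>p. \<phi> p \<partial>V) - (\<integral>p. \<phi> p \<partial>W)\<bar> \<le> L * D"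
proof -
  have int: "integrable V \<phi>" "integrable W \<phi>"
    by (rule integrable_varifold[OF _ cont K(1,2) z], rule V W, assumption)+
  let ?\<psi> = "\<lambda>p. \<phi> p / L"
  have "ennreal \<bar>(\<integral>p. ?\<psi> p \<partial>V) - (\<integral>p. ?\<psi> p \<partial>W)\<bar> \<le> bounded_lipschitz_dist d \<Omega> U V W"
    unfolding bounded_lipschitz_dist_def
  proof (rule SUP_upper, unfold mem_Collect_eq, intro conjI)
    show "\<forall>x\<in>\<Omega>. \<forall>y\<in>\<Omega>. \<forall>S\<in>grassmannian d. \<forall>T\<in>grassmannian d.
        \<bar>\<phi> (x, S) / L - \<phi> (y, T) / L\<bar> \<le> dist x y + dist S T"
    proof (intro ballI)
      fix x y :: 'a and S T :: "'a \<Rightarrow>\<^sub>L 'a" assume "S \<in> grassmannian d" "T \<in> grassmannian d"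
      then have "\<bar>\<phi> (x, S) - \<phi> (y, T)\<bar> / L \<le> dist x y + dist S T"
        using lip L by (simp add: divide_le_eq mult.commute)
      then show "\<bar>\<phi> (x, S) / L - \<phi> (y, T) / L\<bar> \<le> dist x y + dist S T"
        using L by (simp add: diff_divide_distrib[symmetric])
    qed
    show "\<forall>p\<in>\<Omega> \<times> grassmannian d. \<bar>\<phi> p / L\<bar> \<le> 1"
      using bd L by auto
    have "{p \<in> \<Omega> \<times> grassmannian d. \<phi> p / L \<noteq> 0} \<subseteq> K \<times> UNIV"
    proof
      fix p assume "p \<in> {p \<in> \<Omega> \<times> grassmannian d. \<phi> p / L \<noteq> 0}"
      then show "p \<in> K \<times> UNIV" using z[of "fst p" "snd p"] by (cases p) auto
    qed
    then have "closure {p \<in> \<Omega> \<times> grassmannian d. \<phi> p / L \<noteq> 0} \<subseteq> K \<times> UNIV"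
      by (rule closure_minimal) (intro closed_Times compact_imp_closed K closed_UNIV)
    then show "closure {p \<in> \<Omega> \<times> grassmannian d. \<phi> p / L \<noteq> 0} \<inter> \<Omega> \<times> grassmannian d \<subseteq> U \<times> grassmannian d"
      using K(3) by auto
    show "integrable V ?\<psi>" "integrable W ?\<psi>" using int by (simp_all add: integrable_divide_zero)
  qed
  also note bl
  finally have "\<bar>(\<integral>p. ?\<psi> p \<partial>V) - (\<integral>p. ?\<psi> p \<partial>W)\<bar> \<le> D" using D by (simp only: ennreal_le_iff)
  then have "\<bar>(\<integral>p. \<phi> p \<partial>V) - (\<integral>p. \<phi> p \<partial>W)\<bar> / L \<le> D"
    using L by (simp add: diff_divide_distrib[symmetric])
  then show ?thesis using L by (simp add: divide_le_eq mult.commute)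
qed

lemma norm_integral_varifold_le:
  fixes g :: "'a::euclidean_space \<times> ('a \<Rightarrow>\<^sub>L 'a) \<Rightarrow> 'b::{banach, second_countable_topology}"
  assumes \<Omega>: "open \<Omega>" and V: "varifold d \<Omega> V" and B: "B \<in> sets borel" "B \<subseteq> \<Omega>" and c: "0 \<le> c" and m: "0 \<le> m"
    and mass: "emeasure (mass \<Omega> V) B \<le> ennreal m"
    and g: "\<And>y S. S \<in> grassmannian d \<Longrightarrow> norm (g (y, S)) \<le> c" and z: "\<And>y S. y \<notin> B \<Longrightarrow> g (y, S) = 0"
  shows "norm (\<integral>p. g p \<partial>V) \<le> c * m"
proof -
  have Bs: "B \<in> sets (restrict_space borel \<Omega>)" using \<Omega> B by (simp add: sets_restrict_space_iff)
  have eq: "B \<times> grassmannian d = fst -` B \<inter> space V" using B(2) by (auto simp: space_varifold[OF V])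
  have s: "B \<times> grassmannian d \<in> sets V"
    unfolding eq by (rule measurable_sets[OF measurable_fst_varifold[OF V] Bs])
  have "ennreal (norm (\<integral>p. g p \<partial>V)) \<le> (\<integral>\<^sup>+p. ennreal (norm (g p)) \<partial>V)"
    by (rule norm_integral_le_nn_integral)
  also have "\<dots> \<le> (\<integral>\<^sup>+p. ennreal c * indicator (B \<times> grassmannian d) p \<partial>V)"
  proof (rule nn_integral_mono)
    fix p assume p: "p \<in> space V"
    then obtain y S where [simp]: "p = (y, S)" and S: "S \<in> grassmannian d" by (auto simp: space_varifold[OF V])
    show "ennreal (norm (g p)) \<le> ennreal c * indicator (B \<times> grassmannian d) p"
      using g[OF S, of y] z[of y S] S by (cases "y \<in> B") (auto intro: ennreal_leI)
  qed
  also have "\<dots> = ennreal c * emeasure V (B \<times> grassmannian d)" by (rule nn_integral_cmult_indicator[OF s])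
  also have "\<dots> = ennreal c * emeasure (mass \<Omega> V) B" by (simp add: emeasure_mass[OF V Bs])
  also have "\<dots> \<le> ennreal c * ennreal m" by (intro mult_left_mono mass) simp
  also have "\<dots> = ennreal (c * m)" using c by (rule ennreal_mult'[symmetric])
  finally show ?thesis using c m by (simp add: ennreal_le_iff)
qed

lemma norm_blinfun_grassmannian_le:
  "S \<in> grassmannian d \<Longrightarrow> norm (blinfun_apply S v) \<le> norm v"
  using norm_blinfun[of S v] mult_right_mono[OF norm_grassmannian_le[of S d], of "norm v"] by simp

text \<open>The varifold is changed first, with the kernel centred at \<open>z\<close>; the centre
  is moved afterwards under \<open>V\<close>. The distance tests scalar functions, so the first
  change is made coordinatewise and costs the dimension.\<close>

lemma (in c11_profile) first_variation_conv_diff: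
  fixes \<Omega> :: "'a::euclidean_space set"
  assumes \<Omega>: "open \<Omega>" and V: "varifold d \<Omega> V" and W: "varifold d \<Omega> W" and N: "0 < N"
    and \<epsilon>: "0 < \<epsilon>" "\<epsilon> \<le> 1" and xz: "norm (x - z) < \<epsilon>" and sub: "ball x (2 * \<epsilon>) \<subseteq> \<Omega>"
    and bl: "bounded_lipschitz_dist d \<Omega> (ball x (2 * \<epsilon>)) V W \<le> ennreal D" and D: "0 \<le> D"
    and mass: "emeasure (mass \<Omega> V) (ball x (2 * \<epsilon>)) \<le> ennreal m" and m: "0 \<le> m"
  shows "norm (first_variation_conv W \<rho> \<epsilon> z - first_variation_conv V \<rho> \<epsilon> x)
      \<le> real DIM('a) * (3 * N / \<epsilon> ^ (DIM('a) + 2)) * (D + norm (x - z) * m)"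
    and "norm (first_variation_conv V \<rho> \<epsilon> x) \<le> N / \<epsilon> ^ Suc DIM('a) * m"
proof -
  let ?n = "DIM('a)"
  define L where "L = 3 * N / \<epsilon> ^ (?n + 2)"
  have L: "0 < L" using N \<epsilon> by (simp add: L_def)
  \<comment> \<open>For \<open>\<epsilon> \<le> 1\<close> the Lipschitz constant of the gradient
    dominates its sup bound, so one \<open>L\<close> serves for both.\<close>
  have NL: "N / \<epsilon> ^ Suc ?n \<le> L"
  proof -
    have "\<epsilon> ^ (?n + 2) \<le> \<epsilon> ^ Suc ?n" using \<epsilon> by (intro power_decreasing) auto
    then have "N / \<epsilon> ^ Suc ?n \<le> N / \<epsilon> ^ (?n + 2)" using N \<epsilon> by (intro divide_left_mono) auto
    also have "\<dots> \<le> L" using N \<epsilon> by (simp add: L_def divide_right_mono)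
    finally show ?thesis .
  qed
  let ?FW = "first_variation_conv W \<rho> \<epsilon> z" and ?FVz = "first_variation_conv V \<rho> \<epsilon> z"
    and ?FV = "first_variation_conv V \<rho> \<epsilon> x" and ?k = "\<lambda>y. kgrad \<epsilon> (y - z)"
  \<comment> \<open>As \<open>z\<close> is closer to \<open>x\<close> than
    \<open>\<epsilon>\<close>, one ball of radius \<open>2 * \<epsilon>\<close> around
    \<open>x\<close> holds both kernel supports.\<close>
  have zsub: "cball z \<epsilon> \<subseteq> ball x (2 * \<epsilon>)" and xsub: "cball x \<epsilon> \<subseteq> ball x (2 * \<epsilon>)"
  proof
    fix y assume "y \<in> cball z \<epsilon>"
    then show "y \<in> ball x (2 * \<epsilon>)" using dist_triangle[of x y z] xz by (simp add: dist_norm)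
  qed (use \<epsilon> in auto)
  have fvW: "first_variation_conv U \<rho> \<epsilon> u = (\<integral>p. blinfun_apply (snd p) (kgrad \<epsilon> (fst p - u)) \<partial>U)" for U u
    by (simp add: first_variation_conv_def gradient_scaled_kernel[OF \<epsilon>(1)])
  have zz: "?k y = 0" if "y \<notin> cball z \<epsilon>" for y
    using that by (intro kgrad_zero[OF \<epsilon>(1)]) (simp add: dist_norm norm_minus_commute)
  have zx: "kgrad \<epsilon> (y - x) = 0" if "y \<notin> cball x \<epsilon>" for y
    using that by (intro kgrad_zero[OF \<epsilon>(1)]) (simp add: dist_norm norm_minus_commute)
  have klip: "norm (kgrad \<epsilon> u - kgrad \<epsilon> v) \<le> L * norm (u - v)" for u v :: 'a
    unfolding L_def by (rule kgrad_lipschitz[OF \<epsilon>(1)])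
  have kb: "norm (kgrad \<epsilon> u) \<le> N / \<epsilon> ^ Suc ?n" for u :: 'a by (rule norm_kgrad_le[OF \<epsilon>(1)])
  have kbL: "norm (kgrad \<epsilon> u) \<le> L" for u :: 'a using kb NL order_trans by blast
  have intV: "integrable V (\<lambda>p. blinfun_apply (snd p) (kgrad \<epsilon> (fst p - u)))"
    and intW: "integrable W (\<lambda>p. blinfun_apply (snd p) (kgrad \<epsilon> (fst p - u)))" if "u \<in> {x, z}" for u
    using that sub zsub xsub by (intro integrable_kgrad_test[OF V \<epsilon>(1)] integrable_kgrad_test[OF W \<epsilon>(1)]; blast)+
  have part1: "\<bar>(?FW - ?FVz) \<bullet> b\<bar> \<le> L * D" if b: "b \<in> Basis" for b
  proof -
    let ?\<phi> = "\<lambda>p. blinfun_apply (snd p) (kgrad \<epsilon> (fst p - z)) \<bullet> b"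
    have "\<bar>(\<integral>p. ?\<phi> p \<partial>V) - (\<integral>p. ?\<phi> p \<partial>W)\<bar> \<le> L * D"
    proof (rule bounded_lipschitz_dist_test[OF V W L D bl])
      show "continuous_on (\<Omega> \<times> grassmannian d) ?\<phi>"
        by (intro continuous_on_inner continuous_kgrad_test[OF \<epsilon>(1)] continuous_on_const)
      fix y y' :: 'a and S T :: "'a \<Rightarrow>\<^sub>L 'a" assume S: "S \<in> grassmannian d"
      have "\<bar>blinfun_apply S (?k y) \<bullet> b\<bar> \<le> norm (blinfun_apply S (?k y))"
        by (rule Basis_le_norm[OF b])
      also have "\<dots> \<le> L" using norm_blinfun_grassmannian_le[OF S] kbL order_trans by blast
      finally show "\<bar>blinfun_apply (snd (y, S)) (kgrad \<epsilon> (fst (y, S) - z)) \<bullet> b\<bar> \<le> L" by simp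
      \<comment> \<open>Product rule: the kernel varies under the projection \<open>S\<close>, of
        norm at most 1, and the projection varies against the bounded kernel.\<close>
      have "blinfun_apply S (?k y) - blinfun_apply T (?k y')
          = blinfun_apply S (?k y - ?k y') + blinfun_apply (S - T) (?k y')"
        by (simp add: blinfun.diff_left blinfun.diff_right)
      then have "norm (blinfun_apply S (?k y) - blinfun_apply T (?k y'))
          \<le> norm (blinfun_apply S (?k y - ?k y')) + norm (blinfun_apply (S - T) (?k y'))"
        by (simp add: norm_triangle_ineq)
      also have "\<dots> \<le> L * dist y y' + L * dist S T"
      proof (rule add_mono)
        have "norm (blinfun_apply S (?k y - ?k y')) \<le> norm (?k y - ?k y')"
          by (rule norm_blinfun_grassmannian_le[OF S])
        also have "\<dots> \<le> L * norm ((y - z) - (y' - z))" by (rule klip)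
        finally show "norm (blinfun_apply S (?k y - ?k y')) \<le> L * dist y y'"
          by (simp add: dist_norm)
        have "norm (blinfun_apply (S - T) (?k y')) \<le> norm (S - T) * norm (?k y')"
          by (rule norm_blinfun)
        also have "\<dots> \<le> norm (S - T) * L" by (intro mult_left_mono kbL) simp
        finally show "norm (blinfun_apply (S - T) (?k y')) \<le> L * dist S T"
          by (simp add: dist_norm mult.commute)
      qed
      finally have "norm (blinfun_apply S (?k y) - blinfun_apply T (?k y')) \<le> L * (dist y y' + dist S T)"
        by (simp add: distrib_left)
      moreover have "\<bar>(blinfun_apply S (?k y) - blinfun_apply T (?k y')) \<bullet> b\<bar>
          \<le> norm (blinfun_apply S (?k y) - blinfun_apply T (?k y'))"
        by (rule Basis_le_norm[OF b])
      ultimately show "\<bar>blinfun_apply (snd (y, S)) (kgrad \<epsilon> (fst (y, S) - z)) \<bullet> b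
          - blinfun_apply (snd (y', T)) (kgrad \<epsilon> (fst (y', T) - z)) \<bullet> b\<bar> \<le> L * (dist y y' + dist S T)"
        by (simp add: inner_diff_left)
    next
      show "cball z \<epsilon> \<subseteq> \<Omega>" using zsub sub by blast
      show "blinfun_apply (snd (y, S)) (kgrad \<epsilon> (fst (y, S) - z)) \<bullet> b = 0" if "y \<notin> cball z \<epsilon>" for y and S :: "'a \<Rightarrow>\<^sub>L 'a"
        by (simp add: zz[OF that])
    qed (use zsub in auto)
    moreover have "?FW \<bullet> b = (\<integral>p. ?\<phi> p \<partial>W)" "?FVz \<bullet> b = (\<integral>p. ?\<phi> p \<partial>V)"
      unfolding fvW using intW[of z] intV[of z] by simp_all
    ultimately show ?thesis by (simp add: inner_diff_left abs_minus_commute)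
  qed
  have part2: "norm (?FVz - ?FV) \<le> L * norm (x - z) * m"
  proof -
    have "?FVz - ?FV
        = (\<integral>p. blinfun_apply (snd p) (kgrad \<epsilon> (fst p - z)) - blinfun_apply (snd p) (kgrad \<epsilon> (fst p - x)) \<partial>V)"
      unfolding fvW using intV by (subst Bochner_Integration.integral_diff) auto
    also have "norm \<dots> \<le> L * norm (x - z) * m"
    proof (rule norm_integral_varifold_le[OF \<Omega> V _ sub _ m mass])
      fix y and S :: "'a \<Rightarrow>\<^sub>L 'a"
      show "norm (blinfun_apply (snd (y, S)) (kgrad \<epsilon> (fst (y, S) - z)) - blinfun_apply (snd (y, S)) (kgrad \<epsilon> (fst (y, S) - x))) \<le> L * norm (x - z)"
        if S: "S \<in> grassmannian d"
      proof -
        have "norm (blinfun_apply S (?k y - kgrad \<epsilon> (y - x))) \<le> norm (?k y - kgrad \<epsilon> (y - x))"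
          by (rule norm_blinfun_grassmannian_le[OF S])
        also have "\<dots> \<le> L * norm ((y - z) - (y - x))" by (rule klip)
        finally show ?thesis by (simp add: blinfun.diff_right)
      qed
      show "blinfun_apply (snd (y, S)) (kgrad \<epsilon> (fst (y, S) - z)) - blinfun_apply (snd (y, S)) (kgrad \<epsilon> (fst (y, S) - x)) = 0"
        if "y \<notin> ball x (2 * \<epsilon>)"
      proof -
        have "y \<notin> cball z \<epsilon>" "y \<notin> cball x \<epsilon>" using that zsub xsub by blast+
        then show ?thesis by (simp add: zz zx)
      qed
    qed (use L in auto)
    finally show ?thesis .
  qed
  have "norm (?FW - ?FVz)
      \<le> (\<Sum>b\<in>Basis. \<bar>(?FW - ?FVz) \<bullet> b\<bar>)"
    by (rule norm_le_l1)
  also have "\<dots> \<le> (\<Sum>b\<in>(Basis :: 'a set). L * D)" by (rule sum_mono) (rule part1)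
  finally have p1: "norm (?FW - ?FVz) \<le> real ?n * (L * D)" by simp
  \<comment> \<open>The dimension is at least 1, so both contributions can be put under the same
    factor.\<close>
  have "1 * (L * norm (x - z) * m) \<le> real ?n * (L * norm (x - z) * m)"
    using L m by (intro mult_right_mono) (auto simp: DIM_ge_Suc0 Suc_leI)
  then have p2: "norm (?FVz - ?FV) \<le> real ?n * (L * norm (x - z) * m)"
    using part2 by simp
  have "norm (?FW - ?FV)
      \<le> norm (?FW - ?FVz)
        + norm (?FVz - ?FV)"
    using norm_triangle_ineq[of "?FW - ?FVz"
        "?FVz - ?FV"] by simp
  also have "\<dots> \<le> real ?n * (L * D) + real ?n * (L * norm (x - z) * m)" using p1 p2 by (rule add_mono)
  also have "\<dots> = real ?n * L * (D + norm (x - z) * m)" by (simp add: distrib_left mult.assoc)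
  finally show "norm (?FW - ?FV)
      \<le> real ?n * (3 * N / \<epsilon> ^ (?n + 2)) * (D + norm (x - z) * m)"
    unfolding L_def .
  show "norm (?FV) \<le> N / \<epsilon> ^ Suc ?n * m"
    unfolding fvW
  proof (rule norm_integral_varifold_le[OF \<Omega> V _ sub _ m mass])
    fix y and S :: "'a \<Rightarrow>\<^sub>L 'a"
    show "norm (blinfun_apply (snd (y, S)) (kgrad \<epsilon> (fst (y, S) - x))) \<le> N / \<epsilon> ^ Suc ?n" if "S \<in> grassmannian d"
      using order_trans[OF norm_blinfun_grassmannian_le[OF that] kb] by simp
    show "blinfun_apply (snd (y, S)) (kgrad \<epsilon> (fst (y, S) - x)) = 0" if "y \<notin> ball x (2 * \<epsilon>)"
    proof -
      have "y \<notin> cball x \<epsilon>" using that xsub by blast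
      then show ?thesis by (simp add: zx)
    qed
  qed (use N \<epsilon> in auto)
qed

text \<open>The same two moves as for the first variation. The kernel itself enters instead of its
  gradient, which saves one power of \<open>\<epsilon>\<close>, and being scalar it is tested
  directly.\<close>

lemma mass_conv_diff:
  fixes \<Omega> :: "'a::euclidean_space set" and \<xi> :: "real \<Rightarrow> real"
  assumes \<Omega>: "open \<Omega>" and V: "varifold d \<Omega> V" and W: "varifold d \<Omega> W"
    and cont: "continuous_on UNIV \<xi>" and zero: "\<And>t. 1 < \<bar>t\<bar> \<Longrightarrow> \<xi> t = 0"
    and Q: "0 < Q" and lip: "\<And>s t. \<bar>\<xi> s - \<xi> t\<bar> \<le> Q * \<bar>s - t\<bar>" and bd: "\<And>t. \<bar>\<xi> t\<bar> \<le> Q"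
    and \<epsilon>: "0 < \<epsilon>" "\<epsilon> \<le> 1" and xz: "norm (x - z) < \<epsilon>" and sub: "ball x (2 * \<epsilon>) \<subseteq> \<Omega>"
    and bl: "bounded_lipschitz_dist d \<Omega> (ball x (2 * \<epsilon>)) V W \<le> ennreal D" and D: "0 \<le> D"
    and mass: "emeasure (mass \<Omega> V) (ball x (2 * \<epsilon>)) \<le> ennreal m" and m: "0 \<le> m"
  shows "\<bar>mass_conv \<Omega> W \<xi> \<epsilon> z - mass_conv \<Omega> V \<xi> \<epsilon> x\<bar> \<le> Q / \<epsilon> ^ Suc DIM('a) * (D + norm (x - z) * m)"
proof -
  let ?n = "DIM('a)"
  define L where "L = Q / \<epsilon> ^ Suc ?n"
  have L: "0 < L" using Q \<epsilon> by (simp add: L_def)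
  have QL: "Q / \<epsilon> ^ ?n \<le> L"
  proof -
    have "\<epsilon> ^ Suc ?n \<le> \<epsilon> ^ ?n" using \<epsilon> by (intro power_decreasing) auto
    then show ?thesis unfolding L_def using Q \<epsilon> by (intro divide_left_mono) auto
  qed
  have zsub: "cball z \<epsilon> \<subseteq> ball x (2 * \<epsilon>)" and xsub: "cball x \<epsilon> \<subseteq> ball x (2 * \<epsilon>)"
  proof
    fix y assume "y \<in> cball z \<epsilon>"
    then show "y \<in> ball x (2 * \<epsilon>)" using dist_triangle[of x y z] xz by (simp add: dist_norm)
  qed (use \<epsilon> in auto)
  let ?k = "scaled_kernel \<xi> \<epsilon>"
  have kc: "continuous_on A (\<lambda>y. ?k (y - u))" for A and u :: 'a
    by (rule continuous_on_subset[OF continuous_scaled_kernel[OF cont \<epsilon>(1)]]) simp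
  have kcp: "continuous_on A (\<lambda>p. ?k (fst p - u))" for A :: "('a \<times> ('a \<Rightarrow>\<^sub>L 'a)) set" and u :: 'a
    by (rule continuous_on_compose2[OF kc[of UNIV u]]) (auto intro!: continuous_intros)
  have klip: "\<bar>?k u - ?k v\<bar> \<le> L * norm (u - v)" for u v :: 'a
  proof -
    have "\<bar>\<xi> (norm u / \<epsilon>) - \<xi> (norm v / \<epsilon>)\<bar> \<le> Q * \<bar>norm u / \<epsilon> - norm v / \<epsilon>\<bar>" by (rule lip)
    also have "\<dots> = Q * (\<bar>norm u - norm v\<bar> / \<epsilon>)"
      using \<epsilon> by (simp add: diff_divide_distrib[symmetric])
    also have "\<dots> \<le> Q * (norm (u - v) / \<epsilon>)"
      using \<epsilon> Q by (intro mult_left_mono divide_right_mono norm_triangle_ineq3) auto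
    finally have "\<bar>\<xi> (norm u / \<epsilon>) - \<xi> (norm v / \<epsilon>)\<bar> / \<epsilon> ^ ?n \<le> Q * (norm (u - v) / \<epsilon>) / \<epsilon> ^ ?n"
      using \<epsilon> by (intro divide_right_mono) auto
    moreover have "\<bar>?k u - ?k v\<bar> = \<bar>\<xi> (norm u / \<epsilon>) - \<xi> (norm v / \<epsilon>)\<bar> / \<epsilon> ^ ?n"
      using \<epsilon> by (simp add: scaled_kernel_eq diff_divide_distrib[symmetric])
    ultimately show ?thesis by (simp add: L_def)
  qed
  have kb: "\<bar>?k u\<bar> \<le> L" for u :: 'a
  proof -
    have "\<bar>?k u\<bar> \<le> Q / \<epsilon> ^ ?n" using bd \<epsilon> by (simp add: scaled_kernel_eq divide_right_mono)
    then show ?thesis using QL by linarith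
  qed
  have kz: "?k (y - u) = 0" if "y \<notin> cball u \<epsilon>" for y u :: 'a
    using that by (intro scaled_kernel_zero[OF zero \<epsilon>(1)]) (auto simp: dist_norm norm_minus_commute)
  have conv: "mass_conv \<Omega> U \<xi> \<epsilon> u = (\<integral>p. ?k (fst p - u) \<partial>U)" if "varifold d \<Omega> U" for U and u :: 'a
    unfolding mass_conv_def by (rule integral_mass[OF that borel_measurable_continuous_on_restrict[OF kc]])
  have p1: "\<bar>(\<integral>p. ?k (fst p - z) \<partial>V) - (\<integral>p. ?k (fst p - z) \<partial>W)\<bar> \<le> L * D"
  proof (rule bounded_lipschitz_dist_test[OF V W L D bl kcp])
    fix y y' :: 'a and S T :: "'a \<Rightarrow>\<^sub>L 'a"
    show "\<bar>?k (fst (y, S) - z)\<bar> \<le> L" by (rule kb)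
    have "\<bar>?k (y - z) - ?k (y' - z)\<bar> \<le> L * norm ((y - z) - (y' - z))" by (rule klip)
    also have "\<dots> \<le> L * (dist y y' + dist S T)" using L by (intro mult_left_mono) (auto simp: dist_norm)
    finally show "\<bar>?k (fst (y, S) - z) - ?k (fst (y', T) - z)\<bar> \<le> L * (dist y y' + dist S T)" by simp
  next
    show "cball z \<epsilon> \<subseteq> \<Omega>" using zsub sub by blast
    show "?k (fst (y, S) - z) = 0" if "y \<notin> cball z \<epsilon>" for y and S :: "'a \<Rightarrow>\<^sub>L 'a"
      using kz[OF that] by simp
  qed (use zsub in auto)
  have "norm (\<integral>p. ?k (fst p - z) - ?k (fst p - x) \<partial>V) \<le> L * norm (x - z) * m"
  proof (rule norm_integral_varifold_le[OF \<Omega> V _ sub _ m mass])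
    fix y and S :: "'a \<Rightarrow>\<^sub>L 'a"
    show "norm (?k (fst (y, S) - z) - ?k (fst (y, S) - x)) \<le> L * norm (x - z)"
      using klip[of "y - z" "y - x"] by simp
    show "?k (fst (y, S) - z) - ?k (fst (y, S) - x) = 0" if "y \<notin> ball x (2 * \<epsilon>)"
    proof -
      have "y \<notin> cball z \<epsilon>" "y \<notin> cball x \<epsilon>" using that zsub xsub by blast+
      then show ?thesis by (simp add: kz)
    qed
  qed (use L in auto)
  moreover have "(\<integral>p. ?k (fst p - z) - ?k (fst p - x) \<partial>V) = (\<integral>p. ?k (fst p - z) \<partial>V) - (\<integral>p. ?k (fst p - x) \<partial>V)"
  proof (rule Bochner_Integration.integral_diff)
    show "integrable V (\<lambda>p. ?k (fst p - z))"
      by (rule integrable_varifold[OF V kcp compact_cball[of z \<epsilon>]]) (use zsub sub kz in auto)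
    show "integrable V (\<lambda>p. ?k (fst p - x))"
      by (rule integrable_varifold[OF V kcp compact_cball[of x \<epsilon>]]) (use xsub sub kz in auto)
  qed
  ultimately have "\<bar>(\<integral>p. ?k (fst p - z) \<partial>V) - (\<integral>p. ?k (fst p - x) \<partial>V)\<bar> \<le> L * norm (x - z) * m" by simp
  then have "\<bar>mass_conv \<Omega> W \<xi> \<epsilon> z - mass_conv \<Omega> V \<xi> \<epsilon> x\<bar> \<le> L * D + L * norm (x - z) * m"
    using p1 by (simp add: conv[OF V] conv[OF W])
  also have "\<dots> = L * (D + norm (x - z) * m)" by (simp add: distrib_left mult.assoc)
  finally show ?thesis unfolding L_def .
qed

text \<open>\<open>u\<close> stands for \<open>\<epsilon> ^ d / \<epsilon> ^ n\<close>, the size of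
  the denominators. Smallness keeps \<open>m'\<close> above half the lower bound of
  \<open>m\<close>. The numerator error over \<open>m'\<close> gives the term with \<open>p\<close>,
  and the denominator error times \<open>F\<close> over \<open>m * m'\<close> the term with
  \<open>q * r\<close>.\<close>

lemma quotient_diff_bound:
  fixes F F' :: "'a::real_normed_vector" and m m' :: real
  assumes u: "0 < u" and \<epsilon>: "0 < \<epsilon>" and a: "0 < a" and \<delta>: "0 \<le> \<delta>" and pqr: "0 \<le> p" "0 \<le> q" "0 \<le> r"
    and F: "norm (F' - F) \<le> p * u * \<delta> / \<epsilon>\<^sup>2" and m: "\<bar>m' - m\<bar> \<le> q * u * \<delta> / \<epsilon>"
    and Fb: "norm F \<le> r * u / \<epsilon>" and ma: "a * u \<le> m" and small: "q * (\<delta> / \<epsilon>) \<le> a / 2"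
  shows "a / 2 * u \<le> m'"
    and "norm (F' /\<^sub>R m' - F /\<^sub>R m) \<le> (2 * p / a + 2 * q * r / a\<^sup>2) * (\<delta> / \<epsilon>\<^sup>2)"
proof -
  have "q * (\<delta> / \<epsilon>) * u \<le> a / 2 * u" using small u by (intro mult_right_mono) auto
  then have "q * u * \<delta> / \<epsilon> \<le> a / 2 * u" by (simp add: mult.commute mult.left_commute)
  then show m': "a / 2 * u \<le> m'" using m ma by linarith
  have au: "0 < a * u" "0 < a / 2 * u" using a u by simp_all
  have mp: "0 < m" "0 < m'" using au ma m' by linarith+
  have eq: "(m - m') / (m * m') = inverse m' - inverse m" using mp by (simp add: field_simps)
  have split: "F' /\<^sub>R m' - F /\<^sub>R m = (F' - F) /\<^sub>R m' + ((m - m') / (m * m')) *\<^sub>R F"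
    unfolding eq by (simp add: scaleR_diff_left scaleR_diff_right)
  have "norm (F' /\<^sub>R m' - F /\<^sub>R m) \<le> norm ((F' - F) /\<^sub>R m') + norm (((m - m') / (m * m')) *\<^sub>R F)"
    unfolding split by (rule norm_triangle_ineq)
  also have "\<dots> = norm (F' - F) / m' + \<bar>m' - m\<bar> * norm F / (m * m')"
    using mp by (simp add: abs_mult divide_inverse abs_minus_commute mult.commute mult.left_commute)
  also have "\<dots> \<le> (p * u * \<delta> / \<epsilon>\<^sup>2) / (a / 2 * u) + (q * u * \<delta> / \<epsilon>) * (r * u / \<epsilon>) / (a * u * (a / 2 * u))"
    using F m Fb ma m' au mp pqr u \<epsilon> \<delta> by (intro add_mono frac_le mult_mono) auto
  also have "\<dots> = (2 * p / a + 2 * q * r / a\<^sup>2) * (\<delta> / \<epsilon>\<^sup>2)"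
    using u a \<epsilon> by (simp add: field_simps power2_eq_square)
  finally show "norm (F' /\<^sub>R m' - F /\<^sub>R m) \<le> (2 * p / a + 2 * q * r / a\<^sup>2) * (\<delta> / \<epsilon>\<^sup>2)" .
qed

text \<open>The distance hypothesis speaks of balls centred in the support, so \<open>x\<close> must
  be placed there: if a ball around \<open>x\<close> were null, kernels supported inside it would
  have convolution 0.\<close>

lemma mass_support_if_mass_conv_pos:
  fixes \<Omega> :: "'a::euclidean_space set"
  assumes \<Omega>: "open \<Omega>" and V: "varifold d \<Omega> V" and x: "x \<in> \<Omega>"
    and zero: "\<And>t. 1 < \<bar>t\<bar> \<Longrightarrow> \<xi> t = 0"
    and pos: "\<forall>\<^sub>F \<epsilon> in at_right 0. 0 < mass_conv \<Omega> V \<xi> \<epsilon> x"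
  shows "x \<in> mass_support \<Omega> V"
proof -
  note \<mu> = radon_mass[OF \<Omega> V]
  have "emeasure (mass \<Omega> V) (ball x r \<inter> \<Omega>) \<noteq> 0" if r: "0 < r" for r
  proof
    assume z: "emeasure (mass \<Omega> V) (ball x r \<inter> \<Omega>) = 0"
    obtain b where b: "0 < b" "\<And>\<epsilon>. 0 < \<epsilon> \<Longrightarrow> \<epsilon> < b \<Longrightarrow> 0 < mass_conv \<Omega> V \<xi> \<epsilon> x"
      using pos unfolding eventually_at_right_field by blast
    define \<epsilon> where "\<epsilon> = min b r / 2"
    have \<epsilon>: "0 < \<epsilon>" "\<epsilon> < b" "\<epsilon> < r" using b r by (auto simp: \<epsilon>_def)
    have "AE y in mass \<Omega> V. y \<notin> ball x r \<inter> \<Omega>"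
      using z \<Omega> by (intro AE_not_in) (auto simp: null_sets_def radon_sets_iff[OF \<Omega> \<mu>])
    moreover have "AE y in mass \<Omega> V. y \<in> space (mass \<Omega> V)" by (rule AE_space)
    ultimately have "AE y in mass \<Omega> V. scaled_kernel \<xi> \<epsilon> (y - x) = 0"
    proof eventually_elim
      case (elim y)
      then have "\<epsilon> < norm (y - x)" using \<epsilon> by (simp add: space_radon[OF \<mu>] dist_norm norm_minus_commute)
      then show ?case by (intro scaled_kernel_zero[OF zero \<epsilon>(1)])
    qed
    then have "mass_conv \<Omega> V \<xi> \<epsilon> x = 0" unfolding mass_conv_def by (rule integral_eq_zero_AE)
    then show False using b(2)[OF \<epsilon>(1,2)] by simp
  qed
  then show ?thesis using x by (simp add: mass_support_def zero_less_iff_neq_zero)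
qed

text \<open>Here \<open>c\<close> bounds the density of \<open>\<parallel>V\<parallel>\<close> at \<open>x\<close> from above and \<open>a\<close> that
  of \<open>\<parallel>V\<parallel> \<ast> \<xi>\<^sub>\<epsilon>\<close> from below.\<close>

lemma (in c11_profile) approx_mean_curvature_diff:
  fixes \<Omega> :: "'a::euclidean_space set" and \<xi> :: "real \<Rightarrow> real"
  assumes \<Omega>: "open \<Omega>" and V: "varifold d \<Omega> V" and W: "varifold d \<Omega> W" and N: "0 < N"
    and \<xi>: "continuous_on UNIV \<xi>" "\<And>t. 1 < \<bar>t\<bar> \<Longrightarrow> \<xi> t = 0"
    and Q: "0 < Q" "\<And>s t. \<bar>\<xi> s - \<xi> t\<bar> \<le> Q * \<bar>s - t\<bar>" "\<And>t. \<bar>\<xi> t\<bar> \<le> Q"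
    and \<epsilon>: "0 < \<epsilon>" "\<epsilon> \<le> 1" and xz: "norm (x - z) < \<epsilon>" and sub: "ball x (3 * \<epsilon>) \<subseteq> \<Omega>"
    and s: "0 \<le> s" and c: "0 < c" and a: "0 < a"
    and bl: "bounded_lipschitz_dist d \<Omega> (ball x (2 * \<epsilon>)) V W \<le> ennreal (s * (c * (3 * \<epsilon>) ^ d))"
    and growth: "emeasure (mass \<Omega> V) (ball x (2 * \<epsilon>)) \<le> ennreal (c * (2 * \<epsilon>) ^ d)"
    and low: "a \<le> \<epsilon> ^ DIM('a) / \<epsilon> ^ d * mass_conv \<Omega> V \<xi> \<epsilon> x"
    and small: "Q * c * 3 ^ d * ((s + norm (x - z)) / \<epsilon>\<^sup>2) \<le> a / 2"
  shows "0 < mass_conv \<Omega> W \<xi> \<epsilon> z"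
    and "norm (approx_mean_curvature d \<Omega> W \<rho> \<xi> \<epsilon> z - approx_mean_curvature d \<Omega> V \<rho> \<xi> \<epsilon> x)
      \<le> \<bar>profile_const d \<xi> / profile_const d \<rho>\<bar> *
          (6 * real DIM('a) * c * 3 ^ d / a + 2 * Q * c * 3 ^ d * c * 2 ^ d / a\<^sup>2) * N * ((s + norm (x - z)) / \<epsilon>\<^sup>2)"
proof -
  let ?n = "DIM('a)"
  define u where "u = \<epsilon> ^ d / \<epsilon> ^ ?n"
  define \<delta> where "\<delta> = s + norm (x - z)"
  have u: "0 < u" using \<epsilon> by (simp add: u_def)
  have \<delta>: "0 \<le> \<delta>" using s by (simp add: \<delta>_def)
  define D m where "D = s * (c * (3 * \<epsilon>) ^ d)" and "m = c * (2 * \<epsilon>) ^ d"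
  have Dm: "0 \<le> D" "0 \<le> m" using s c \<epsilon> by (simp_all add: D_def m_def)
  have sub2: "ball x (2 * \<epsilon>) \<subseteq> \<Omega>" using sub \<epsilon> by (auto simp: subset_iff)
  \<comment> \<open>The mass bound is relaxed to radius \<open>3 * \<epsilon>\<close> so that
    \<open>D\<close> and the shift term combine into \<open>s + norm (x - z)\<close>.\<close>
  have tot: "D + norm (x - z) * m \<le> c * 3 ^ d * \<epsilon> ^ d * \<delta>"
  proof -
    have "m \<le> c * (3 * \<epsilon>) ^ d" unfolding m_def using c \<epsilon> by (intro mult_left_mono power_mono) auto
    then have "norm (x - z) * m \<le> norm (x - z) * (c * (3 * \<epsilon>) ^ d)" by (intro mult_left_mono) auto
    then show ?thesis by (simp add: D_def \<delta>_def power_mult_distrib algebra_simps)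
  qed
  let ?FW = "first_variation_conv W \<rho> \<epsilon> z" and ?FV = "first_variation_conv V \<rho> \<epsilon> x"
  let ?mW = "mass_conv \<Omega> W \<xi> \<epsilon> z" and ?mV = "mass_conv \<Omega> V \<xi> \<epsilon> x"
  define p q r where "p = 3 * real ?n * N * c * 3 ^ d" and "q = Q * c * 3 ^ d" and "r = N * c * 2 ^ d"
  have pqr: "0 \<le> p" "0 \<le> q" "0 \<le> r" using N c Q by (simp_all add: p_def q_def r_def)
  note fv = first_variation_conv_diff[OF \<Omega> V W N \<epsilon> xz sub2 bl[folded D_def] Dm(1) growth[folded m_def] Dm(2)]
  have "norm (?FW - ?FV) \<le> real ?n * (3 * N / \<epsilon> ^ (?n + 2)) * (D + norm (x - z) * m)" by (rule fv)
  also have "\<dots> \<le> real ?n * (3 * N / \<epsilon> ^ (?n + 2)) * (c * 3 ^ d * \<epsilon> ^ d * \<delta>)"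
    using N \<epsilon> by (intro mult_left_mono tot) auto
  also have "\<dots> = p * u * \<delta> / \<epsilon>\<^sup>2"
    by (simp add: p_def u_def power_add power2_eq_square mult_ac)
  finally have h1: "norm (?FW - ?FV) \<le> p * u * \<delta> / \<epsilon>\<^sup>2" .
  have "\<bar>?mW - ?mV\<bar> \<le> Q / \<epsilon> ^ Suc ?n * (D + norm (x - z) * m)"
    by (rule mass_conv_diff[OF \<Omega> V W \<xi> Q \<epsilon> xz sub2 bl[folded D_def] Dm(1) growth[folded m_def] Dm(2)])
  also have "\<dots> \<le> Q / \<epsilon> ^ Suc ?n * (c * 3 ^ d * \<epsilon> ^ d * \<delta>)"
    using Q \<epsilon> by (intro mult_left_mono tot) auto
  also have "\<dots> = q * u * \<delta> / \<epsilon>" by (simp add: q_def u_def mult_ac)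
  finally have h2: "\<bar>?mW - ?mV\<bar> \<le> q * u * \<delta> / \<epsilon>" .
  have h3: "norm ?FV \<le> r * u / \<epsilon>"
    using fv(2) by (simp add: m_def r_def u_def power_mult_distrib mult_ac)
  have h4: "a * u \<le> ?mV"
    using mult_right_mono[OF low, of u] u \<epsilon> by (simp add: u_def)
  \<comment> \<open>Since \<open>\<epsilon> \<le> 1\<close>, smallness of
    \<open>\<delta> / \<epsilon>\<^sup>2\<close> controls the relative denominator error, which is
    of order \<open>\<delta> / \<epsilon>\<close>.\<close>
  have "\<delta> / \<epsilon> \<le> \<delta> / \<epsilon>\<^sup>2"
    using \<epsilon> \<delta> by (intro divide_left_mono) (auto simp: power2_eq_square mult_le_one)
  then have h5: "q * (\<delta> / \<epsilon>) \<le> a / 2"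
    using small[folded q_def \<delta>_def] mult_left_mono[of "\<delta> / \<epsilon>" "\<delta> / \<epsilon>\<^sup>2" q] pqr by linarith
  note quot = quotient_diff_bound[OF u \<epsilon>(1) a \<delta> pqr h1 h2 h3 h4 h5]
  have "0 < a / 2 * u" using a u by simp
  then show "0 < ?mW" using quot(1) by linarith
  let ?P = "profile_const d \<xi> / profile_const d \<rho>"
  have "approx_mean_curvature d \<Omega> W \<rho> \<xi> \<epsilon> z - approx_mean_curvature d \<Omega> V \<rho> \<xi> \<epsilon> x
      = - (?P *\<^sub>R (?FW /\<^sub>R ?mW - ?FV /\<^sub>R ?mV))"
    by (simp add: approx_mean_curvature_def scaleR_diff_right)
  then have "norm (approx_mean_curvature d \<Omega> W \<rho> \<xi> \<epsilon> z - approx_mean_curvature d \<Omega> V \<rho> \<xi> \<epsilon> x)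
      = \<bar>?P\<bar> * norm (?FW /\<^sub>R ?mW - ?FV /\<^sub>R ?mV)"
    by (simp only: norm_minus_cancel norm_scaleR)
  also have "\<dots> \<le> \<bar>?P\<bar> * ((2 * p / a + 2 * q * r / a\<^sup>2) * (\<delta> / \<epsilon>\<^sup>2))"
    by (intro mult_left_mono quot(2)) simp
  also have "2 * p / a + 2 * q * r / a\<^sup>2
      = (6 * real ?n * c * 3 ^ d / a + 2 * Q * c * 3 ^ d * c * 2 ^ d / a\<^sup>2) * N"
    by (simp add: p_def q_def r_def distrib_left mult_ac)
  finally show "norm (approx_mean_curvature d \<Omega> W \<rho> \<xi> \<epsilon> z - approx_mean_curvature d \<Omega> V \<rho> \<xi> \<epsilon> x)
      \<le> \<bar>?P\<bar> * (6 * real ?n * c * 3 ^ d / a + 2 * Q * c * 3 ^ d * c * 2 ^ d / a\<^sup>2) * N * ((s + norm (x - z)) / \<epsilon>\<^sup>2)"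
    by (simp only: \<delta>_def mult.assoc)
qed

text \<open>The origin of the radius \<open>3 * \<epsilon>\<close>: the test functions live in
  radius \<open>2 * \<epsilon>\<close>, and thickening adds at most
  \<open>\<epsilon>\<close>.\<close>

lemma thickening_ball_subset:
  assumes "\<eta> \<le> \<epsilon>"
  shows "thickening \<eta> (ball x (2 * \<epsilon>)) \<subseteq> ball x (3 * \<epsilon>)"
proof
  fix y assume "y \<in> thickening \<eta> (ball x (2 * \<epsilon>))"
  then obtain w where "dist x w < 2 * \<epsilon>" "dist w y < \<eta>" by (auto simp: thickening_def)
  then show "y \<in> ball x (3 * \<epsilon>)" using dist_triangle[of x y w] assms by simp
qed

theorem theorem4p5:
  fixes \<Omega> M :: "'a::euclidean_space set"
    and d :: nat
    and V :: "('a \<times> ('a \<Rightarrow>\<^sub>L 'a)) measure"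
    and Vs :: "nat \<Rightarrow> ('a \<times> ('a \<Rightarrow>\<^sub>L 'a)) measure"
    and \<theta> :: "'a \<Rightarrow> real" and H :: "'a \<Rightarrow> 'a"
    and \<rho> \<xi> :: "real \<Rightarrow> real"
    and \<eta> ds :: "nat \<Rightarrow> real"
  assumes "1 \<le> d" and "d < DIM('a)"
    and "open \<Omega>"
    and "rectifiable_varifold d \<Omega> M \<theta> V"
    and "bounded_first_variation \<Omega> V"
    and "generalized_mean_curvature \<Omega> V H"
    and "kernel_profile TYPE('a) \<rho>" and "\<rho> C1_differentiable_on UNIV" and "W2_infinity \<rho>"
    and "kernel_profile TYPE('a) \<xi>" and "continuous_on UNIV \<xi>" and "W1_infinity \<xi>"
    and "\<And>i. varifold d \<Omega> (Vs i)"
    and "\<And>i. 0 < \<eta> i" and "decseq \<eta>" and "\<eta> \<longlonglongrightarrow> 0"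
    and "\<And>i. 0 < ds i" and "decseq ds" and "ds \<longlonglongrightarrow> 0"
    and "\<And>i x r. x \<in> mass_support \<Omega> V \<Longrightarrow> 0 < r \<Longrightarrow> ball x r \<subseteq> \<Omega> \<Longrightarrow>
           bounded_lipschitz_dist d \<Omega> (ball x r) V (Vs i)
             \<le> ennreal (ds i) *
                 min (emeasure (mass \<Omega> V) (thickening (\<eta> i) (ball x r) \<inter> \<Omega>))
                     (emeasure (mass \<Omega> (Vs i)) (thickening (\<eta> i) (ball x r) \<inter> \<Omega>))"
  shows "AE x in mass \<Omega> V.
           \<forall>z \<epsilon>. z \<longlonglongrightarrow> x \<and> (\<forall>i. 0 < \<epsilon> i) \<and> decseq \<epsilon> \<and> \<epsilon> \<longlonglongrightarrow> 0 \<and>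
              (\<lambda>i. (ds i + norm (x - z i)) / (\<epsilon> i)\<^sup>2) \<longlonglongrightarrow> 0 \<and>
              (\<lambda>i. \<eta> i / \<epsilon> i) \<longlonglongrightarrow> 0 \<longrightarrow>
              (\<exists>C>0. \<forall>\<^sub>F i in sequentially.
                 approx_mean_curvature_defined \<Omega> (Vs i) \<xi> (\<epsilon> i) (z i) \<and>
                 approx_mean_curvature_defined \<Omega> V \<xi> (\<epsilon> i) x \<and>
                 norm (approx_mean_curvature d \<Omega> (Vs i) \<rho> \<xi> (\<epsilon> i) (z i)
                       - approx_mean_curvature d \<Omega> V \<rho> \<xi> (\<epsilon> i) x)
                   \<le> C * W2_infinity_norm \<rho> * ((ds i + norm (x - z i)) / (\<epsilon> i)\<^sup>2)) \<and>
              (\<lambda>i. approx_mean_curvature d \<Omega> (Vs i) \<rho> \<xi> (\<epsilon> i) (z i)) \<longlonglongrightarrow> H x"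
proof -
  note \<Omega> = assms(3) and d = assms(1) and rect = assms(4) and bl = assms(20)
  have V: "varifold d \<Omega> V" using rect by (simp add: rectifiable_varifold_def)
  note \<mu> = radon_mass[OF \<Omega> V]
  define N where "N = W2_infinity_norm \<rho>"
  have N: "0 < N" unfolding N_def by (rule c11_profile_W2(2)[OF assms(7,8,9)])
  interpret c11_profile \<rho> "deriv \<rho>" N unfolding N_def by (rule c11_profile_W2(1)[OF assms(7,8,9)])
  have \<xi>0: "\<xi> t = 0" if "1 < \<bar>t\<bar>" for t using assms(10) that by (simp add: kernel_profile_def)
  \<comment> \<open>One constant for the sup bound and the Lipschitz bound of \<open>\<xi>\<close>,
    raised by 1 for positivity.\<close>
  obtain Q where Q: "0 < Q" "\<And>s t. \<bar>\<xi> s - \<xi> t\<bar> \<le> Q * \<bar>s - t\<bar>" "\<And>t. \<bar>\<xi> t\<bar> \<le> Q"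
  proof -
    obtain L B where L: "L-lipschitz_on UNIV \<xi>" and B: "\<And>t. \<bar>\<xi> t\<bar> \<le> B"
      using assms(12) unfolding W1_infinity_def bounded_iff by auto
    have L0: "0 \<le> L" using L by (rule lipschitz_on_nonneg)
    have B0: "0 \<le> B" using B[of 0] by linarith
    show thesis
    proof (rule that[of "L + B + 1"])
      show "\<bar>\<xi> s - \<xi> t\<bar> \<le> (L + B + 1) * \<bar>s - t\<bar>" for s t
      proof -
        have "\<bar>\<xi> s - \<xi> t\<bar> \<le> L * \<bar>s - t\<bar>" using lipschitz_onD[OF L, of s t] by (simp add: dist_real_def)
        also have "\<dots> \<le> (L + B + 1) * \<bar>s - t\<bar>" using B0 by (intro mult_right_mono) auto
        finally show ?thesis .
      qed
      show "\<bar>\<xi> t\<bar> \<le> L + B + 1" for t using B[of t] L0 by linarith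
    qed (use L0 B0 in simp)
  qed
  obtain \<sigma> \<nu> Z where H: "H \<in> borel_measurable (mass \<Omega> V)"
    "\<And>K. compact K \<Longrightarrow> K \<subseteq> \<Omega> \<Longrightarrow> set_integrable (mass \<Omega> V) K H"
    and \<sigma>: "radon_measure_on \<Omega> \<sigma>" "AE x in \<sigma>. norm (\<nu> x) = 1"
    and Z: "Z \<in> sets (restrict_space borel \<Omega>)" "emeasure (mass \<Omega> V) Z = 0" "emeasure \<sigma> (\<Omega> - Z) = 0"
    and fv: "\<And>X. C1_compact_support \<Omega> X \<Longrightarrow>
      first_variation V X = - (\<integral>x. X x \<bullet> H x \<partial>mass \<Omega> V) + (\<integral>x. X x \<bullet> \<nu> x \<partial>\<sigma>)"
    using assms(6) unfolding generalized_mean_curvature_def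
    by (elim conjE exE bexE) (rule that; simp)
  have Zb: "Z \<in> sets borel" "Z \<subseteq> \<Omega>" using Z(1) \<Omega> by (auto simp: sets_restrict_space_iff)
  have "AE x in mass \<Omega> V. x \<notin> Z" using Z by (intro AE_not_in) (auto simp: null_sets_def sets_mass)
  \<comment> \<open>The singular measure \<open>\<sigma>\<close> lives on the mass-null set
    \<open>Z\<close>. The complement is therefore \<open>\<sigma>\<close>-null and carries all of
    the mass.\<close>
  moreover have "AE x in mass \<Omega> V. x \<in> \<Omega> - Z \<and> growth_at d (mass \<Omega> V) x \<longrightarrow>
      (\<forall>e>0. \<forall>\<^sub>F r in at_right 0. emeasure \<sigma> (ball x r) \<le> ennreal (e * r ^ d))"
    by (rule AE_null_density[OF \<Omega> \<mu> \<sigma>(1) _ _ Z(3)]) (use \<Omega> Zb in auto)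
  moreover note rectifiable_varifold_AE[OF \<Omega> d rect]
  moreover have "AE x in mass \<Omega> V. growth_at d (mass \<Omega> V) x \<longrightarrow>
      (\<forall>e>0. \<forall>\<^sub>F r in at_right 0. (\<integral>\<^sup>+y\<in>ball x r. norm (H y - H x) \<partial>mass \<Omega> V) \<le> ennreal (e * r ^ d))"
    by (rule AE_Lebesgue_point[OF \<Omega> \<mu> H])
  ultimately show ?thesis
  proof eventually_elim
    case (elim x)
    then obtain P where x: "x \<in> \<Omega>" and \<theta>: "0 < \<theta> x" and P: "approx_tangent_space d M \<theta> x P" by blast
    have gr: "growth_at d (mass \<Omega> V) x" by (rule growth_at_approx_tangent_space[OF \<Omega> rect x P])
    have sing: "\<forall>e>0. \<forall>\<^sub>F r in at_right 0. emeasure \<sigma> (ball x r) \<le> ennreal (e * r ^ d)"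
      using elim(1,2) x gr by blast
    have leb: "\<forall>e>0. \<forall>\<^sub>F r in at_right 0. (\<integral>\<^sup>+y\<in>ball x r. norm (H y - H x) \<partial>mass \<Omega> V) \<le> ennreal (e * r ^ d)"
      using elim(4) gr by blast
    note blow = approx_mean_curvature_blowup[OF \<Omega> d rect x P \<theta> assms(7) continuous assms(10,11)
        first_variation_conv_blowup[OF \<Omega> V x H \<sigma> fv leb sing]]
    obtain a where a: "0 < a" "\<forall>\<^sub>F \<epsilon> in at_right 0. a \<le> \<epsilon> ^ DIM('a) / \<epsilon> ^ d * mass_conv \<Omega> V \<xi> \<epsilon> x"
      using blow(2) by blast
    have pos: "0 < mass_conv \<Omega> V \<xi> \<epsilon> x"
      if "0 < \<epsilon>" "a \<le> \<epsilon> ^ DIM('a) / \<epsilon> ^ d * mass_conv \<Omega> V \<xi> \<epsilon> x" for \<epsilon>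
    proof -
      have "0 < \<epsilon> ^ DIM('a) / \<epsilon> ^ d * mass_conv \<Omega> V \<xi> \<epsilon> x" using that a(1) by linarith
      moreover have "0 < \<epsilon> ^ DIM('a) / \<epsilon> ^ d" using that(1) by simp
      ultimately show ?thesis using zero_less_mult_pos by blast
    qed
    have mass_pos: "\<forall>\<^sub>F \<epsilon> in at_right 0. 0 < mass_conv \<Omega> V \<xi> \<epsilon> x"
      using a(2) eventually_at_right_less[of 0] by eventually_elim (rule pos)
    have spt: "x \<in> mass_support \<Omega> V"
      by (rule mass_support_if_mass_conv_pos[OF \<Omega> V x \<xi>0 mass_pos])
    obtain c0 where c0: "\<forall>\<^sub>F r in at_right 0. emeasure (mass \<Omega> V) (ball x r) \<le> ennreal (c0 * r ^ d)"
      using gr unfolding growth_at_def by blast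
    define c where "c = max c0 1"
    have c: "0 < c" by (simp add: c_def)
    obtain b where b: "0 < b" "\<And>r. 0 < r \<Longrightarrow> r < b \<Longrightarrow> emeasure (mass \<Omega> V) (ball x r) \<le> ennreal (c0 * r ^ d)"
      using c0 unfolding eventually_at_right_field by blast
    have growth: "emeasure (mass \<Omega> V) (ball x r) \<le> ennreal (c * r ^ d)" if "0 < r" "r < b" for r
    proof -
      have "c0 * r ^ d \<le> c * r ^ d" using that by (intro mult_right_mono) (auto simp: c_def)
      then show ?thesis using b(2)[OF that] by (meson ennreal_leI order_trans)
    qed
    obtain t where t: "0 < t" "ball x t \<subseteq> \<Omega>" using \<Omega> x openE by blast
    \<comment> \<open>\<open>C\<close> depends on the point through the density bounds
      \<open>c\<close> and \<open>a\<close>, not on the sequences. As only \<open>0 \<le> C\<close>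
      is established, the final constant is \<open>C + 1\<close>.\<close>
    define C where "C = \<bar>profile_const d \<xi> / profile_const d \<rho>\<bar> *
      (6 * real DIM('a) * c * 3 ^ d / a + 2 * Q * c * 3 ^ d * c * 2 ^ d / a\<^sup>2)"
    have C: "0 \<le> C" unfolding C_def using a(1) c Q(1) by (intro mult_nonneg_nonneg add_nonneg_nonneg divide_nonneg_nonneg) auto
    show ?case
    proof (intro allI impI, elim conjE)
      fix z :: "nat \<Rightarrow> 'a" and \<epsilon> :: "nat \<Rightarrow> real"
      assume \<epsilon>: "\<forall>i. 0 < \<epsilon> i" "\<epsilon> \<longlonglongrightarrow> 0"
        and r2: "(\<lambda>i. (ds i + norm (x - z i)) / (\<epsilon> i)\<^sup>2) \<longlonglongrightarrow> 0" and \<eta>\<epsilon>: "(\<lambda>i. \<eta> i / \<epsilon> i) \<longlonglongrightarrow> 0"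
      let ?Hi = "\<lambda>i. approx_mean_curvature d \<Omega> (Vs i) \<rho> \<xi> (\<epsilon> i) (z i)"
        and ?HV = "\<lambda>i. approx_mean_curvature d \<Omega> V \<rho> \<xi> (\<epsilon> i) x"
      have fl: "filterlim \<epsilon> (at_right 0) sequentially"
        using \<epsilon> by (auto simp: filterlim_at less_imp_neq[symmetric] intro!: always_eventually)
      \<comment> \<open>Once the ratio is below \<open>k\<close>, the denominator error stays under
        half of the lower bound \<open>a\<close>.\<close>
      define k where "k = a / (2 * (Q * c * 3 ^ d))"
      have k: "0 < k" using a Q c by (simp add: k_def)
      \<comment> \<open>\<open>3 * \<epsilon> i\<close> has to stay below the growth radius
        \<open>b\<close> and the radius \<open>t\<close> of a ball inside \<open>\<Omega>\<close>;
        the bound 1 makes powers of \<open>\<epsilon> i\<close> comparable.\<close>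
      have "\<forall>\<^sub>F i in sequentially. \<epsilon> i < Min {1, b / 3, t / 3}"
        using b t by (intro order_tendstoD(2)[OF \<epsilon>(2)]) simp
      moreover have "\<forall>\<^sub>F i in sequentially. (ds i + norm (x - z i)) / (\<epsilon> i)\<^sup>2 < min 1 k"
        using k by (intro order_tendstoD(2)[OF r2]) simp
      moreover have "\<forall>\<^sub>F i in sequentially. \<eta> i / \<epsilon> i < 1"
        by (intro order_tendstoD(2)[OF \<eta>\<epsilon>]) simp
      moreover have "\<forall>\<^sub>F i in sequentially. a \<le> \<epsilon> i ^ DIM('a) / \<epsilon> i ^ d * mass_conv \<Omega> V \<xi> (\<epsilon> i) x"
        using fl a(2) unfolding filterlim_iff by blast
      ultimately have ev: "\<forall>\<^sub>F i in sequentially.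
           approx_mean_curvature_defined \<Omega> (Vs i) \<xi> (\<epsilon> i) (z i) \<and>
           approx_mean_curvature_defined \<Omega> V \<xi> (\<epsilon> i) x \<and>
           norm (?Hi i - ?HV i)
             \<le> (C + 1) * N * ((ds i + norm (x - z i)) / (\<epsilon> i)\<^sup>2)"
      proof eventually_elim
        case (elim i)
        define e s y where "e = \<epsilon> i" and "s = ds i" and "y = z i"
        have e: "0 < e" "e < 1" "3 * e < b" "3 * e < t" using elim(1) \<epsilon>(1) by (auto simp: e_def)
        have s: "0 < s" using assms(17) by (simp add: s_def)
        have ratio: "(s + norm (x - y)) / e\<^sup>2 < 1" "(s + norm (x - y)) / e\<^sup>2 < k"
          using elim(2) by (simp_all add: e_def s_def y_def)
        have \<eta>e: "\<eta> i \<le> e" using elim(3) e(1) by (simp add: e_def)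
        \<comment> \<open>A ratio below 1 gives \<open>norm (x - y) < e\<^sup>2\<close>, and
          \<open>e < 1\<close> turns this into the closeness required of the shifted centre.\<close>
        have xy: "norm (x - y) < e"
        proof -
          have "s + norm (x - y) < e\<^sup>2" using ratio(1) e(1) by (simp add: divide_less_eq)
          moreover have "e\<^sup>2 \<le> e" using e by (simp add: power2_eq_square mult_left_le_one_le)
          ultimately show ?thesis using s by linarith
        qed
        have sub3: "ball x (3 * e) \<subseteq> \<Omega>" using e t subset_ball[of "3 * e" t x] by auto
        have sub2: "ball x (2 * e) \<subseteq> \<Omega>" using sub3 subset_ball[of "2 * e" "3 * e" x] e by auto
        have "bounded_lipschitz_dist d \<Omega> (ball x (2 * e)) V (Vs i)
            \<le> ennreal s * min (emeasure (mass \<Omega> V) (thickening (\<eta> i) (ball x (2 * e)) \<inter> \<Omega>))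
                (emeasure (mass \<Omega> (Vs i)) (thickening (\<eta> i) (ball x (2 * e)) \<inter> \<Omega>))"
          unfolding s_def by (rule bl[OF spt _ sub2]) (use e in simp)
        \<comment> \<open>The minimum is bounded by the mass of \<open>V\<close>, whose growth at
          \<open>x\<close> is known.\<close>
        also have "\<dots> \<le> ennreal s * emeasure (mass \<Omega> V) (thickening (\<eta> i) (ball x (2 * e)) \<inter> \<Omega>)"
          by (intro mult_left_mono) auto
        also have "\<dots> \<le> ennreal s * emeasure (mass \<Omega> V) (ball x (3 * e))"
          using thickening_ball_subset[OF \<eta>e, of x] sub3
          by (intro mult_left_mono emeasure_mono) (auto simp: radon_sets_iff[OF \<Omega> \<mu>])
        also have "\<dots> \<le> ennreal s * ennreal (c * (3 * e) ^ d)"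
          using e by (intro mult_left_mono growth) auto
        also have "\<dots> = ennreal (s * (c * (3 * e) ^ d))" using s by (intro ennreal_mult'[symmetric]) simp
        finally have bl': "bounded_lipschitz_dist d \<Omega> (ball x (2 * e)) V (Vs i) \<le> ennreal (s * (c * (3 * e) ^ d))" .
        have small: "Q * c * 3 ^ d * ((s + norm (x - y)) / e\<^sup>2) \<le> a / 2"
        proof -
          have "Q * c * 3 ^ d * ((s + norm (x - y)) / e\<^sup>2) \<le> Q * c * 3 ^ d * k"
            using ratio(2) Q c by (intro mult_left_mono) auto
          also have "\<dots> = a / 2" using Q c by (simp add: k_def)
          finally show ?thesis .
        qed
        have growth2: "emeasure (mass \<Omega> V) (ball x (2 * e)) \<le> ennreal (c * (2 * e) ^ d)"
          using e by (intro growth) auto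
        note est = approx_mean_curvature_diff[OF \<Omega> V assms(13) N assms(11) \<xi>0 Q e(1) less_imp_le[OF e(2)] xy sub3
            less_imp_le[OF s] c a(1) bl' growth2 elim(4)[folded e_def] small]
        have "cball y e \<subseteq> \<Omega>"
        proof
          fix w assume "w \<in> cball y e"
          then have "w \<in> ball x (2 * e)" using dist_triangle[of x w y] xy by (simp add: dist_norm)
          then show "w \<in> \<Omega>" using sub2 by blast
        qed
        then have "approx_mean_curvature_defined \<Omega> (Vs i) \<xi> e y"
          using est(1) by (simp add: approx_mean_curvature_defined_def)
        moreover have "cball x e \<subseteq> \<Omega>" using sub2 e by (auto simp: subset_iff)
        then have "approx_mean_curvature_defined \<Omega> V \<xi> e x"
          using pos[OF e(1)] elim(4) by (simp add: approx_mean_curvature_defined_def e_def)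
        moreover have "norm (approx_mean_curvature d \<Omega> (Vs i) \<rho> \<xi> e y - approx_mean_curvature d \<Omega> V \<rho> \<xi> e x)
            \<le> (C + 1) * N * ((s + norm (x - y)) / e\<^sup>2)"
        proof -
          have "C * N * ((s + norm (x - y)) / e\<^sup>2) \<le> (C + 1) * N * ((s + norm (x - y)) / e\<^sup>2)"
            using N s by (intro mult_right_mono divide_nonneg_nonneg add_nonneg_nonneg) auto
          then show ?thesis using est(2) unfolding C_def by linarith
        qed
        ultimately show ?case unfolding e_def s_def y_def by blast
      qed
      have lim0: "(\<lambda>i. (C + 1) * N * ((ds i + norm (x - z i)) / (\<epsilon> i)\<^sup>2)) \<longlonglongrightarrow> 0"
        using tendsto_mult_right_zero[OF r2, of "(C + 1) * N"] .
      have diff0: "(\<lambda>i. ?Hi i - ?HV i) \<longlonglongrightarrow> 0"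
        by (rule Lim_null_comparison[OF _ lim0]) (use ev in \<open>eventually_elim, blast\<close>)
      have "(\<lambda>i. ?HV i) \<longlonglongrightarrow> H x"
        by (rule filterlim_compose[OF blow(1) fl])
      from tendsto_add[OF diff0 this]
      have "(\<lambda>i. ?Hi i) \<longlonglongrightarrow> H x" by simp
      moreover have "0 < C + 1" using C by simp
      ultimately show "(\<exists>C>0. \<forall>\<^sub>F i in sequentially.
           approx_mean_curvature_defined \<Omega> (Vs i) \<xi> (\<epsilon> i) (z i) \<and>
           approx_mean_curvature_defined \<Omega> V \<xi> (\<epsilon> i) x \<and>
           norm (?Hi i - ?HV i)
             \<le> C * W2_infinity_norm \<rho> * ((ds i + norm (x - z i)) / (\<epsilon> i)\<^sup>2)) \<and>
         (\<lambda>i. ?Hi i) \<longlonglongrightarrow> H x"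
        using ev unfolding N_def by blast
    qed
  qed
qed

end
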